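(* Let $A$ be a ring such that $\mathcal{C}_A$ is a left Ore set and $R=Q_{l,cl}(A)$ is a left Artinian ring, and let $e=\sum_{e'\in\min\mathcal{I}'_l(R)}e'$. Then 1. $T_l(A)=\bigcap_{S'\in\mathrm{max.Den}_l(A)}S'$. 2. $\mathfrak{l}^s_A=A\cap\mathfrak{l}^s_R=A\cap\mathfrak{l}_R=A\cap(1-e)R$. 3. $Q_l^s(A)\simeq Q_l^s(R)=R/\mathfrak{l}^s_R\simeq R/(1-e)R\simeq\prod_{e'\in\min\mathcal{I}'_l(R)}R/(1-e')R\simeq\prod_{S\in\mathrm{max.Den}_l(R)}S^{-1}R\simeq\prod_{S'\in\mathrm{max.Den}_l(A)}S'^{-1}A$.
   Context: Rings are associative with $1$ and nonzero. For any ring $B$: a multiplicative subset $S$ of $B$ is a submonoid of $(B,\cdot)$ with $1\in S$, $0\notin S$. It is a left Ore set if $Sr\cap Bs\neq\emptyset$ for all $r\in B$, $s\in S$; then $\mathrm{ass}(S):=\{r\in B\mid sr=0 \text{ for some } s\in S\}$ is an ideal. A left Ore set $S$ is a left denominator set if $rs=0$ with $r\in B$, $s\in S$ implies $r\in\mathrm{ass}(S)$. $\mathrm{Den}_l(B)$ is the set of left denominator sets of $B$; for $S\in\mathrm{Den}_l(B)$, $S^{-1}B=\{s^{-1}r\mid s\in S,r\in B\}$ is the left localization. $\mathrm{max.Den}_l(B)$ is the (non-empty) set of elements of $\mathrm{Den}_l(B)$ maximal under inclusion. $\mathcal{L}^s_l(B):=\bigcap_{S\in \mathrm{max.Den}_l(B)}S$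 and $\mathfrak{l}_B:=\bigcap_{S\in\mathrm{max.Den}_l(B)}\mathrm{ass}(S)$. $T_l(B)$ is the union of all $S\in\mathrm{Den}_l(B)$ with $S\subseteq\mathcal{L}^s_l(B)$; it is the largest left denominator set of $B$ contained in $\mathcal{L}^s_l(B)$. $Q_l^s(B):=T_l(B)^{-1}B$ and $\mathfrak{l}^s_B:=\mathrm{ass}(T_l(B))$. $\mathcal{C}_A$ is the set of regular elements (non-zero-divisors) of $A$, $Q_{l,cl}(A):=\mathcal{C}_A^{-1}A$, and $A$ is identified with its image in $R=Q_{l,cl}(A)$ under the injection $a\mapsto\frac{a}{1}$. For the left Artinian ring $R$ with (Jacobson) radical $\mathrm{rad}(R)$, write $\overline{R}:=R/\mathrm{rad}(R)=\prod_{i=1}^s\overline{R}_i$, a product of simple Artinian rings, let $\overline{1}_i$ be the identity element of $\overline{R}_i$, and fix a decomposition $1=\sum_{i=1}^s1_i$ into orthogonal idempotents of $R$ such that $1_i$ lifts $\overline{1}_i$. For a non-empty subset $I\subseteq\{1,\ldots,s\}$ put $e_I:=\sum_{i\in I}1_i$, and let $\mathcal{I}'_l(R):=\{e_I\mid e_IR(1-e_I)=0\}$, partially ordered by $e_I\leq e_J$ iff $I\subseteq J$. $\min\mathcal{I}'_l(R)$ is its set of minimal elements. (For $e'\in\mathcal{I}'_l(R)$, $(1-e')R$ is a two-sided ideal.) The equality $Q_l^s(R)=R/\mathfrak{l}^s_R$ means that the canonical map $R/\mathfrak{l}^s_R\to Q_l^s(R)$ is an isomorphism. *)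

theory Defs
  imports "HOL-Algebra.QuotRing"
begin

definition multiplicative_subset :: "('a, 'm) ring_scheme \<Rightarrow> 'a set \<Rightarrow> bool" where
  "multiplicative_subset B S \<longleftrightarrow> submonoid S B \<and> \<zero>\<^bsub>B\<^esub> \<notin> S"

definition left_Ore_set :: "('a, 'm) ring_scheme \<Rightarrow> 'a set \<Rightarrow> bool" where
  "left_Ore_set B S \<longleftrightarrow> multiplicative_subset B S \<and>
     (\<forall>r\<in>carrier B. \<forall>s\<in>S. (S #>\<^bsub>B\<^esub> r) \<inter> (carrier B #>\<^bsub>B\<^esub> s) \<noteq> {})"

definition ass :: "('a, 'm) ring_scheme \<Rightarrow> 'a set \<Rightarrow> 'a set" where
  "ass B S = {r \<in> carrier B. \<exists>s\<in>S. s \<otimes>\<^bsub>B\<^esub> r = \<zero>\<^bsub>B\<^esub>}"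

definition Den_l :: "('a, 'm) ring_scheme \<Rightarrow> 'a set set" where
  "Den_l B = {S. left_Ore_set B S \<and>
     (\<forall>r\<in>carrier B. \<forall>s\<in>S. r \<otimes>\<^bsub>B\<^esub> s = \<zero>\<^bsub>B\<^esub> \<longrightarrow> r \<in> ass B S)}"

definition max_Den_l :: "('a, 'm) ring_scheme \<Rightarrow> 'a set set" where
  "max_Den_l B = {S \<in> Den_l B. \<forall>S'\<in>Den_l B. S \<subseteq> S' \<longrightarrow> S' = S}"

text \<open>
  The ring \<open>S\<^sup>-\<^sup>1 B\<close> is built from pairs \<open>(s, r)\<close>, read as the left fraction \<open>s\<^sup>-\<^sup>1 r\<close>. Two fractions are
  equal if they can be expanded (by multiplying numerator and denominator from the left) to a common
  fraction with denominator in \<open>S\<close>; the expansion factors need not lie in \<open>S\<close>.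
\<close>

definition frac_rel :: "('a, 'm) ring_scheme \<Rightarrow> 'a set \<Rightarrow> (('a \<times> 'a) \<times> ('a \<times> 'a)) set" where
  "frac_rel B S = {((s, r), (s', r')). s \<in> S \<and> r \<in> carrier B \<and> s' \<in> S \<and> r' \<in> carrier B \<and>
     (\<exists>c\<in>carrier B. \<exists>d\<in>carrier B. c \<otimes>\<^bsub>B\<^esub> s \<in> S \<and>
        c \<otimes>\<^bsub>B\<^esub> s = d \<otimes>\<^bsub>B\<^esub> s' \<and> c \<otimes>\<^bsub>B\<^esub> r = d \<otimes>\<^bsub>B\<^esub> r')}"

definition frac :: "('a, 'm) ring_scheme \<Rightarrow> 'a set \<Rightarrow> 'a \<Rightarrow> 'a \<Rightarrow> ('a \<times> 'a) set" where
  "frac B S s r = frac_rel B S `` {(s, r)}"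

text \<open>
  Products: if \<open>t r = a s'\<close> with \<open>t \<in> S\<close>, then \<open>r s'\<^sup>-\<^sup>1 = t\<^sup>-\<^sup>1 a\<close>, so
  \<open>(s\<^sup>-\<^sup>1 r) (s'\<^sup>-\<^sup>1 r') = (t s)\<^sup>-\<^sup>1 (a r')\<close>. Sums are formed over a common denominator
  \<open>c s = d s' \<in> S\<close>. The unions below range over all choices of representatives and of
  \<open>t, a, c, d\<close>; if \<open>S\<close> is a left denominator set, all these choices give one and the same class.
\<close>

definition left_localization ::
    "('a, 'm) ring_scheme \<Rightarrow> 'a set \<Rightarrow> ('a \<times> 'a) set ring" where
  "left_localization B S =
     \<lparr>carrier = (S \<times> carrier B) // frac_rel B S,
      mult = (\<lambda>X Y. \<Union>{frac B S (t \<otimes>\<^bsub>B\<^esub> s) (a \<otimes>\<^bsub>B\<^esub> r') | s r s' r' t a.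
                (s, r) \<in> X \<and> (s', r') \<in> Y \<and> t \<in> S \<and> a \<in> carrier B \<and>
                t \<otimes>\<^bsub>B\<^esub> r = a \<otimes>\<^bsub>B\<^esub> s'}),
      one = frac B S \<one>\<^bsub>B\<^esub> \<one>\<^bsub>B\<^esub>,
      zero = frac B S \<one>\<^bsub>B\<^esub> \<zero>\<^bsub>B\<^esub>,
      add = (\<lambda>X Y. \<Union>{frac B S (c \<otimes>\<^bsub>B\<^esub> s) ((c \<otimes>\<^bsub>B\<^esub> r) \<oplus>\<^bsub>B\<^esub> (d \<otimes>\<^bsub>B\<^esub> r')) | s r s' r' c d.
                (s, r) \<in> X \<and> (s', r') \<in> Y \<and> c \<in> carrier B \<and> d \<in> carrier B \<and>
                c \<otimes>\<^bsub>B\<^esub> s \<in> S \<and> c \<otimes>\<^bsub>B\<^esub> s = d \<otimes>\<^bsub>B\<^esub> s'})\<rparr>"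

definition loc_map :: "('a, 'm) ring_scheme \<Rightarrow> 'a set \<Rightarrow> 'a \<Rightarrow> ('a \<times> 'a) set" where
  "loc_map B S r = frac B S \<one>\<^bsub>B\<^esub> r"

definition regular_elements :: "('a, 'm) ring_scheme \<Rightarrow> 'a set" where
  "regular_elements B = {c \<in> carrier B. \<forall>r\<in>carrier B.
     (c \<otimes>\<^bsub>B\<^esub> r = \<zero>\<^bsub>B\<^esub> \<longrightarrow> r = \<zero>\<^bsub>B\<^esub>) \<and> (r \<otimes>\<^bsub>B\<^esub> c = \<zero>\<^bsub>B\<^esub> \<longrightarrow> r = \<zero>\<^bsub>B\<^esub>)}"

definition Q_lcl :: "('a, 'm) ring_scheme \<Rightarrow> ('a \<times> 'a) set ring" where
  "Q_lcl B = left_localization B (regular_elements B)"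

definition L_ls :: "('a, 'm) ring_scheme \<Rightarrow> 'a set" where
  "L_ls B = (\<Inter>S\<in>max_Den_l B. S)"

definition l_rad :: "('a, 'm) ring_scheme \<Rightarrow> 'a set" where
  "l_rad B = (\<Inter>S\<in>max_Den_l B. ass B S)"

definition T_l :: "('a, 'm) ring_scheme \<Rightarrow> 'a set" where
  "T_l B = \<Union>{S \<in> Den_l B. S \<subseteq> L_ls B}"

definition Q_ls :: "('a, 'm) ring_scheme \<Rightarrow> ('a \<times> 'a) set ring" where
  "Q_ls B = left_localization B (T_l B)"

definition ls_rad :: "('a, 'm) ring_scheme \<Rightarrow> 'a set" where
  "ls_rad B = ass B (T_l B)"

definition left_ideal :: "'a set \<Rightarrow> ('a, 'm) ring_scheme \<Rightarrow> bool" where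
  "left_ideal I R \<longleftrightarrow> additive_subgroup I R \<and>
     (\<forall>a\<in>I. \<forall>x\<in>carrier R. x \<otimes>\<^bsub>R\<^esub> a \<in> I)"

definition left_artinian :: "('a, 'm) ring_scheme \<Rightarrow> bool" where
  "left_artinian R \<longleftrightarrow> ring R \<and>
     (\<forall>I :: nat \<Rightarrow> 'a set. (\<forall>n. left_ideal (I n) R \<and> I (Suc n) \<subseteq> I n) \<longrightarrow>
        (\<exists>N. \<forall>n\<ge>N. I n = I N))"

definition simple_ring :: "('a, 'm) ring_scheme \<Rightarrow> bool" where
  "simple_ring R \<longleftrightarrow> ring R \<and> \<one>\<^bsub>R\<^esub> \<noteq> \<zero>\<^bsub>R\<^esub> \<and>
     (\<forall>I. ideal I R \<longrightarrow> I = {\<zero>\<^bsub>R\<^esub>} \<or> I = carrier R)"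

definition maximal_left_ideal :: "'a set \<Rightarrow> ('a, 'm) ring_scheme \<Rightarrow> bool" where
  "maximal_left_ideal M R \<longleftrightarrow> left_ideal M R \<and> M \<noteq> carrier R \<and>
     (\<forall>I. left_ideal I R \<and> M \<subseteq> I \<longrightarrow> I = M \<or> I = carrier R)"

definition jacobson_radical :: "('a, 'm) ring_scheme \<Rightarrow> 'a set" where
  "jacobson_radical R = {x \<in> carrier R. \<forall>M. maximal_left_ideal M R \<longrightarrow> x \<in> M}"

definition product_ring :: "'i set \<Rightarrow> ('i \<Rightarrow> ('a, 'm) ring_scheme) \<Rightarrow> ('i \<Rightarrow> 'a) ring" where
  "product_ring I F =
     \<lparr>carrier = (\<Pi>\<^sub>E i\<in>I. carrier (F i)),
      mult = (\<lambda>x y. \<lambda>i\<in>I. x i \<otimes>\<^bsub>F i\<^esub> y i),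
      one = (\<lambda>i\<in>I. \<one>\<^bsub>F i\<^esub>),
      zero = (\<lambda>i\<in>I. \<zero>\<^bsub>F i\<^esub>),
      add = (\<lambda>x y. \<lambda>i\<in>I. x i \<oplus>\<^bsub>F i\<^esub> y i)\<rparr>"

text \<open>
  The datum \<open>h\<close> is the identification of \<open>R / rad(R)\<close> with a finite product of simple left Artinian
  rings \<open>Rb 1, \<dots>, Rb s\<close>; under it the identity element of the \<open>i\<close>-th factor is the family that is
  one at \<open>i\<close> and zero elsewhere.
\<close>

definition wedderburn_decomposition ::
    "('a, 'm) ring_scheme \<Rightarrow> nat \<Rightarrow> (nat \<Rightarrow> 'b ring) \<Rightarrow> ('a set \<Rightarrow> nat \<Rightarrow> 'b) \<Rightarrow> bool" where
  "wedderburn_decomposition R s Rb h \<longleftrightarrow>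
     (\<forall>i\<in>{1..s}. simple_ring (Rb i) \<and> left_artinian (Rb i)) \<and>
     h \<in> ring_iso (R Quot jacobson_radical R) (product_ring {1..s} Rb)"

definition orthogonal_idempotents :: "('a, 'm) ring_scheme \<Rightarrow> nat \<Rightarrow> (nat \<Rightarrow> 'a) \<Rightarrow> bool" where
  "orthogonal_idempotents R s u \<longleftrightarrow>
     (\<forall>i\<in>{1..s}. u i \<in> carrier R) \<and>
     (\<forall>i\<in>{1..s}. \<forall>j\<in>{1..s}. u i \<otimes>\<^bsub>R\<^esub> u j = (if i = j then u i else \<zero>\<^bsub>R\<^esub>))"

definition lifts_identities ::
    "('a, 'm) ring_scheme \<Rightarrow> nat \<Rightarrow> (nat \<Rightarrow> 'b ring) \<Rightarrow> ('a set \<Rightarrow> nat \<Rightarrow> 'b) \<Rightarrow> (nat \<Rightarrow> 'a) \<Rightarrow> bool" where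
  "lifts_identities R s Rb h u \<longleftrightarrow>
     (\<forall>i\<in>{1..s}. h (jacobson_radical R +>\<^bsub>R\<^esub> u i) =
        (\<lambda>j\<in>{1..s}. if j = i then \<one>\<^bsub>Rb j\<^esub> else \<zero>\<^bsub>Rb j\<^esub>))"

definition idem_sum :: "('a, 'm) ring_scheme \<Rightarrow> (nat \<Rightarrow> 'a) \<Rightarrow> nat set \<Rightarrow> 'a" where
  "idem_sum R u I = (\<Oplus>\<^bsub>R\<^esub>i\<in>I. u i)"

definition I'_l :: "('a, 'm) ring_scheme \<Rightarrow> nat \<Rightarrow> (nat \<Rightarrow> 'a) \<Rightarrow> 'a set" where
  "I'_l R s u = {idem_sum R u I | I. I \<noteq> {} \<and> I \<subseteq> {1..s} \<and>
     (\<forall>r\<in>carrier R. idem_sum R u I \<otimes>\<^bsub>R\<^esub> r \<otimes>\<^bsub>R\<^esub> (\<one>\<^bsub>R\<^esub> \<ominus>\<^bsub>R\<^esub> idem_sum R u I) = \<zero>\<^bsub>R\<^esub>)}"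

definition idem_le :: "('a, 'm) ring_scheme \<Rightarrow> nat \<Rightarrow> (nat \<Rightarrow> 'a) \<Rightarrow> 'a \<Rightarrow> 'a \<Rightarrow> bool" where
  "idem_le R s u e f \<longleftrightarrow> (\<exists>I J. I \<noteq> {} \<and> I \<subseteq> J \<and> J \<subseteq> {1..s} \<and>
     e = idem_sum R u I \<and> f = idem_sum R u J)"

definition min_I'_l :: "('a, 'm) ring_scheme \<Rightarrow> nat \<Rightarrow> (nat \<Rightarrow> 'a) \<Rightarrow> 'a set" where
  "min_I'_l R s u = {e \<in> I'_l R s u. \<forall>f\<in>I'_l R s u. idem_le R s u f e \<longrightarrow> f = e}"

definition idem_compl_ideal :: "('a, 'm) ring_scheme \<Rightarrow> 'a \<Rightarrow> 'a set" where
  "idem_compl_ideal R e = (\<one>\<^bsub>R\<^esub> \<ominus>\<^bsub>R\<^esub> e) <#\<^bsub>R\<^esub> carrier R"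

end

(*
Let R be left Artinian. If S is a left denominator set of R, the right annihilators of its elements
form a directed family with ascending chain condition, so ass(S) is the right annihilator of one
s in S. As s is a unit modulo ass(S), this gives ass(S) = (1 - f)R for an idempotent f with
fR(1 - f) = 0, and S consists of units modulo (1 - f)R. Conversely, for every such f /= 0 the units
modulo (1 - f)R form a left denominator set with localization R/(1 - f)R. Modulo the radical f becomes
a sum of some of the central idempotents, and since an idempotent in the radical vanishes,
(1 - f)R = (1 - e_I)R for some I. Hence max.Den_l(R) corresponds to the minimal e_I, which are
orthogonal, and the Chinese remainder theorem gives the product decomposition.

The same description holds for A: if S' is a left denominator set of A, the descending chain
condition makes R ass(S') a two-sided ideal of R, and S' becomes a set of units modulo it. So all
statements are proved for an arbitrary left order in R and used for A and for R itself.
*)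

theory Submission
  imports Defs
begin

text \<open>A right semicentral idempotent is not determined by its ideal (1 - f)R: two of them with
  the same ideal only satisfy fg = f and gf = g. Hence ideals rather than idempotents are compared
  throughout, and f is replaced by a sum of lifted idempotents only up to its right annihilator.

  For a left order A there are two obstacles. First, f need not lie in A; it is replaced by
  multiples v f that do, with v a unit of R, and these still kill (1 - f)R. Second, the fractions
  with numerator in ass(S') form a left ideal I of R that is visibly stable under right
  multiplication by A only; stability under the inverse of a denominator c comes from the chain I
  c^n, which becomes stationary.

  Localizations are defined by unions over all representatives, so their ring laws are awkward to
  check. Instead each one is compared with a quotient of R, known to be a ring, and chains of
  isomorphisms are composed starting from such quotients.\<close>

section \<open>Left Artinian rings\<close>

context ring
begin

section \<open>Left ideals\<close>

lemma minus_eq_zero_iff: "x \<in> carrier R \<Longrightarrow> y \<in> carrier R \<Longrightarrow> x \<ominus> y = \<zero> \<longleftrightarrow> x = y"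
  by (metis a_inv_closed minus_eq minus_equality minus_minus r_neg)

lemma left_idealI:
  assumes "I \<subseteq> carrier R" "\<zero> \<in> I"
    and "\<And>x y. x \<in> I \<Longrightarrow> y \<in> I \<Longrightarrow> x \<oplus> y \<in> I"
    and l: "\<And>r x. r \<in> carrier R \<Longrightarrow> x \<in> I \<Longrightarrow> r \<otimes> x \<in> I"
  shows "left_ideal I R"
proof -
  have "\<ominus> x \<in> I" if "x \<in> I" for x
    using l[OF a_inv_closed[OF one_closed] that] that assms(1) by (auto simp: l_minus)
  then have "subgroup I (add_monoid R)"
    using assms by (intro add.subgroupI) auto
  then show ?thesis
    using l by (auto simp: left_ideal_def additive_subgroup_def)
qed

lemma left_idealD:
  assumes "left_ideal I R"
  shows "I \<subseteq> carrier R" "\<zero> \<in> I"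
    and "\<And>x y. x \<in> I \<Longrightarrow> y \<in> I \<Longrightarrow> x \<oplus> y \<in> I"
    and "\<And>r x. r \<in> carrier R \<Longrightarrow> x \<in> I \<Longrightarrow> r \<otimes> x \<in> I"
    and "\<And>x y. x \<in> I \<Longrightarrow> y \<in> I \<Longrightarrow> x \<ominus> y \<in> I"
  using assms additive_subgroup.a_subset[of I R] additive_subgroup.zero_closed[of I R]
    additive_subgroup.a_closed[of I R] additive_subgroup.a_inv_closed[of I R]
  by (auto simp: left_ideal_def minus_eq intro: abelian_group_axioms)

lemma ideal_of_left_ideal:
  assumes "left_ideal I R" "\<And>r x. r \<in> carrier R \<Longrightarrow> x \<in> I \<Longrightarrow> x \<otimes> r \<in> I"
  shows "ideal I R"
  using assms unfolding left_ideal_def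
  by (intro idealI ring_axioms additive_subgroup.a_subgroup) auto

lemma ideal_imp_left_ideal: "ideal I R \<Longrightarrow> left_ideal I R"
  by (simp add: left_ideal_def ideal.axioms(1) ideal.I_l_closed)

text \<open>Preimage in \<open>R\<close> of the units of \<open>R Quot I\<close>. Working with
  representatives keeps calculations in \<open>R\<close> and makes monotonicity in \<open>I\<close>
  immediate.\<close>

definition units_modulo :: "'a set \<Rightarrow> 'a set" where
  "units_modulo I = {c \<in> carrier R. \<exists>t \<in> carrier R. t \<otimes> c \<ominus> \<one> \<in> I \<and> c \<otimes> t \<ominus> \<one> \<in> I}"

lemma units_modulo_mono: "I \<subseteq> J \<Longrightarrow> units_modulo I \<subseteq> units_modulo J"
  unfolding units_modulo_def by blast

lemma units_modulo_mult:
  assumes "ideal I R" "c \<in> units_modulo I" "d \<in> units_modulo I"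
  shows "c \<otimes> d \<in> units_modulo I"
proof -
  interpret I: ideal I R by fact
  obtain t where t: "t \<in> carrier R" "t \<otimes> c \<ominus> \<one> \<in> I" "c \<otimes> t \<ominus> \<one> \<in> I" and c: "c \<in> carrier R"
    using assms(2) unfolding units_modulo_def by blast
  obtain s where s: "s \<in> carrier R" "s \<otimes> d \<ominus> \<one> \<in> I" "d \<otimes> s \<ominus> \<one> \<in> I" and d: "d \<in> carrier R"
    using assms(3) unfolding units_modulo_def by blast
  have "s \<otimes> (t \<otimes> c \<ominus> \<one>) \<otimes> d \<oplus> (s \<otimes> d \<ominus> \<one>) \<in> I"
    using s t c d by (intro I.a_closed I.I_l_closed I.I_r_closed)
  moreover have "s \<otimes> (t \<otimes> c \<ominus> \<one>) \<otimes> d \<oplus> (s \<otimes> d \<ominus> \<one>) = (s \<otimes> t) \<otimes> (c \<otimes> d) \<ominus> \<one>"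
    using s(1) t(1) c d by algebra
  moreover have "c \<otimes> (d \<otimes> s \<ominus> \<one>) \<otimes> t \<oplus> (c \<otimes> t \<ominus> \<one>) \<in> I"
    using s t c d by (intro I.a_closed I.I_l_closed I.I_r_closed)
  moreover have "c \<otimes> (d \<otimes> s \<ominus> \<one>) \<otimes> t \<oplus> (c \<otimes> t \<ominus> \<one>) = (c \<otimes> d) \<otimes> (s \<otimes> t) \<ominus> \<one>"
    using s(1) t(1) c d by algebra
  ultimately show ?thesis
    unfolding units_modulo_def using s(1) t(1) c d by fastforce
qed

lemma Units_subset_units_modulo:
  assumes "left_ideal I R"
  shows "Units R \<subseteq> units_modulo I"
proof
  fix c assume c: "c \<in> Units R"
  then have "inv c \<otimes> c \<ominus> \<one> \<in> I" "c \<otimes> inv c \<ominus> \<one> \<in> I"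
    using left_idealD(2)[OF assms] by (simp_all add: minus_eq r_neg)
  then show "c \<in> units_modulo I"
    using c unfolding units_modulo_def by blast
qed

section \<open>The descending chain condition\<close>

lemma left_artinian_minimal:
  assumes art: "left_artinian R" and "F \<noteq> {}" and F: "\<And>I. I \<in> F \<Longrightarrow> left_ideal I R"
  obtains I where "I \<in> F" "\<And>J. J \<in> F \<Longrightarrow> J \<subseteq> I \<Longrightarrow> J = I"
proof (rule ccontr)
  assume "\<not> thesis"
  then have "\<forall>I\<in>F. \<exists>J\<in>F. J \<subset> I"
    using that by blast
  then obtain g where g: "\<And>I. I \<in> F \<Longrightarrow> g I \<in> F \<and> g I \<subset> I"
    by metis
  obtain I0 where I0: "I0 \<in> F" using assms(2) by blast
  define I where "I n = (g ^^ n) I0" for n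
  have IF: "I n \<in> F" for n
    unfolding I_def using I0 g by (induction n) auto
  have less: "I (Suc n) \<subset> I n" for n
    using g[OF IF[of n]] by (simp add: I_def)
  have "\<forall>n. left_ideal (I n) R \<and> I (Suc n) \<subseteq> I n"
    using IF F less by blast
  then obtain N where "\<forall>n\<ge>N. I n = I N"
    using art unfolding left_artinian_def by blast
  then show False using less[of N] by (metis le_SucI order_refl psubset_eq)
qed

lemma left_artinian_chain:
  assumes "left_artinian R" "\<And>n :: nat. left_ideal (I n) R" "\<And>n. I (Suc n) \<subseteq> I n"
  obtains N where "I (Suc N) = I N"
  using assms unfolding left_artinian_def by (meson le_SucI order_refl)

text \<open>Right multiplication by such an \<open>x\<close> is an injective endomorphism of the left Artinian
  module \<open>R / I\<close>, hence bijective.\<close>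

lemma left_artinian_unit_modulo:
  assumes art: "left_artinian R" and I: "ideal I R" and x: "x \<in> carrier R"
    and inj: "\<And>y. y \<in> carrier R \<Longrightarrow> y \<otimes> x \<in> I \<Longrightarrow> y \<in> I"
  shows "x \<in> units_modulo I"
proof -
  interpret I: ideal I R by fact
  note Ic [simp] = I.a_Hcarr
  \<comment> \<open>\<open>J n\<close> is the left ideal R x^n + I; a stationary step puts x^N into
    R x^(N+1) + I.\<close>
  define J where "J n = {z \<in> carrier R. \<exists>y\<in>carrier R. z \<ominus> y \<otimes> x [^] n \<in> I}" for n :: nat
  have J: "left_ideal (J n) R" for n
  proof (rule left_idealI)
    have "\<zero> \<ominus> \<zero> \<otimes> x [^] n = \<zero>" using x by (simp add: minus_eq)
    then show "\<zero> \<in> J n" unfolding J_def by (metis (no_types, lifting) I.zero_closed mem_Collect_eq zero_closed)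
  next
    fix z w assume "z \<in> J n" "w \<in> J n"
    then obtain a b where *: "z \<in> carrier R" "w \<in> carrier R" "a \<in> carrier R" "b \<in> carrier R"
      "z \<ominus> a \<otimes> x [^] n \<in> I" "w \<ominus> b \<otimes> x [^] n \<in> I" unfolding J_def by blast
    have "z \<oplus> w \<ominus> (a \<oplus> b) \<otimes> x [^] n = (z \<ominus> a \<otimes> x [^] n) \<oplus> (w \<ominus> b \<otimes> x [^] n)"
      using *(1-4) nat_pow_closed[OF x, of n] by algebra
    then have "z \<oplus> w \<ominus> (a \<oplus> b) \<otimes> x [^] n \<in> I" using *(5,6) by auto
    then show "z \<oplus> w \<in> J n" unfolding J_def using *(1-4) by blast
  next
    fix r z assume r: "r \<in> carrier R" and "z \<in> J n"
    then obtain a where *: "z \<in> carrier R" "a \<in> carrier R"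
      "z \<ominus> a \<otimes> x [^] n \<in> I" unfolding J_def by blast
    have "r \<otimes> z \<ominus> (r \<otimes> a) \<otimes> x [^] n = r \<otimes> (z \<ominus> a \<otimes> x [^] n)"
      using *(1,2) r nat_pow_closed[OF x, of n] by algebra
    then have "r \<otimes> z \<ominus> (r \<otimes> a) \<otimes> x [^] n \<in> I" using *(3) r I.I_l_closed by auto
    then show "r \<otimes> z \<in> J n" unfolding J_def using *(1-2) r by blast
  qed (auto simp: J_def)
  have dec: "J (Suc n) \<subseteq> J n" for n
  proof
    fix z assume "z \<in> J (Suc n)"
    then obtain y where y: "z \<in> carrier R" "y \<in> carrier R" "z \<ominus> y \<otimes> x [^] Suc n \<in> I"
      unfolding J_def by blast
    moreover have "y \<otimes> x [^] Suc n = (y \<otimes> x) \<otimes> x [^] n"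
      using x y(2) nat_pow_Suc2[OF x] by (simp add: m_assoc)
    ultimately show "z \<in> J n" unfolding J_def using x by (metis (mono_tags, lifting) m_closed mem_Collect_eq)
  qed
  obtain N where N: "J (Suc N) = J N" using left_artinian_chain[of J] art J dec by blast
  have "x [^] N \<ominus> \<one> \<otimes> x [^] N = \<zero>" using x by (simp add: minus_eq r_neg)
  then have "x [^] N \<in> J N" unfolding J_def using x by (metis (mono_tags, lifting) I.zero_closed mem_Collect_eq nat_pow_closed one_closed)
  then obtain y where y: "y \<in> carrier R" "x [^] N \<ominus> y \<otimes> x [^] Suc N \<in> I"
    unfolding N[symmetric] unfolding J_def by blast
  have fact: "x [^] N \<ominus> y \<otimes> x [^] Suc N = (\<one> \<ominus> y \<otimes> x) \<otimes> x [^] N"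
    unfolding nat_pow_Suc2[OF x] using x y(1) nat_pow_closed[OF x, of N] by algebra
  have cancel: "z \<in> I" if "z \<in> carrier R" "z \<otimes> x [^] n \<in> I" for z and n :: nat
    using that
  proof (induction n)
    case (Suc n)
    then have "(z \<otimes> x [^] n) \<otimes> x \<in> I" using x by (simp add: m_assoc)
    then have "z \<otimes> x [^] n \<in> I" using inj[of "z \<otimes> x [^] n"] Suc.prems(1) x by blast
    then show ?case using Suc by blast
  qed auto
  \<comment> \<open>Cancelling x^N on the right modulo \<open>I\<close> leaves a left inverse of
    \<open>x\<close> modulo \<open>I\<close>.\<close>
  have "\<one> \<ominus> y \<otimes> x \<in> I"
    using y(2) unfolding fact by (rule cancel[rotated]) (use x y(1) in blast)
  then have "\<ominus> (\<one> \<ominus> y \<otimes> x) \<in> I" by (rule I.a_inv_closed)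
  then have yx: "y \<otimes> x \<ominus> \<one> \<in> I" using x y(1) by (simp add: minus_eq minus_add a_comm)
  \<comment> \<open>The left inverse is also a right inverse: (xy - 1)x = x(yx - 1) lies in
    \<open>I\<close>, and \<open>x\<close> cancels once more.\<close>
  have "(x \<otimes> y \<ominus> \<one>) \<otimes> x = x \<otimes> (y \<otimes> x \<ominus> \<one>)" using x y(1) by (simp add: ring_simprules)
  then have "x \<otimes> y \<ominus> \<one> \<in> I" using inj[of "x \<otimes> y \<ominus> \<one>"] yx I.I_l_closed x y(1) by auto
  then show ?thesis unfolding units_modulo_def using x y(1) yx by blast
qed

text \<open>A subtraction-free form of f R (1 - f) = 0 for an idempotent f, with no reference to
  index sets. Zero qualifies, so f \<noteq> 0 appears as a separate hypothesis later.\<close>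

definition right_semicentral :: "'a \<Rightarrow> bool" where
  "right_semicentral f \<longleftrightarrow> f \<in> carrier R \<and> f \<otimes> f = f \<and> (\<forall>x\<in>carrier R. f \<otimes> x \<otimes> f = f \<otimes> x)"

abbreviation right_ann :: "'a \<Rightarrow> 'a set" where
  "right_ann x \<equiv> {y \<in> carrier R. x \<otimes> y = \<zero>}"

text \<open>Replaces the coset (1 - f)R by the kernel of left multiplication by \<open>f\<close>, so
  that membership becomes a single equation. Later arguments use this form.\<close>

lemma idem_compl_ideal_eq:
  assumes "f \<in> carrier R" "f \<otimes> f = f"
  shows "idem_compl_ideal R f = right_ann f"
proof (intro equalityI subsetI)
  fix x assume "x \<in> idem_compl_ideal R f"
  then obtain r where r: "r \<in> carrier R" "x = (\<one> \<ominus> f) \<otimes> r"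
    unfolding idem_compl_ideal_def l_coset_def by blast
  have "f \<otimes> ((\<one> \<ominus> f) \<otimes> r) = f \<otimes> r \<ominus> (f \<otimes> f) \<otimes> r" using assms(1) r(1) by algebra
  then show "x \<in> right_ann f" using assms r by (simp add: minus_eq r_neg)
next
  fix x assume x: "x \<in> right_ann f"
  have "(\<one> \<ominus> f) \<otimes> x = x \<ominus> f \<otimes> x" using assms(1) x by (simp; algebra)
  then have "x = (\<one> \<ominus> f) \<otimes> x" using x by (simp add: minus_eq)
  then show "x \<in> idem_compl_ideal R f"
    unfolding idem_compl_ideal_def l_coset_def using x by blast
qed

lemma right_semicentral_iff:
  assumes f: "f \<in> carrier R" "f \<otimes> f = f"
  shows "right_semicentral f \<longleftrightarrow> (\<forall>x\<in>carrier R. f \<otimes> x \<otimes> (\<one> \<ominus> f) = \<zero>)"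
proof -
  have "f \<otimes> x \<otimes> (\<one> \<ominus> f) = f \<otimes> x \<ominus> f \<otimes> x \<otimes> f" if "x \<in> carrier R" for x
    using that f(1) by (simp add: ring_simprules)
  then show ?thesis unfolding right_semicentral_def using f minus_eq_zero_iff by (metis m_closed)
qed

text \<open>A right annihilator is a right ideal anyway; semicentrality gives the other side, as f r
  x = (f r f) x = f r (f x).\<close>

lemma right_semicentral_ideal:
  assumes "right_semicentral f"
  shows "ideal (right_ann f) R"
proof (rule ideal_of_left_ideal)
  show "left_ideal (right_ann f) R"
  proof (rule left_idealI)
    fix r x assume r: "r \<in> carrier R" and "x \<in> right_ann f"
    then have x: "x \<in> carrier R" "f \<otimes> x = \<zero>" by auto
    have "f \<otimes> (r \<otimes> x) = f \<otimes> r \<otimes> f \<otimes> x"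
      using assms r x(1) unfolding right_semicentral_def by (simp add: m_assoc[symmetric])
    then show "r \<otimes> x \<in> right_ann f"
      using assms r x unfolding right_semicentral_def by (simp add: m_assoc)
  qed (use assms in \<open>auto simp: right_semicentral_def r_distr\<close>)
qed (use assms in \<open>auto simp: right_semicentral_def m_assoc[symmetric]\<close>)

text \<open>A congruence modulo (1 - f)R becomes an equation in \<open>R\<close> after left
  multiplication by \<open>f\<close>. Together with \<open>units_moduloI\<close> this passes between
  the two forms of invertibility.\<close>

lemma right_semicentral_units_modulo:
  assumes "right_semicentral f" "c \<in> units_modulo (right_ann f)"
  obtains t where "t \<in> carrier R" "f \<otimes> t \<otimes> c = f" "f \<otimes> c \<otimes> t = f"
proof -
  have f: "f \<in> carrier R" using assms(1) by (simp add: right_semicentral_def)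
  obtain t where t: "t \<in> carrier R" "f \<otimes> (t \<otimes> c \<ominus> \<one>) = \<zero>" "f \<otimes> (c \<otimes> t \<ominus> \<one>) = \<zero>"
    and c: "c \<in> carrier R" using assms(2) unfolding units_modulo_def by blast
  have "f \<otimes> (t \<otimes> c \<ominus> \<one>) = f \<otimes> t \<otimes> c \<ominus> f" using t(1) c f by (simp add: ring_simprules)
  moreover have "f \<otimes> (c \<otimes> t \<ominus> \<one>) = f \<otimes> c \<otimes> t \<ominus> f" using t(1) c f by (simp add: ring_simprules)
  ultimately show ?thesis
    using that[OF t(1)] t c f minus_eq_zero_iff by (metis m_closed)
qed

lemma units_moduloI:
  assumes "f \<in> carrier R" "c \<in> carrier R" "t \<in> carrier R" "f \<otimes> t \<otimes> c = f" "f \<otimes> c \<otimes> t = f"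
  shows "c \<in> units_modulo (right_ann f)"
proof -
  have "f \<otimes> (t \<otimes> c \<ominus> \<one>) = f \<otimes> t \<otimes> c \<ominus> f" using assms(1-3) by (simp add: ring_simprules)
  moreover have "f \<otimes> (c \<otimes> t \<ominus> \<one>) = f \<otimes> c \<otimes> t \<ominus> f" using assms(1-3) by (simp add: ring_simprules)
  ultimately show ?thesis
    unfolding units_modulo_def using assms by (auto simp: minus_eq r_neg)
qed

text \<open>Right annihilators satisfy the ascending chain condition in a left Artinian ring, because
  their left annihilators satisfy the descending one. So one element of \<open>units_modulo I\<close>
  annihilates all of \<open>I\<close>.\<close>

lemma left_artinian_semicentral_generator:
  assumes art: "left_artinian R" and I: "ideal I R"
    and ann: "\<And>r. r \<in> I \<Longrightarrow> \<exists>x\<in>units_modulo I. x \<otimes> r = \<zero>"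
  obtains f where "right_semicentral f" "I = right_ann f"
proof -
  interpret I: ideal I R by fact
  note Ic [simp] = I.a_Hcarr
  note LI = ideal_imp_left_ideal[OF I]
  \<comment> \<open>Taking left annihilators of the sets \<open>right_ann x\<close> reverses
    inclusion. The descending condition thus yields an \<open>x\<close> whose right annihilator no
    longer grows when \<open>x\<close> is multiplied on the left by a unit modulo
    \<open>I\<close>.\<close>
  define lann where "lann Y = {z \<in> carrier R. \<forall>y\<in>Y. z \<otimes> y = \<zero>}" for Y
  have lann: "left_ideal (lann Y) R" if "Y \<subseteq> carrier R" for Y
    unfolding lann_def using that by (intro left_idealI) (auto simp: m_assoc l_distr subset_iff)
  have Vc: "x \<in> carrier R" if "x \<in> units_modulo I" for x
    using that unfolding units_modulo_def by blast
  have "\<one> \<in> units_modulo I" using Units_subset_units_modulo[OF LI] by blast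
  then have "(\<lambda>x. lann (right_ann x)) ` units_modulo I \<noteq> {}" by blast
  moreover have "left_ideal J R" if "J \<in> (\<lambda>x. lann (right_ann x)) ` units_modulo I" for J
    using that lann by auto
  ultimately obtain L where "L \<in> (\<lambda>x. lann (right_ann x)) ` units_modulo I"
    and minL: "\<And>J. J \<in> (\<lambda>x. lann (right_ann x)) ` units_modulo I \<Longrightarrow> J \<subseteq> L \<Longrightarrow> J = L"
    by (rule left_artinian_minimal[OF art]) blast+
  then obtain x where x: "x \<in> units_modulo I" and L: "L = lann (right_ann x)" by blast
  note xc = Vc[OF x]
  have min: "lann (right_ann y) = lann (right_ann x)"
    if "y \<in> units_modulo I" "lann (right_ann y) \<subseteq> lann (right_ann x)" for y
    using minL that L by blast
  \<comment> \<open>Double annihilator: a right annihilator is recovered from its left annihilator,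
    so equality may be tested on the latter.\<close>
  have rl: "right_ann y = {r \<in> carrier R. \<forall>z\<in>lann (right_ann y). z \<otimes> r = \<zero>}" if "y \<in> carrier R" for y
    using that unfolding lann_def by blast
  \<comment> \<open>x r lies in \<open>I\<close>, so some \<open>y\<close> kills it. Then
    \<open>r\<close> lies in \<open>right_ann (y \<otimes> x)\<close>, which by the choice of
    \<open>x\<close> equals \<open>right_ann x\<close>.\<close>
  have kill: "x \<otimes> r = \<zero>" if r: "r \<in> I" for r
  proof -
    obtain y where y: "y \<in> units_modulo I" "y \<otimes> (x \<otimes> r) = \<zero>"
      using ann[OF I.I_l_closed[OF r xc]] by blast
    have "right_ann x \<subseteq> right_ann (y \<otimes> x)"
      using Vc[OF y(1)] xc by (auto simp: m_assoc)
    then have "lann (right_ann (y \<otimes> x)) \<subseteq> lann (right_ann x)" unfolding lann_def by blast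
    then have "lann (right_ann (y \<otimes> x)) = lann (right_ann x)"
      using min units_modulo_mult[OF I y(1) x] by blast
    then have "right_ann (y \<otimes> x) = right_ann x"
      using rl[of x] rl[of "y \<otimes> x"] Vc[OF y(1)] xc by simp
    moreover have "r \<in> right_ann (y \<otimes> x)"
      using y Vc[OF y(1)] xc r by (simp add: m_assoc)
    ultimately show ?thesis by blast
  qed
  obtain t where t: "t \<in> carrier R" "t \<otimes> x \<ominus> \<one> \<in> I"
    using x unfolding units_modulo_def by blast
  have xtx: "x \<otimes> t \<otimes> x = x"
  proof -
    have "x \<otimes> (t \<otimes> x \<ominus> \<one>) = x \<otimes> t \<otimes> x \<ominus> x" using t(1) xc by (simp add: ring_simprules)
    then show ?thesis using kill[OF t(2)] t(1) xc minus_eq_zero_iff by (metis m_closed)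
  qed
  \<comment> \<open>Since \<open>x\<close> kills tx - 1, \<open>t\<close> is an inner inverse of
    \<open>x\<close>; hence tx is idempotent and has the same right annihilator as
    \<open>x\<close>.\<close>
  define f where "f = t \<otimes> x"
  have f: "f \<in> carrier R" "f \<otimes> f = f"
    unfolding f_def using t(1) xc xtx by (simp_all add: m_assoc)
  have If: "I = right_ann f"
  proof (intro equalityI subsetI)
    fix y assume "y \<in> I"
    then show "y \<in> right_ann f"
      unfolding f_def using kill t(1) xc by (simp add: m_assoc)
  next
    fix y assume "y \<in> right_ann f"
    then have y: "y \<in> carrier R" "t \<otimes> x \<otimes> y = \<zero>" by (auto simp: f_def)
    have "(t \<otimes> x \<ominus> \<one>) \<otimes> y \<in> I" using t(2) y(1) I.I_r_closed by blast
    then have "\<ominus> ((t \<otimes> x \<ominus> \<one>) \<otimes> y) \<in> I" by blast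
    moreover have "\<ominus> ((t \<otimes> x \<ominus> \<one>) \<otimes> y) = y \<ominus> t \<otimes> x \<otimes> y" using t(1) xc y(1) by algebra
    ultimately show "y \<in> I" using y by (simp add: minus_eq)
  qed
  have "f \<otimes> z \<otimes> (\<one> \<ominus> f) = \<zero>" if z: "z \<in> carrier R" for z
  proof -
    have "f \<otimes> (\<one> \<ominus> f) = f \<ominus> f \<otimes> f" using f(1) by (simp add: ring_simprules)
    then have "\<one> \<ominus> f \<in> I" unfolding If using f by (simp add: minus_eq r_neg)
    then have "z \<otimes> (\<one> \<ominus> f) \<in> I" using z I.I_l_closed by blast
    then show ?thesis unfolding If using f(1) z by (simp add: m_assoc)
  qed
  then have "right_semicentral f" using right_semicentral_iff f by blast
  then show ?thesis using that If by blast
qed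

end

section \<open>Left denominator sets of a left order\<close>

text \<open>The Ore condition supplies what is not formal: a common left multiple of two
  denominators kills a sum, and replacing t r by b s gives closure under left
  multiplication.\<close>

lemma ideal_ass:
  assumes "ring A" "left_Ore_set A S"
  shows "ideal (ass A S) A"
proof -
  interpret ring A by fact
  interpret S: submonoid S A
    using assms(2) by (simp add: left_Ore_set_def multiplicative_subset_def)
  note Sc [simp] = subsetD[OF S.subset]
  have ore: "\<exists>t\<in>S. \<exists>b\<in>carrier A. t \<otimes>\<^bsub>A\<^esub> r = b \<otimes>\<^bsub>A\<^esub> s" if "r \<in> carrier A" "s \<in> S" for r s
    using assms(2) that unfolding left_Ore_set_def r_coset_def by blast
  show ?thesis
  proof (rule ideal_of_left_ideal[OF left_idealI])
    fix x y assume "x \<in> ass A S" "y \<in> ass A S"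
    then obtain s s' where s: "s \<in> S" "s' \<in> S" "s \<otimes>\<^bsub>A\<^esub> x = \<zero>\<^bsub>A\<^esub>" "s' \<otimes>\<^bsub>A\<^esub> y = \<zero>\<^bsub>A\<^esub>"
      and c: "x \<in> carrier A" "y \<in> carrier A" unfolding ass_def by blast
    obtain t b where t: "t \<in> S" "b \<in> carrier A" "t \<otimes>\<^bsub>A\<^esub> s = b \<otimes>\<^bsub>A\<^esub> s'"
      using ore[of s s'] s by auto
    have "(t \<otimes>\<^bsub>A\<^esub> s) \<otimes>\<^bsub>A\<^esub> y = \<zero>\<^bsub>A\<^esub>"
      unfolding t(3) using s t(2) c by (simp add: m_assoc)
    moreover have "(t \<otimes>\<^bsub>A\<^esub> s) \<otimes>\<^bsub>A\<^esub> x = \<zero>\<^bsub>A\<^esub>" using s t(1) c by (simp add: m_assoc)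
    ultimately have "(t \<otimes>\<^bsub>A\<^esub> s) \<otimes>\<^bsub>A\<^esub> (x \<oplus>\<^bsub>A\<^esub> y) = \<zero>\<^bsub>A\<^esub>"
      using s t(1) c by (simp add: r_distr)
    then show "x \<oplus>\<^bsub>A\<^esub> y \<in> ass A S"
      unfolding ass_def using S.m_closed[OF t(1) s(1)] c by blast
  next
    fix r x assume r: "r \<in> carrier A" and "x \<in> ass A S"
    then obtain s where s: "s \<in> S" "s \<otimes>\<^bsub>A\<^esub> x = \<zero>\<^bsub>A\<^esub>" and c: "x \<in> carrier A"
      unfolding ass_def by blast
    obtain t b where t: "t \<in> S" "b \<in> carrier A" "t \<otimes>\<^bsub>A\<^esub> r = b \<otimes>\<^bsub>A\<^esub> s"
      using ore r s by blast
    have "t \<otimes>\<^bsub>A\<^esub> (r \<otimes>\<^bsub>A\<^esub> x) = (b \<otimes>\<^bsub>A\<^esub> s) \<otimes>\<^bsub>A\<^esub> x"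
      unfolding t(3)[symmetric] using r t(1) c by (simp add: m_assoc)
    then have "t \<otimes>\<^bsub>A\<^esub> (r \<otimes>\<^bsub>A\<^esub> x) = \<zero>\<^bsub>A\<^esub>" using t(2) s c by (simp add: m_assoc)
    then show "r \<otimes>\<^bsub>A\<^esub> x \<in> ass A S"
      unfolding ass_def using t(1) r c by blast
  next
    fix r x assume "r \<in> carrier A" "x \<in> ass A S"
    moreover from this obtain s where "s \<in> S" "s \<otimes>\<^bsub>A\<^esub> x = \<zero>\<^bsub>A\<^esub>" "x \<in> carrier A"
      unfolding ass_def by blast
    moreover from calculation have "s \<otimes>\<^bsub>A\<^esub> (x \<otimes>\<^bsub>A\<^esub> r) = \<zero>\<^bsub>A\<^esub>"
      using m_assoc[of s x r] by simp
    ultimately show "x \<otimes>\<^bsub>A\<^esub> r \<in> ass A S"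
      unfolding ass_def by blast
  next
    show "\<zero>\<^bsub>A\<^esub> \<in> ass A S"
      unfolding ass_def using S.one_closed by (auto intro: S.one_closed)
  qed (auto simp: ass_def)
qed

text \<open>Each r in \<open>R\<close> is a left fraction of elements of \<open>A\<close>, embedded
  by \<open>\<phi>\<close>. Denominators are only asked to become units of \<open>R\<close>, so the
  identity map of \<open>R\<close> is an instance too, and every result applies to both
  rings.\<close>

locale left_order = R?: ring R + A: ring A
  for R (structure) and A (structure) +
  fixes \<phi>
  assumes hom: "\<phi> \<in> ring_hom A R" and inj: "inj_on \<phi> (carrier A)"
    and fraction: "r \<in> carrier R \<Longrightarrow> \<exists>c\<in>carrier A. \<phi> c \<in> Units R \<and> (\<exists>a\<in>carrier A. \<phi> c \<otimes> r = \<phi> a)"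
    and nontrivial: "\<one> \<noteq> \<zero>"
begin

sublocale phi: ring_hom_ring A R \<phi>
  using hom by (intro ring_hom_ringI2 A.ring_axioms R.ring_axioms)

lemma phi_eq_iff: "a \<in> carrier A \<Longrightarrow> b \<in> carrier A \<Longrightarrow> \<phi> a = \<phi> b \<longleftrightarrow> a = b"
  using inj by (auto dest: inj_onD)

text \<open>These sets control all others: over a left Artinian \<open>R\<close>, each left
  denominator set of \<open>A\<close> is contained in one of them with f \<noteq> 0
  (\<open>Den_l_subset_order_den\<close>).\<close>

definition order_den :: "'a \<Rightarrow> 'c set" where
  "order_den f = {a \<in> carrier A. \<phi> a \<in> units_modulo (right_ann f)}"

text \<open>Neither f nor x need come from \<open>A\<close>. Clearing first the denominator of f and
  then that of the product with x gives one unit v that serves both; v f is a unit modulo (1 - f)R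
  with inverse v^(-1), and it kills (1 - f)R outright.\<close>

lemma order_den_exists:
  assumes f: "right_semicentral f" and x: "x \<in> carrier R"
  obtains w y v where "w \<in> order_den f" "y \<in> carrier A" "v \<in> carrier R" "\<phi> w = v \<otimes> f" "\<phi> y = v \<otimes> x"
proof -
  have fc: "f \<in> carrier R" "f \<otimes> f = f" "\<And>x. x \<in> carrier R \<Longrightarrow> f \<otimes> x \<otimes> f = f \<otimes> x"
    using f by (auto simp: right_semicentral_def)
  obtain c1 x1 where 1: "c1 \<in> carrier A" "\<phi> c1 \<in> Units R" "x1 \<in> carrier A" "\<phi> c1 \<otimes> f = \<phi> x1"
    using fraction fc(1) by blast
  have "\<phi> c1 \<otimes> x \<in> carrier R" using 1 x by simp
  from fraction[OF this] obtain c2 y where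
    2: "c2 \<in> carrier A" "\<phi> c2 \<in> Units R" "y \<in> carrier A" "\<phi> c2 \<otimes> (\<phi> c1 \<otimes> x) = \<phi> y" by blast
  define v where "v = \<phi> c2 \<otimes> \<phi> c1"
  have v: "v \<in> Units R" "v \<in> carrier R" using 1 2 by (auto simp: v_def)
  have w: "\<phi> (c2 \<otimes>\<^bsub>A\<^esub> x1) = v \<otimes> f"
    using 1 2 fc(1) by (simp add: v_def m_assoc)
  have "c2 \<otimes>\<^bsub>A\<^esub> x1 \<in> order_den f"
  proof -
    have "f \<otimes> inv v \<otimes> (v \<otimes> f) = f \<otimes> (inv v \<otimes> v) \<otimes> f"
      using v fc(1) by (simp add: m_assoc del: Units_l_inv)
    then have "f \<otimes> inv v \<otimes> (v \<otimes> f) = f" using v fc by simp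
    moreover have "f \<otimes> (v \<otimes> f) \<otimes> inv v = f \<otimes> v \<otimes> f \<otimes> inv v"
      using v fc(1) by (simp add: m_assoc)
    then have "f \<otimes> (v \<otimes> f) \<otimes> inv v = f" using v fc by (simp add: m_assoc)
    ultimately have "v \<otimes> f \<in> units_modulo (right_ann f)"
      using units_moduloI[of f "v \<otimes> f" "inv v"] v fc(1) by simp
    then show ?thesis using w 1 2 by (simp add: order_den_def)
  qed
  moreover have "\<phi> y = v \<otimes> x" using 1 2 x by (simp add: v_def m_assoc)
  ultimately show ?thesis using that[of "c2 \<otimes>\<^bsub>A\<^esub> x1" y v] 2 v w by blast
qed

text \<open>If s a = 0, then f a = f t s a = 0 for an inverse t of s modulo (1 - f)R. Conversely one
  element w with image v f kills every a with f a = 0.\<close>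

lemma ass_order_den:
  assumes f: "right_semicentral f"
  shows "ass A (order_den f) = {a \<in> carrier A. f \<otimes> \<phi> a = \<zero>}"
proof (intro equalityI subsetI)
  have fc: "f \<in> carrier R" using f by (simp add: right_semicentral_def)
  fix a assume "a \<in> ass A (order_den f)"
  then obtain s where s: "s \<in> order_den f" "s \<otimes>\<^bsub>A\<^esub> a = \<zero>\<^bsub>A\<^esub>" and a: "a \<in> carrier A"
    unfolding ass_def by blast
  obtain t where t: "t \<in> carrier R" "f \<otimes> t \<otimes> \<phi> s = f" and sc: "s \<in> carrier A"
    using s(1) right_semicentral_units_modulo[OF f] unfolding order_den_def by blast
  have "f \<otimes> \<phi> a = f \<otimes> t \<otimes> \<phi> (s \<otimes>\<^bsub>A\<^esub> a)"
    using t fc sc a by (metis R.m_assoc R.m_closed phi.hom_closed phi.hom_mult)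
  then show "a \<in> {a \<in> carrier A. f \<otimes> \<phi> a = \<zero>}" using s a t fc by simp
next
  have fc: "f \<in> carrier R" using f by (simp add: right_semicentral_def)
  fix a assume a: "a \<in> {a \<in> carrier A. f \<otimes> \<phi> a = \<zero>}"
  obtain w v where w: "w \<in> order_den f" "v \<in> carrier R" "\<phi> w = v \<otimes> f"
    using order_den_exists[OF f fc] by metis
  have wc: "w \<in> carrier A" using w(1) by (simp add: order_den_def)
  have "\<phi> (w \<otimes>\<^bsub>A\<^esub> a) = \<phi> \<zero>\<^bsub>A\<^esub>" using w a wc fc by (simp add: R.m_assoc)
  then have "w \<otimes>\<^bsub>A\<^esub> a = \<zero>\<^bsub>A\<^esub>" using phi_eq_iff[of "w \<otimes>\<^bsub>A\<^esub> a" "\<zero>\<^bsub>A\<^esub>"] wc a by simp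
  then show "a \<in> ass A (order_den f)" unfolding ass_def using w a by blast
qed

lemma order_den_Den_l:
  assumes f: "right_semicentral f" and f0: "f \<noteq> \<zero>"
  shows "order_den f \<in> Den_l A"
proof -
  have fc: "f \<in> carrier R" "f \<otimes> f = f" "\<And>x. x \<in> carrier R \<Longrightarrow> f \<otimes> x \<otimes> f = f \<otimes> x"
    using f by (auto simp: right_semicentral_def)
  note K = right_semicentral_ideal[OF f]
  note KL = ideal_imp_left_ideal[OF K]
  have mult: "multiplicative_subset A (order_den f)"
  proof -
    have "submonoid (order_den f) A"
    proof (rule submonoid.intro)
      show "\<one>\<^bsub>A\<^esub> \<in> order_den f"
        unfolding order_den_def using Units_subset_units_modulo[OF KL] by auto
    qed (auto simp: order_den_def intro: units_modulo_mult[OF K])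
    moreover have "\<zero>\<^bsub>A\<^esub> \<notin> order_den f"
    proof
      assume "\<zero>\<^bsub>A\<^esub> \<in> order_den f"
      then obtain t where "t \<in> carrier R" "f \<otimes> t \<otimes> \<phi> \<zero>\<^bsub>A\<^esub> = f"
        using right_semicentral_units_modulo[OF f] unfolding order_den_def by blast
      then show False using fc(1) f0 by simp
    qed
    ultimately show ?thesis by (simp add: multiplicative_subset_def)
  qed
  have t_ex: "\<exists>t\<in>carrier R. f \<otimes> t \<otimes> \<phi> s = f \<and> f \<otimes> \<phi> s \<otimes> t = f" if "s \<in> order_den f" for s
    using that right_semicentral_units_modulo[OF f] unfolding order_den_def by blast
  have Sc: "s \<in> carrier A" if "s \<in> order_den f" for s using that by (simp add: order_den_def)
  have ore: "(order_den f #>\<^bsub>A\<^esub> r) \<inter> (carrier A #>\<^bsub>A\<^esub> s) \<noteq> {}"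
    if r: "r \<in> carrier A" and s: "s \<in> order_den f" for r s
  proof -
    obtain t where t: "t \<in> carrier R" "f \<otimes> t \<otimes> \<phi> s = f" using t_ex[OF s] by blast
    have b: "f \<otimes> \<phi> r \<otimes> t \<in> carrier R" using fc(1) r t(1) by simp
    have "f \<otimes> \<phi> r \<otimes> t \<otimes> \<phi> s = f \<otimes> \<phi> r \<otimes> f \<otimes> t \<otimes> \<phi> s"
      using fc(3)[of "\<phi> r"] r by simp
    also have "\<dots> = f \<otimes> \<phi> r \<otimes> (f \<otimes> t \<otimes> \<phi> s)"
      using fc(1) r t(1) Sc[OF s] by (simp add: R.m_assoc)
    finally have bs: "f \<otimes> \<phi> r \<otimes> t \<otimes> \<phi> s = f \<otimes> \<phi> r" using t(2) fc(3) r by simp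
    \<comment> \<open>Modulo (1 - f)R the fraction r s^(-1) is f r t. Clearing f and f r t by the
      same \<open>v\<close> gives the exact equation y s = w r in \<open>A\<close>, because v f
      absorbs the error lying in (1 - f)R.\<close>
    obtain w y v where w: "w \<in> order_den f" "y \<in> carrier A" "v \<in> carrier R"
      "\<phi> w = v \<otimes> f" "\<phi> y = v \<otimes> (f \<otimes> \<phi> r \<otimes> t)"
      using order_den_exists[OF f b] by metis
    have "\<phi> (y \<otimes>\<^bsub>A\<^esub> s) = v \<otimes> (f \<otimes> \<phi> r \<otimes> t \<otimes> \<phi> s)"
      using w Sc[OF s] fc(1) r t(1) by (simp add: R.m_assoc)
    also have "\<dots> = \<phi> (w \<otimes>\<^bsub>A\<^esub> r)"
      unfolding bs using w(3,4) Sc[OF w(1)] r fc(1) by (simp add: R.m_assoc)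
    finally have "y \<otimes>\<^bsub>A\<^esub> s = w \<otimes>\<^bsub>A\<^esub> r"
      using phi_eq_iff[of "y \<otimes>\<^bsub>A\<^esub> s" "w \<otimes>\<^bsub>A\<^esub> r"] w(2) Sc[OF s] Sc[OF w(1)] r by simp
    then show ?thesis unfolding r_coset_def using w(1,2) by blast
  qed
  have den: "r \<in> ass A (order_den f)"
    if r: "r \<in> carrier A" and s: "s \<in> order_den f" and rs: "r \<otimes>\<^bsub>A\<^esub> s = \<zero>\<^bsub>A\<^esub>" for r s
  proof -
    obtain t where t: "t \<in> carrier R" "f \<otimes> \<phi> s \<otimes> t = f" using t_ex[OF s] by blast
    \<comment> \<open>Semicentrality allows \<open>f\<close> to be inserted after r and removed
      again, so r s = 0 forces f r = 0; \<open>ass_order_den\<close> translates this back.\<close>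
    have "f \<otimes> \<phi> r = f \<otimes> \<phi> r \<otimes> (f \<otimes> \<phi> s \<otimes> t)" using t(2) fc(3) r by simp
    also have "\<dots> = f \<otimes> \<phi> r \<otimes> f \<otimes> \<phi> s \<otimes> t"
      using fc(1) r t(1) Sc[OF s] by (simp add: R.m_assoc)
    also have "\<dots> = f \<otimes> \<phi> (r \<otimes>\<^bsub>A\<^esub> s) \<otimes> t"
      using fc(1) fc(3)[of "\<phi> r"] r t(1) Sc[OF s] by (simp add: R.m_assoc)
    finally show ?thesis using ass_order_den[OF f] rs r t(1) fc(1) by simp
  qed
  show ?thesis
    using mult ore den by (auto simp: Den_l_def left_Ore_set_def)
qed

text \<open>The ideal R ass(S) of \<open>R\<close> is shown to satisfy the hypotheses of
  \<open>left_artinian_semicentral_generator\<close>, which supplies \<open>f\<close>.\<close>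

lemma Den_l_subset_order_den:
  assumes art: "left_artinian R" and S: "S \<in> Den_l A"
  obtains f where "right_semicentral f" "f \<noteq> \<zero>" "S \<subseteq> order_den f"
proof -
  have Ore: "left_Ore_set A S"
    and den: "\<And>r s. r \<in> carrier A \<Longrightarrow> s \<in> S \<Longrightarrow> r \<otimes>\<^bsub>A\<^esub> s = \<zero>\<^bsub>A\<^esub> \<Longrightarrow> r \<in> ass A S"
    using S by (auto simp: Den_l_def)
  interpret S: submonoid S A
    using Ore by (simp add: left_Ore_set_def multiplicative_subset_def)
  have S0: "\<zero>\<^bsub>A\<^esub> \<notin> S" using Ore by (simp add: left_Ore_set_def multiplicative_subset_def)
  note Sc [simp] = subsetD[OF S.subset]
  define a where "a = ass A S"
  interpret a: ideal a A unfolding a_def by (rule ideal_ass[OF A.ring_axioms Ore])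
  note ac [simp] = a.a_Hcarr
  define U where "U = {c \<in> carrier A. \<phi> c \<in> Units R}"
  have U: "c \<in> carrier A" "\<phi> c \<in> Units R" "\<phi> c \<in> carrier R" if "c \<in> U" for c
    using that by (auto simp: U_def)
  have Umult: "c \<otimes>\<^bsub>A\<^esub> d \<in> U" if "c \<in> U" "d \<in> U" for c d
    using that unfolding U_def by auto
  have fr: "\<exists>c\<in>U. \<exists>b\<in>carrier A. \<phi> c \<otimes> r = \<phi> b" if "r \<in> carrier R" for r
    using fraction[OF that] unfolding U_def by blast
  \<comment> \<open>The left ideal of \<open>R\<close> generated by the image of \<open>a\<close>,
    with each element written over a single denominator.\<close>
  define I where "I = {x \<in> carrier R. \<exists>c\<in>U. \<exists>y\<in>a. \<phi> c \<otimes> x = \<phi> y}"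
  have Ic: "x \<in> carrier R" if "x \<in> I" for x using that by (simp add: I_def)
  \<comment> \<open>Applying the fraction property to r c^(-1) instead of r gives an Ore condition
    for \<open>U\<close>, with r anywhere in \<open>R\<close>.\<close>
  have ore_U: "\<exists>d\<in>U. \<exists>b\<in>carrier A. \<phi> d \<otimes> r = \<phi> b \<otimes> \<phi> c"
    if r: "r \<in> carrier R" and c: "c \<in> U" for r c
  proof -
    obtain d b where d: "d \<in> U" "b \<in> carrier A" "\<phi> d \<otimes> (r \<otimes> inv (\<phi> c)) = \<phi> b"
      using fr[of "r \<otimes> inv (\<phi> c)"] r U(2)[OF c] by (meson R.Units_inv_closed R.m_closed)
    have "\<phi> b \<otimes> \<phi> c = \<phi> d \<otimes> r \<otimes> (inv (\<phi> c) \<otimes> \<phi> c)"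
      unfolding d(3)[symmetric] using r U[OF c] U d(1) by (simp add: R.m_assoc del: R.Units_l_inv)
    then have "\<phi> d \<otimes> r = \<phi> b \<otimes> \<phi> c" using r U[OF c] U d(1) by simp
    then show ?thesis using d by blast
  qed
  have LI: "left_ideal I R"
  proof (rule left_idealI)
    fix x1 x2 assume "x1 \<in> I" "x2 \<in> I"
    then obtain c1 c2 y1 y2 where *: "x1 \<in> carrier R" "x2 \<in> carrier R" "c1 \<in> U" "c2 \<in> U" "y1 \<in> a" "y2 \<in> a"
      "\<phi> c1 \<otimes> x1 = \<phi> y1" "\<phi> c2 \<otimes> x2 = \<phi> y2" unfolding I_def by blast
    obtain d b where d: "d \<in> U" "b \<in> carrier A" "\<phi> d \<otimes> \<phi> c1 = \<phi> b \<otimes> \<phi> c2"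
      using ore_U[of "\<phi> c1" c2] * U by auto
    have "\<phi> (d \<otimes>\<^bsub>A\<^esub> c1) \<otimes> (x1 \<oplus> x2) = \<phi> d \<otimes> \<phi> c1 \<otimes> x1 \<oplus> \<phi> b \<otimes> \<phi> c2 \<otimes> x2"
      using *(1-6) d(1,2) U unfolding d(3)[symmetric] by (simp add: R.r_distr)
    also have "\<dots> = \<phi> (d \<otimes>\<^bsub>A\<^esub> y1 \<oplus>\<^bsub>A\<^esub> b \<otimes>\<^bsub>A\<^esub> y2)"
      using * d(1,2) U by (simp add: R.m_assoc)
    finally have "\<phi> (d \<otimes>\<^bsub>A\<^esub> c1) \<otimes> (x1 \<oplus> x2) = \<phi> (d \<otimes>\<^bsub>A\<^esub> y1 \<oplus>\<^bsub>A\<^esub> b \<otimes>\<^bsub>A\<^esub> y2)" .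
    moreover have "d \<otimes>\<^bsub>A\<^esub> y1 \<oplus>\<^bsub>A\<^esub> b \<otimes>\<^bsub>A\<^esub> y2 \<in> a"
      using a.I_l_closed * d(2) U(1)[OF d(1)] by simp
    ultimately show "x1 \<oplus> x2 \<in> I"
      unfolding I_def using *(1,2) Umult[OF d(1) *(3)] by blast
  next
    fix r x assume r: "r \<in> carrier R" and "x \<in> I"
    then obtain c y where *: "x \<in> carrier R" "c \<in> U" "y \<in> a" "\<phi> c \<otimes> x = \<phi> y"
      unfolding I_def by blast
    obtain d b where d: "d \<in> U" "b \<in> carrier A" "\<phi> d \<otimes> r = \<phi> b \<otimes> \<phi> c"
      using ore_U[OF r *(2)] by blast
    have "\<phi> d \<otimes> (r \<otimes> x) = \<phi> d \<otimes> r \<otimes> x" using *(1) d(1) U r by (simp add: R.m_assoc)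
    also have "\<dots> = \<phi> (b \<otimes>\<^bsub>A\<^esub> y)" unfolding d(3) using * d(1,2) U by (simp add: R.m_assoc)
    finally show "r \<otimes> x \<in> I"
      unfolding I_def using r * d a.I_l_closed[OF *(3) d(2)] by blast
  next
    have "\<phi> \<one>\<^bsub>A\<^esub> \<otimes> \<zero> = \<phi> \<zero>\<^bsub>A\<^esub>" by simp
    moreover have "\<one>\<^bsub>A\<^esub> \<in> U" by (simp add: U_def)
    ultimately show "\<zero> \<in> I" unfolding I_def using a.zero_closed by blast
  qed (simp add: I_def)
  have IrA: "x \<otimes> \<phi> z \<in> I" if "x \<in> I" "z \<in> carrier A" for x z
  proof -
    obtain c y where *: "x \<in> carrier R" "c \<in> U" "y \<in> a" "\<phi> c \<otimes> x = \<phi> y"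
      using \<open>x \<in> I\<close> unfolding I_def by blast
    have "\<phi> c \<otimes> (x \<otimes> \<phi> z) = \<phi> c \<otimes> x \<otimes> \<phi> z"
      using *(1) U[OF *(2)] that by (simp add: R.m_assoc)
    also have "\<dots> = \<phi> (y \<otimes>\<^bsub>A\<^esub> z)"
      unfolding *(4) using * that by simp
    finally have "\<phi> c \<otimes> (x \<otimes> \<phi> z) = \<phi> (y \<otimes>\<^bsub>A\<^esub> z)" .
    moreover have "x \<otimes> \<phi> z \<in> carrier R" using * that by simp
    ultimately show ?thesis unfolding I_def using *(2) a.I_r_closed[OF *(3) that(2)] by blast
  qed
  \<comment> \<open>The claim amounts to I c = I. As I c lies in \<open>I\<close>, the left ideals I
    c^n descend; at a stationary step the unit c^N cancels.\<close>
  have IrU: "x \<otimes> inv (\<phi> c) \<in> I" if x: "x \<in> I" and c: "c \<in> U" for x c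
  proof -
    define J where "J n = (\<lambda>x. x \<otimes> \<phi> c [^] n) ` I" for n :: nat
    have J: "left_ideal (J n) R" for n
    proof (rule left_idealI)
      show "J n \<subseteq> carrier R" unfolding J_def using Ic U(3)[OF c] by auto
      show "\<zero> \<in> J n" unfolding J_def using left_idealD(2)[OF LI] U(3)[OF c] by (auto intro!: image_eqI[of _ _ \<zero>])
      show "x \<oplus> y \<in> J n" if "x \<in> J n" "y \<in> J n" for x y
        using that left_idealD(3)[OF LI] Ic U(3)[OF c] unfolding J_def
        by (auto simp: R.l_distr[symmetric])
      show "r \<otimes> x \<in> J n" if "r \<in> carrier R" "x \<in> J n" for r x
        using that left_idealD(4)[OF LI] Ic U(3)[OF c] unfolding J_def
        by (auto simp: R.m_assoc[symmetric])
    qed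
    have dec: "J (Suc n) \<subseteq> J n" for n
    proof
      fix z assume "z \<in> J (Suc n)"
      then obtain x where "x \<in> I" "z = x \<otimes> \<phi> c [^] Suc n" unfolding J_def by blast
      then have "z = (x \<otimes> \<phi> c) \<otimes> \<phi> c [^] n" "x \<otimes> \<phi> c \<in> I"
        unfolding nat_pow_Suc2[OF U(3)[OF c]] using U[OF c] Ic IrA by (simp_all add: R.m_assoc)
      then show "z \<in> J n" unfolding J_def by blast
    qed
    obtain N where N: "J (Suc N) = J N" using left_artinian_chain[of J] art J dec by blast
    have "x \<otimes> \<phi> c [^] N \<in> J (Suc N)" unfolding N using x by (auto simp: J_def)
    then obtain x' where x': "x' \<in> I" "x \<otimes> \<phi> c [^] N = x' \<otimes> \<phi> c [^] Suc N"
      unfolding J_def by blast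
    have "x \<otimes> \<phi> c [^] N = (x' \<otimes> \<phi> c) \<otimes> \<phi> c [^] N"
      unfolding x'(2) nat_pow_Suc2[OF U(3)[OF c]] using Ic[OF x'(1)] U[OF c] by (simp add: R.m_assoc)
    moreover have "\<phi> c [^] N \<in> Units R" by (induction N) (use U[OF c] in auto)
    ultimately have "x = x' \<otimes> \<phi> c"
      using Ic[OF x] Ic[OF x'(1)] U[OF c] by (metis R.Units_closed R.Units_inv_closed R.Units_r_inv R.m_assoc R.m_closed R.r_one)
    then have "x \<otimes> inv (\<phi> c) = x'" using Ic[OF x'(1)] U[OF c] by (simp add: R.m_assoc)
    then show ?thesis using x' by simp
  qed
  have I: "ideal I R"
  proof (rule ideal_of_left_ideal[OF LI])
    fix r x assume r: "r \<in> carrier R" and x: "x \<in> I"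
    obtain c z where c: "c \<in> U" "z \<in> carrier A" "\<phi> c \<otimes> r = \<phi> z" using fr[OF r] by blast
    have "r = inv (\<phi> c) \<otimes> \<phi> c \<otimes> r" using U[OF c(1)] r by simp
    also have "\<dots> = inv (\<phi> c) \<otimes> \<phi> z" unfolding c(3)[symmetric]
      using U[OF c(1)] r by (simp add: R.m_assoc del: R.Units_l_inv)
    finally have "x \<otimes> r = x \<otimes> inv (\<phi> c) \<otimes> \<phi> z" using Ic[OF x] U[OF c(1)] c(2) by (simp add: R.m_assoc)
    then show "x \<otimes> r \<in> I" using IrU[OF x c(1)] IrA c(2) by simp
  qed
  have Sunit: "\<phi> s \<in> units_modulo I" if s: "s \<in> S" for s
  proof (rule left_artinian_unit_modulo[OF art I])
    show "\<phi> s \<in> carrier R" using s by simp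
    fix x assume x: "x \<in> carrier R" "x \<otimes> \<phi> s \<in> I"
    obtain c y where c: "c \<in> U" "y \<in> carrier A" "\<phi> c \<otimes> x = \<phi> y" using fr[OF x(1)] by blast
    have "\<phi> c \<otimes> (x \<otimes> \<phi> s) \<in> I" using left_idealD(4)[OF LI] x(2) U[OF c(1)] by blast
    moreover have "\<phi> c \<otimes> (x \<otimes> \<phi> s) = \<phi> (y \<otimes>\<^bsub>A\<^esub> s)"
      using c x(1) U[OF c(1)] s by (simp add: R.m_assoc[symmetric])
    ultimately obtain d w where d: "d \<in> U" "w \<in> a" "\<phi> d \<otimes> \<phi> (y \<otimes>\<^bsub>A\<^esub> s) = \<phi> w"
      unfolding I_def by auto
    have "\<phi> (d \<otimes>\<^bsub>A\<^esub> (y \<otimes>\<^bsub>A\<^esub> s)) = \<phi> w" using d U[OF d(1)] c(2) s by simp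
    then have dw: "d \<otimes>\<^bsub>A\<^esub> (y \<otimes>\<^bsub>A\<^esub> s) = w"
      using phi_eq_iff[of "d \<otimes>\<^bsub>A\<^esub> (y \<otimes>\<^bsub>A\<^esub> s)" w] d U[OF d(1)] c(2) s by simp
    \<comment> \<open>Now t d y s = 0, and the denominator condition moves the annihilation to the
      left: t d y lies in ass(S), hence so does d y.\<close>
    obtain t where t: "t \<in> S" "t \<otimes>\<^bsub>A\<^esub> w = \<zero>\<^bsub>A\<^esub>" using d(2) unfolding a_def ass_def by blast
    have "(t \<otimes>\<^bsub>A\<^esub> (d \<otimes>\<^bsub>A\<^esub> y)) \<otimes>\<^bsub>A\<^esub> s = \<zero>\<^bsub>A\<^esub>"
      using t(2) unfolding dw[symmetric] using t(1) U[OF d(1)] c(2) s by (simp add: A.m_assoc)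
    then have "t \<otimes>\<^bsub>A\<^esub> (d \<otimes>\<^bsub>A\<^esub> y) \<in> ass A S"
      using den s t(1) U[OF d(1)] c(2) by simp
    then obtain t' where t': "t' \<in> S" "t' \<otimes>\<^bsub>A\<^esub> (t \<otimes>\<^bsub>A\<^esub> (d \<otimes>\<^bsub>A\<^esub> y)) = \<zero>\<^bsub>A\<^esub>"
      unfolding ass_def by blast
    then have "(t' \<otimes>\<^bsub>A\<^esub> t) \<otimes>\<^bsub>A\<^esub> (d \<otimes>\<^bsub>A\<^esub> y) = \<zero>\<^bsub>A\<^esub>"
      using t(1) U[OF d(1)] c(2) by (simp add: A.m_assoc)
    then have dy: "d \<otimes>\<^bsub>A\<^esub> y \<in> a"
      unfolding a_def ass_def using S.m_closed[OF t'(1) t(1)] U[OF d(1)] c(2) by blast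
    have "\<phi> (d \<otimes>\<^bsub>A\<^esub> c) \<otimes> x = \<phi> (d \<otimes>\<^bsub>A\<^esub> y)"
      using c U[OF d(1)] U[OF c(1)] x(1) by (simp add: R.m_assoc)
    then show "x \<in> I" unfolding I_def using x(1) dy Umult[OF d(1) c(1)] by blast
  qed
  \<comment> \<open>If c r = y and s y = 0, then s c kills r; it is a unit modulo \<open>I\<close>
    because s is one and c is invertible in \<open>R\<close>.\<close>
  have ann: "\<exists>x\<in>units_modulo I. x \<otimes> r = \<zero>" if "r \<in> I" for r
  proof -
    obtain c y where *: "r \<in> carrier R" "c \<in> U" "y \<in> a" "\<phi> c \<otimes> r = \<phi> y"
      using \<open>r \<in> I\<close> unfolding I_def by blast
    obtain s where s: "s \<in> S" "s \<otimes>\<^bsub>A\<^esub> y = \<zero>\<^bsub>A\<^esub>" using *(3) unfolding a_def ass_def by blast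
    have "\<phi> s \<otimes> \<phi> c \<otimes> r = \<phi> (s \<otimes>\<^bsub>A\<^esub> y)" using * U s(1) by (simp add: R.m_assoc)
    moreover have "\<phi> s \<otimes> \<phi> c \<in> units_modulo I"
      using units_modulo_mult[OF I Sunit[OF s(1)]] Units_subset_units_modulo[OF LI] U[OF *(2)] by blast
    ultimately show ?thesis using s(2) by auto
  qed
  obtain f where f: "right_semicentral f" "I = right_ann f"
    using left_artinian_semicentral_generator[OF art I ann] by blast
  \<comment> \<open>Otherwise 1 lies in \<open>I\<close>, so some c in ass(S) is invertible in
    \<open>R\<close>; then s c = 0 forces s = 0 for some s in \<open>S\<close>.\<close>
  have "f \<noteq> \<zero>"
  proof
    assume "f = \<zero>"
    then have "\<one> \<in> I" using f(2) by simp
    then obtain c y where c: "c \<in> U" "y \<in> a" "\<phi> c \<otimes> \<one> = \<phi> y" unfolding I_def by blast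
    then have "c = y" using phi_eq_iff U[OF c(1)] by simp
    then obtain s where s: "s \<in> S" "s \<otimes>\<^bsub>A\<^esub> c = \<zero>\<^bsub>A\<^esub>"
      using c(2) unfolding a_def ass_def by blast
    have "\<phi> s = \<phi> (s \<otimes>\<^bsub>A\<^esub> c) \<otimes> inv (\<phi> c)" using s(1) U[OF c(1)] by (simp add: R.m_assoc)
    then have "\<phi> s = \<phi> \<zero>\<^bsub>A\<^esub>" using s(2) U[OF c(1)] by simp
    then have "s = \<zero>\<^bsub>A\<^esub>" using phi_eq_iff[of s "\<zero>\<^bsub>A\<^esub>"] s(1) by simp
    then show False using S0 s(1) by simp
  qed
  moreover have "S \<subseteq> order_den f"
    unfolding order_den_def using Sunit f(2) by auto
  ultimately show ?thesis using that f(1) by blast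
qed

end

section \<open>Left localizations\<close>

text \<open>A ring \<open>Q\<close> with these properties is the left localization: \<open>z \<in> Q\<close> corresponds to the class of
  all \<open>(s, r)\<close> with \<open>\<psi> r = \<psi> s z\<close>, that is \<open>z = (\<psi> s)\<^sup>-\<^sup>1 \<psi> r\<close>.\<close>

lemma left_localization_characterization:
  assumes "ring B" "ring Q" and hom: "\<psi> \<in> ring_hom B Q" and Ore: "left_Ore_set B S"
    and units: "\<And>s. s \<in> S \<Longrightarrow> \<psi> s \<in> Units Q"
    and ker: "\<And>r. r \<in> carrier B \<Longrightarrow> \<psi> r = \<zero>\<^bsub>Q\<^esub> \<Longrightarrow> r \<in> ass B S"
    and fraction: "\<And>z. z \<in> carrier Q \<Longrightarrow> \<exists>s\<in>S. \<exists>r\<in>carrier B. \<psi> r = \<psi> s \<otimes>\<^bsub>Q\<^esub> z"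
  obtains G where "G \<in> ring_iso Q (left_localization B S)"
    "\<And>r. r \<in> carrier B \<Longrightarrow> G (\<psi> r) = loc_map B S r"
proof -
  interpret B: ring B by fact
  interpret Q: ring Q by fact
  interpret psi: ring_hom_ring B Q \<psi>
    using hom by (intro ring_hom_ringI2 B.ring_axioms Q.ring_axioms)
  interpret S: submonoid S B
    using Ore by (simp add: left_Ore_set_def multiplicative_subset_def)
  note Sc [simp] = subsetD[OF S.subset]
  have ore: "\<exists>t\<in>S. \<exists>b\<in>carrier B. t \<otimes>\<^bsub>B\<^esub> r = b \<otimes>\<^bsub>B\<^esub> s" if "r \<in> carrier B" "s \<in> S" for r s
    using Ore that unfolding left_Ore_set_def r_coset_def by blast
  define G where "G z = {(s, r). s \<in> S \<and> r \<in> carrier B \<and> \<psi> r = \<psi> s \<otimes>\<^bsub>Q\<^esub> z}" for z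
  have cancel: "x = y" if "u \<in> Units Q" "x \<in> carrier Q" "y \<in> carrier Q"
    "u \<otimes>\<^bsub>Q\<^esub> x = u \<otimes>\<^bsub>Q\<^esub> y" for u x y
    using that Q.Units_l_cancel by blast
  \<comment> \<open>Each class of fractions is a full fibre \<open>G z\<close>. This makes the
    operations defined by unions computable.\<close>
  have frac: "frac B S s r = G z" if z: "z \<in> carrier Q" and sr: "(s, r) \<in> G z" for s r z
  proof (intro equalityI subsetI)
    have sr: "s \<in> S" "r \<in> carrier B" "\<psi> r = \<psi> s \<otimes>\<^bsub>Q\<^esub> z" using sr by (auto simp: G_def)
    fix p assume "p \<in> frac B S s r"
    then obtain s' r' c d where p: "p = (s', r')" "s' \<in> S" "r' \<in> carrier B" "c \<in> carrier B" "d \<in> carrier B"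
      "c \<otimes>\<^bsub>B\<^esub> s \<in> S" "c \<otimes>\<^bsub>B\<^esub> s = d \<otimes>\<^bsub>B\<^esub> s'" "c \<otimes>\<^bsub>B\<^esub> r = d \<otimes>\<^bsub>B\<^esub> r'"
      unfolding frac_def frac_rel_def by blast
    have "\<psi> (c \<otimes>\<^bsub>B\<^esub> s) \<in> Units Q" using units p(6) .
    then have u: "\<psi> d \<otimes>\<^bsub>Q\<^esub> \<psi> s' \<in> Units Q" using p(2,5,7) by simp
    have us: "\<psi> s' \<in> Units Q" using units p(2) .
    \<comment> \<open>The expansion factor \<open>d\<close> need not lie in \<open>S\<close>, but
      its image is a unit because the images of d s' and s' are; so it can be cancelled
      below.\<close>
    have "\<psi> d = (\<psi> d \<otimes>\<^bsub>Q\<^esub> \<psi> s') \<otimes>\<^bsub>Q\<^esub> inv\<^bsub>Q\<^esub> (\<psi> s')"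
      using us p(2,5) by (simp add: Q.m_assoc)
    then have ud: "\<psi> d \<in> Units Q" using u us Q.Units_m_closed Q.Units_inv_Units by metis
    have "\<psi> d \<otimes>\<^bsub>Q\<^esub> \<psi> r' = \<psi> (c \<otimes>\<^bsub>B\<^esub> r)" using p by simp
    also have "\<dots> = \<psi> (c \<otimes>\<^bsub>B\<^esub> s) \<otimes>\<^bsub>Q\<^esub> z" using p(4) sr z by (simp add: Q.m_assoc)
    also have "\<dots> = \<psi> d \<otimes>\<^bsub>Q\<^esub> (\<psi> s' \<otimes>\<^bsub>Q\<^esub> z)" unfolding p(7) using p(2,5) z by (simp add: Q.m_assoc)
    finally have "\<psi> r' = \<psi> s' \<otimes>\<^bsub>Q\<^esub> z" using cancel[OF ud] p(2,3) z by simp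
    then show "p \<in> G z" using p by (simp add: G_def)
  next
    have sr: "s \<in> S" "r \<in> carrier B" "\<psi> r = \<psi> s \<otimes>\<^bsub>Q\<^esub> z" using sr by (auto simp: G_def)
    fix p assume "p \<in> G z"
    then obtain s' r' where p: "p = (s', r')" "s' \<in> S" "r' \<in> carrier B" "\<psi> r' = \<psi> s' \<otimes>\<^bsub>Q\<^esub> z"
      by (auto simp: G_def)
    obtain t b where t: "t \<in> S" "b \<in> carrier B" "t \<otimes>\<^bsub>B\<^esub> s = b \<otimes>\<^bsub>B\<^esub> s'"
      using ore[of s s'] sr(1) p(2) by auto
    have "\<psi> (t \<otimes>\<^bsub>B\<^esub> r) = \<psi> (t \<otimes>\<^bsub>B\<^esub> s) \<otimes>\<^bsub>Q\<^esub> z" using t(1) sr z by (simp add: Q.m_assoc)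
    also have "\<dots> = \<psi> (b \<otimes>\<^bsub>B\<^esub> r')" unfolding t(3) using t(2) p(2-4) z by (simp add: Q.m_assoc)
    \<comment> \<open>The two expansions agree only in \<open>Q\<close>. Their difference lies in
      ass(S), and one further left factor \<open>w\<close> makes them agree in
      \<open>B\<close>.\<close>
    finally have "\<psi> (t \<otimes>\<^bsub>B\<^esub> r \<ominus>\<^bsub>B\<^esub> b \<otimes>\<^bsub>B\<^esub> r') = \<zero>\<^bsub>Q\<^esub>"
      using t(1,2) sr(2) p(3) by (simp add: B.minus_eq Q.r_neg del: psi.hom_mult)
    from ker[OF _ this] obtain w where
      w: "w \<in> S" "w \<otimes>\<^bsub>B\<^esub> (t \<otimes>\<^bsub>B\<^esub> r \<ominus>\<^bsub>B\<^esub> b \<otimes>\<^bsub>B\<^esub> r') = \<zero>\<^bsub>B\<^esub>"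
      using t(1,2) sr(2) p(3) unfolding ass_def by auto
    have "(w \<otimes>\<^bsub>B\<^esub> t) \<otimes>\<^bsub>B\<^esub> r \<ominus>\<^bsub>B\<^esub> (w \<otimes>\<^bsub>B\<^esub> b) \<otimes>\<^bsub>B\<^esub> r' = \<zero>\<^bsub>B\<^esub>"
      using w t(1,2) sr(2) p(3) by (simp add: B.ring_simprules)
    then have "(w \<otimes>\<^bsub>B\<^esub> t) \<otimes>\<^bsub>B\<^esub> r = (w \<otimes>\<^bsub>B\<^esub> b) \<otimes>\<^bsub>B\<^esub> r'"
      using B.minus_eq_zero_iff w(1) t(1,2) sr(2) p(3) by simp
    moreover have "(w \<otimes>\<^bsub>B\<^esub> t) \<otimes>\<^bsub>B\<^esub> s = (w \<otimes>\<^bsub>B\<^esub> b) \<otimes>\<^bsub>B\<^esub> s'"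
      using w(1) t sr(1) p(2) by (simp add: B.m_assoc)
    moreover have "(w \<otimes>\<^bsub>B\<^esub> t) \<otimes>\<^bsub>B\<^esub> s \<in> S" using w(1) t(1) sr(1) by simp
    moreover have "w \<otimes>\<^bsub>B\<^esub> t \<in> carrier B" "w \<otimes>\<^bsub>B\<^esub> b \<in> carrier B" using w(1) t(1,2) by simp_all
    ultimately show "p \<in> frac B S s r"
      unfolding frac_def frac_rel_def using p(1-3) sr(1,2) by blast
  qed
  have G_rep: "\<exists>s r. (s, r) \<in> G z" if "z \<in> carrier Q" for z
    using fraction[OF that] by (auto simp: G_def)
  have rep_G: "\<exists>z\<in>carrier Q. (s, r) \<in> G z" if "s \<in> S" "r \<in> carrier B" for s r
  proof
    have u: "\<psi> s \<in> Units Q" using that units by blast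
    show "(s, r) \<in> G (inv\<^bsub>Q\<^esub> (\<psi> s) \<otimes>\<^bsub>Q\<^esub> \<psi> r)"
      using u that by (simp add: G_def Q.m_assoc[symmetric])
    show "inv\<^bsub>Q\<^esub> (\<psi> s) \<otimes>\<^bsub>Q\<^esub> \<psi> r \<in> carrier Q" using u that by simp
  qed
  have carrier: "carrier (left_localization B S) = G ` carrier Q"
  proof -
    have "carrier (left_localization B S) = {frac B S s r | s r. s \<in> S \<and> r \<in> carrier B}"
      unfolding left_localization_def frac_def quotient_def by auto
    also have "\<dots> = G ` carrier Q"
    proof (intro equalityI subsetI)
      fix X assume "X \<in> {frac B S s r | s r. s \<in> S \<and> r \<in> carrier B}"
      then obtain s r where "X = frac B S s r" "s \<in> S" "r \<in> carrier B" by blast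
      moreover from this obtain z where "z \<in> carrier Q" "(s, r) \<in> G z" using rep_G by blast
      ultimately show "X \<in> G ` carrier Q" using frac[of z s r] by blast
    next
      fix X assume "X \<in> G ` carrier Q"
      then obtain z s r where "z \<in> carrier Q" "X = G z" "(s, r) \<in> G z" using G_rep by blast
      then have "X = frac B S s r" "s \<in> S" "r \<in> carrier B"
        using frac by (auto simp: G_def)
      then show "X \<in> {frac B S s r | s r. s \<in> S \<and> r \<in> carrier B}" by blast
    qed
    finally show ?thesis .
  qed
  have mult: "G z \<otimes>\<^bsub>left_localization B S\<^esub> G w = G (z \<otimes>\<^bsub>Q\<^esub> w)"
    if z: "z \<in> carrier Q" and w: "w \<in> carrier Q" for z w
  proof -
    \<comment> \<open>The product is the union of \<open>?M\<close>. All members are the class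
      \<open>G (z \<otimes> w)\<close>, and the Ore condition makes \<open>?M\<close> nonempty, so
      the union is that class. Addition is treated in the same way.\<close>
    let ?M = "{frac B S (t \<otimes>\<^bsub>B\<^esub> s) (a \<otimes>\<^bsub>B\<^esub> r') | s r s' r' t a.
                (s, r) \<in> G z \<and> (s', r') \<in> G w \<and> t \<in> S \<and> a \<in> carrier B \<and>
                t \<otimes>\<^bsub>B\<^esub> r = a \<otimes>\<^bsub>B\<^esub> s'}"
    have "Y = G (z \<otimes>\<^bsub>Q\<^esub> w)" if M: "Y \<in> ?M" for Y
    proof -
      obtain s r s' r' t a where Y: "Y = frac B S (t \<otimes>\<^bsub>B\<^esub> s) (a \<otimes>\<^bsub>B\<^esub> r')"
        and *: "(s, r) \<in> G z" "(s', r') \<in> G w" "t \<in> S" "a \<in> carrier B" "t \<otimes>\<^bsub>B\<^esub> r = a \<otimes>\<^bsub>B\<^esub> s'"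
        using M by blast
      have sr: "s \<in> S" "r \<in> carrier B" "\<psi> r = \<psi> s \<otimes>\<^bsub>Q\<^esub> z"
        "s' \<in> S" "r' \<in> carrier B" "\<psi> r' = \<psi> s' \<otimes>\<^bsub>Q\<^esub> w"
        using * by (auto simp: G_def)
      have "\<psi> (a \<otimes>\<^bsub>B\<^esub> r') = \<psi> (a \<otimes>\<^bsub>B\<^esub> s') \<otimes>\<^bsub>Q\<^esub> w"
        using sr(4-6) *(4) w by (simp add: Q.m_assoc)
      also have "\<dots> = \<psi> (t \<otimes>\<^bsub>B\<^esub> s) \<otimes>\<^bsub>Q\<^esub> (z \<otimes>\<^bsub>Q\<^esub> w)"
        unfolding *(5)[symmetric] using sr(1-3) *(3) z w by (simp add: Q.m_assoc)
      finally have "(t \<otimes>\<^bsub>B\<^esub> s, a \<otimes>\<^bsub>B\<^esub> r') \<in> G (z \<otimes>\<^bsub>Q\<^esub> w)"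
        using sr *(3,4) by (simp add: G_def del: psi.hom_mult)
      then show ?thesis unfolding Y using frac[of "z \<otimes>\<^bsub>Q\<^esub> w"] z w by simp
    qed
    moreover obtain s r where 1: "(s, r) \<in> G z" using G_rep[OF z] by blast
    obtain s' r' where 2: "(s', r') \<in> G w" using G_rep[OF w] by blast
    obtain t a where "t \<in> S" "a \<in> carrier B" "t \<otimes>\<^bsub>B\<^esub> r = a \<otimes>\<^bsub>B\<^esub> s'"
      using ore[of r s'] 1 2 by (auto simp: G_def)
    with 1 2 have "frac B S (t \<otimes>\<^bsub>B\<^esub> s) (a \<otimes>\<^bsub>B\<^esub> r') \<in> ?M" by blast
    ultimately have "\<Union>?M = G (z \<otimes>\<^bsub>Q\<^esub> w)" by blast
    then show ?thesis by (simp add: left_localization_def)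
  qed
  have add: "G z \<oplus>\<^bsub>left_localization B S\<^esub> G w = G (z \<oplus>\<^bsub>Q\<^esub> w)"
    if z: "z \<in> carrier Q" and w: "w \<in> carrier Q" for z w
  proof -
    let ?M = "{frac B S (c \<otimes>\<^bsub>B\<^esub> s) ((c \<otimes>\<^bsub>B\<^esub> r) \<oplus>\<^bsub>B\<^esub> (d \<otimes>\<^bsub>B\<^esub> r')) | s r s' r' c d.
                (s, r) \<in> G z \<and> (s', r') \<in> G w \<and> c \<in> carrier B \<and> d \<in> carrier B \<and>
                c \<otimes>\<^bsub>B\<^esub> s \<in> S \<and> c \<otimes>\<^bsub>B\<^esub> s = d \<otimes>\<^bsub>B\<^esub> s'}"
    have "Y = G (z \<oplus>\<^bsub>Q\<^esub> w)" if M: "Y \<in> ?M" for Y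
    proof -
      obtain s r s' r' c d where Y: "Y = frac B S (c \<otimes>\<^bsub>B\<^esub> s) ((c \<otimes>\<^bsub>B\<^esub> r) \<oplus>\<^bsub>B\<^esub> (d \<otimes>\<^bsub>B\<^esub> r'))"
        and *: "(s, r) \<in> G z" "(s', r') \<in> G w" "c \<in> carrier B" "d \<in> carrier B"
          "c \<otimes>\<^bsub>B\<^esub> s \<in> S" "c \<otimes>\<^bsub>B\<^esub> s = d \<otimes>\<^bsub>B\<^esub> s'"
        using M by blast
      have sr: "s \<in> S" "r \<in> carrier B" "\<psi> r = \<psi> s \<otimes>\<^bsub>Q\<^esub> z"
        "s' \<in> S" "r' \<in> carrier B" "\<psi> r' = \<psi> s' \<otimes>\<^bsub>Q\<^esub> w"
        using * by (auto simp: G_def)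
      have 1: "\<psi> (c \<otimes>\<^bsub>B\<^esub> r) = \<psi> (c \<otimes>\<^bsub>B\<^esub> s) \<otimes>\<^bsub>Q\<^esub> z" using sr(1-3) *(3) z by (simp add: Q.m_assoc)
      have 2: "\<psi> (d \<otimes>\<^bsub>B\<^esub> r') = \<psi> (c \<otimes>\<^bsub>B\<^esub> s) \<otimes>\<^bsub>Q\<^esub> w"
        unfolding *(6) using sr(4-6) *(4) w by (simp add: Q.m_assoc)
      have "\<psi> (c \<otimes>\<^bsub>B\<^esub> r \<oplus>\<^bsub>B\<^esub> d \<otimes>\<^bsub>B\<^esub> r') = \<psi> (c \<otimes>\<^bsub>B\<^esub> r) \<oplus>\<^bsub>Q\<^esub> \<psi> (d \<otimes>\<^bsub>B\<^esub> r')"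
        using sr *(3,4) by (simp del: psi.hom_mult)
      also have "\<dots> = \<psi> (c \<otimes>\<^bsub>B\<^esub> s) \<otimes>\<^bsub>Q\<^esub> (z \<oplus>\<^bsub>Q\<^esub> w)"
        unfolding 1 2 using *(5) z w by (simp add: Q.r_distr del: psi.hom_mult)
      finally have "(c \<otimes>\<^bsub>B\<^esub> s, c \<otimes>\<^bsub>B\<^esub> r \<oplus>\<^bsub>B\<^esub> d \<otimes>\<^bsub>B\<^esub> r') \<in> G (z \<oplus>\<^bsub>Q\<^esub> w)"
        using sr *(3-5) by (simp add: G_def del: psi.hom_mult)
      then show ?thesis unfolding Y using frac[of "z \<oplus>\<^bsub>Q\<^esub> w"] z w by simp
    qed
    moreover obtain s r where 1: "(s, r) \<in> G z" using G_rep[OF z] by blast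
    obtain s' r' where 2: "(s', r') \<in> G w" using G_rep[OF w] by blast
    have ss: "s \<in> S" "s' \<in> S" using 1 2 by (auto simp: G_def)
    obtain t a where t: "t \<in> S" "a \<in> carrier B" "t \<otimes>\<^bsub>B\<^esub> s = a \<otimes>\<^bsub>B\<^esub> s'"
      using ore[of s s'] ss by auto
    have "t \<otimes>\<^bsub>B\<^esub> s \<in> S" "t \<in> carrier B" using t(1) ss by auto
    with 1 2 t have "frac B S (t \<otimes>\<^bsub>B\<^esub> s) (t \<otimes>\<^bsub>B\<^esub> r \<oplus>\<^bsub>B\<^esub> a \<otimes>\<^bsub>B\<^esub> r') \<in> ?M" by blast
    ultimately have "\<Union>?M = G (z \<oplus>\<^bsub>Q\<^esub> w)" by blast
    then show ?thesis by (simp add: left_localization_def)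
  qed
  have loc: "G (\<psi> r) = loc_map B S r" if "r \<in> carrier B" for r
  proof -
    have "(\<one>\<^bsub>B\<^esub>, r) \<in> G (\<psi> r)" using that by (simp add: G_def)
    then show ?thesis using frac[of "\<psi> r" "\<one>\<^bsub>B\<^esub>" r] that by (simp add: loc_map_def)
  qed
  have one: "G \<one>\<^bsub>Q\<^esub> = \<one>\<^bsub>left_localization B S\<^esub>"
    using loc[of "\<one>\<^bsub>B\<^esub>"] by (simp add: left_localization_def loc_map_def)
  have "inj_on G (carrier Q)"
  proof (rule inj_onI)
    fix z w assume z: "z \<in> carrier Q" and w: "w \<in> carrier Q" and eq: "G z = G w"
    obtain s r where "(s, r) \<in> G z" using G_rep[OF z] by blast
    moreover from this have "(s, r) \<in> G w" using eq by simp
    ultimately show "z = w" using cancel[OF units[of s] z w] by (auto simp: G_def)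
  qed
  then have "bij_betw G (carrier Q) (carrier (left_localization B S))"
    using carrier by (simp add: bij_betw_def)
  then have "G \<in> ring_iso Q (left_localization B S)"
    using mult add one carrier by (intro ring_iso_memI) auto
  then show ?thesis using that loc by blast
qed

text \<open>\<open>left_localization_characterization\<close> compares with a ring that is already
  understood, and none is at hand here, so fractions are computed directly. The ring laws are a
  hypothesis; it remains to decide when fractions agree and to evaluate enough products and
  sums.\<close>

lemma left_order_Q_lcl:
  assumes "ring A" "\<one>\<^bsub>A\<^esub> \<noteq> \<zero>\<^bsub>A\<^esub>" and Ore: "left_Ore_set A (regular_elements A)"
    and R: "ring (Q_lcl A)"
  shows "left_order (Q_lcl A) A (loc_map A (regular_elements A))"
proof -
  define C where "C = regular_elements A"
  interpret A: ring A by fact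
  interpret R: ring "Q_lcl A" by fact
  note Ore = Ore[folded C_def]
  interpret C: submonoid C A
    using Ore by (simp add: left_Ore_set_def multiplicative_subset_def)
  note Cc [simp] = subsetD[OF C.subset]
  have ore: "\<exists>t\<in>C. \<exists>b\<in>carrier A. t \<otimes>\<^bsub>A\<^esub> r = b \<otimes>\<^bsub>A\<^esub> s" if "r \<in> carrier A" "s \<in> C" for r s
    using Ore that unfolding left_Ore_set_def r_coset_def by blast
  have lcan: "x = y" if "c \<in> C" "x \<in> carrier A" "y \<in> carrier A" "c \<otimes>\<^bsub>A\<^esub> x = c \<otimes>\<^bsub>A\<^esub> y" for c x y
  proof -
    have "c \<otimes>\<^bsub>A\<^esub> (x \<ominus>\<^bsub>A\<^esub> y) = \<zero>\<^bsub>A\<^esub>"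
      using that by (simp add: A.minus_eq A.r_distr A.r_minus A.r_neg)
    then have "x \<ominus>\<^bsub>A\<^esub> y = \<zero>\<^bsub>A\<^esub>" using that(1-3) A.minus_closed unfolding C_def regular_elements_def by blast
    then show ?thesis using that A.minus_eq_zero_iff by blast
  qed
  have rcan: "x = y" if "c \<in> C" "x \<in> carrier A" "y \<in> carrier A" "x \<otimes>\<^bsub>A\<^esub> c = y \<otimes>\<^bsub>A\<^esub> c" for c x y
  proof -
    have "(x \<ominus>\<^bsub>A\<^esub> y) \<otimes>\<^bsub>A\<^esub> c = \<zero>\<^bsub>A\<^esub>"
      using that by (simp add: A.minus_eq A.l_distr A.l_minus A.r_neg)
    then have "x \<ominus>\<^bsub>A\<^esub> y = \<zero>\<^bsub>A\<^esub>" using that(1-3) A.minus_closed unfolding C_def regular_elements_def by blast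
    then show ?thesis using that A.minus_eq_zero_iff by blast
  qed
  define rel where "rel s r s' r' \<longleftrightarrow> ((s, r), (s', r')) \<in> frac_rel A C" for s r s' r'
  \<comment> \<open>Equality of fractions is witnessed by one pair of expansion factors. The Ore
    condition and cancellation of regular elements extend it to all x, y with x s = y s'. In this
    universal form (\<open>relI'\<close> is the converse) symmetry and independence of
    representatives follow directly.\<close>
  have relD: "x \<otimes>\<^bsub>A\<^esub> r = y \<otimes>\<^bsub>A\<^esub> r'"
    if rel: "rel s r s' r'" and x: "x \<in> carrier A" and y: "y \<in> carrier A"
      and xy: "x \<otimes>\<^bsub>A\<^esub> s = y \<otimes>\<^bsub>A\<^esub> s'" for s r s' r' x y
  proof -
    obtain c d where *: "s \<in> C" "r \<in> carrier A" "s' \<in> C" "r' \<in> carrier A" "c \<in> carrier A" "d \<in> carrier A"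
      "c \<otimes>\<^bsub>A\<^esub> s \<in> C" "c \<otimes>\<^bsub>A\<^esub> s = d \<otimes>\<^bsub>A\<^esub> s'" "c \<otimes>\<^bsub>A\<^esub> r = d \<otimes>\<^bsub>A\<^esub> r'"
      using rel unfolding rel_def frac_rel_def by auto
    obtain p q where p: "p \<in> C" "q \<in> carrier A" "p \<otimes>\<^bsub>A\<^esub> (x \<otimes>\<^bsub>A\<^esub> s) = q \<otimes>\<^bsub>A\<^esub> (c \<otimes>\<^bsub>A\<^esub> s)"
      using ore[of "x \<otimes>\<^bsub>A\<^esub> s" "c \<otimes>\<^bsub>A\<^esub> s"] * x by auto
    have "(p \<otimes>\<^bsub>A\<^esub> x) \<otimes>\<^bsub>A\<^esub> s = (q \<otimes>\<^bsub>A\<^esub> c) \<otimes>\<^bsub>A\<^esub> s"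
      using p *(1,5) x by (simp add: A.m_assoc)
    then have px: "p \<otimes>\<^bsub>A\<^esub> x = q \<otimes>\<^bsub>A\<^esub> c" using rcan[OF *(1)] p(1,2) *(5) x by simp
    have "p \<otimes>\<^bsub>A\<^esub> (y \<otimes>\<^bsub>A\<^esub> s') = q \<otimes>\<^bsub>A\<^esub> (d \<otimes>\<^bsub>A\<^esub> s')"
      using p(3) unfolding xy *(8) .
    then have "(p \<otimes>\<^bsub>A\<^esub> y) \<otimes>\<^bsub>A\<^esub> s' = (q \<otimes>\<^bsub>A\<^esub> d) \<otimes>\<^bsub>A\<^esub> s'"
      using p(1,2) *(3,6) y by (simp add: A.m_assoc)
    then have py: "p \<otimes>\<^bsub>A\<^esub> y = q \<otimes>\<^bsub>A\<^esub> d" using rcan[OF *(3)] p(1,2) *(6) y by simp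
    have "p \<otimes>\<^bsub>A\<^esub> (x \<otimes>\<^bsub>A\<^esub> r) = q \<otimes>\<^bsub>A\<^esub> (c \<otimes>\<^bsub>A\<^esub> r)"
      using px p(1,2) *(2,5) x by (metis A.m_assoc Cc)
    also have "\<dots> = p \<otimes>\<^bsub>A\<^esub> (y \<otimes>\<^bsub>A\<^esub> r')"
      unfolding *(9) using py p(1,2) *(4,6) y by (metis A.m_assoc Cc)
    finally show ?thesis using lcan[OF p(1)] *(2,4) x y by simp
  qed
  have relI: "rel s r s' r'" if "s \<in> C" "r \<in> carrier A" "s' \<in> C" "r' \<in> carrier A"
    "c \<in> carrier A" "d \<in> carrier A" "c \<otimes>\<^bsub>A\<^esub> s \<in> C" "c \<otimes>\<^bsub>A\<^esub> s = d \<otimes>\<^bsub>A\<^esub> s'"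
    "c \<otimes>\<^bsub>A\<^esub> r = d \<otimes>\<^bsub>A\<^esub> r'" for s r s' r' c d
    using that unfolding rel_def frac_rel_def by blast
  have relI': "rel s r s' r'" if c: "s \<in> C" "r \<in> carrier A" "s' \<in> C" "r' \<in> carrier A"
    and h: "\<And>x y. x \<in> carrier A \<Longrightarrow> y \<in> carrier A \<Longrightarrow> x \<otimes>\<^bsub>A\<^esub> s = y \<otimes>\<^bsub>A\<^esub> s' \<Longrightarrow> x \<otimes>\<^bsub>A\<^esub> r = y \<otimes>\<^bsub>A\<^esub> r'"
    for s r s' r'
  proof -
    obtain t b where t: "t \<in> C" "b \<in> carrier A" "t \<otimes>\<^bsub>A\<^esub> s = b \<otimes>\<^bsub>A\<^esub> s'" using ore[of s s'] c by auto
    show ?thesis using t c h[of t b] C.m_closed[of t s] by (intro relI[of s r s' r' t b]) auto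
  qed
  have relC: "s \<in> C \<and> r \<in> carrier A \<and> s' \<in> C \<and> r' \<in> carrier A" if "rel s r s' r'" for s r s' r'
    using that unfolding rel_def frac_rel_def by auto
  have refl: "rel s r s r" if "s \<in> C" "r \<in> carrier A" for s r
    using that by (intro relI[of s r s r "\<one>\<^bsub>A\<^esub>" "\<one>\<^bsub>A\<^esub>"]) auto
  have sym: "rel s' r' s r" if "rel s r s' r'" for s r s' r'
    using relC[OF that] relD[OF that] by (intro relI') metis+
  have trans: "rel s r s'' r''" if 1: "rel s r s' r'" and 2: "rel s' r' s'' r''" for s r s' r' s'' r''
  proof -
    obtain c d where c: "c \<in> carrier A" "d \<in> carrier A" "c \<otimes>\<^bsub>A\<^esub> s \<in> C" "c \<otimes>\<^bsub>A\<^esub> s = d \<otimes>\<^bsub>A\<^esub> s'"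
      "c \<otimes>\<^bsub>A\<^esub> r = d \<otimes>\<^bsub>A\<^esub> r'" using 1 unfolding rel_def frac_rel_def by auto
    have C1: "s \<in> C" "r \<in> carrier A" "s' \<in> C" "r' \<in> carrier A" "s'' \<in> C" "r'' \<in> carrier A"
      using relC[OF 1] relC[OF 2] by auto
    obtain p q where p: "p \<in> C" "q \<in> carrier A" "p \<otimes>\<^bsub>A\<^esub> (d \<otimes>\<^bsub>A\<^esub> s') = q \<otimes>\<^bsub>A\<^esub> s''"
      using ore[of "d \<otimes>\<^bsub>A\<^esub> s'" s''] c C1 by auto
    have "(p \<otimes>\<^bsub>A\<^esub> d) \<otimes>\<^bsub>A\<^esub> r' = q \<otimes>\<^bsub>A\<^esub> r''"
      using relD[OF 2, of "p \<otimes>\<^bsub>A\<^esub> d" q] p c C1 by (simp add: A.m_assoc)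
    then have "(p \<otimes>\<^bsub>A\<^esub> c) \<otimes>\<^bsub>A\<^esub> r = q \<otimes>\<^bsub>A\<^esub> r''" using c p(1) C1 by (simp add: A.m_assoc)
    moreover have "(p \<otimes>\<^bsub>A\<^esub> c) \<otimes>\<^bsub>A\<^esub> s = q \<otimes>\<^bsub>A\<^esub> s''" using p c(1,2,4) C1 by (simp add: A.m_assoc)
    moreover have "(p \<otimes>\<^bsub>A\<^esub> c) \<otimes>\<^bsub>A\<^esub> s \<in> C"
      using C.m_closed[OF p(1) c(3)] p(1) c(1) C1 by (simp add: A.m_assoc)
    ultimately show ?thesis
      using relI[of s r s'' r'' "p \<otimes>\<^bsub>A\<^esub> c" q] C1 p(1,2) c(1) by simp
  qed
  have frac_eq: "frac A C s r = frac A C s' r'" if "rel s r s' r'" for s r s' r'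
  proof -
    have "rel s r p q \<longleftrightarrow> rel s' r' p q" for p q using that sym trans by metis
    then show ?thesis unfolding frac_def rel_def by auto
  qed
  have frac_mem: "(p, q) \<in> frac A C s r \<longleftrightarrow> rel s r p q" for p q s r
    unfolding frac_def rel_def by simp
  have eq_rel: "rel s r s' r'" if "frac A C s r = frac A C s' r'" "s' \<in> C" "r' \<in> carrier A" for s r s' r'
    using that frac_mem refl by metis
  have mult: "frac A C s r \<otimes>\<^bsub>Q_lcl A\<^esub> frac A C s' r' = frac A C (t \<otimes>\<^bsub>A\<^esub> s) (a \<otimes>\<^bsub>A\<^esub> r')"
    if c: "s \<in> C" "r \<in> carrier A" "s' \<in> C" "r' \<in> carrier A" "t \<in> C" "a \<in> carrier A"
      and ta: "t \<otimes>\<^bsub>A\<^esub> r = a \<otimes>\<^bsub>A\<^esub> s'" for s r s' r' t a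
  proof -
    let ?M = "{frac A C (t \<otimes>\<^bsub>A\<^esub> s1) (a \<otimes>\<^bsub>A\<^esub> r1') | s1 r1 s1' r1' t a.
      (s1, r1) \<in> frac A C s r \<and> (s1', r1') \<in> frac A C s' r' \<and> t \<in> C \<and> a \<in> carrier A \<and>
                t \<otimes>\<^bsub>A\<^esub> r1 = a \<otimes>\<^bsub>A\<^esub> s1'}"
    have "Y = frac A C (t \<otimes>\<^bsub>A\<^esub> s) (a \<otimes>\<^bsub>A\<^esub> r')" if M: "Y \<in> ?M" for Y
    proof -
      obtain s1 r1 s1' r1' t1 a1 where Y: "Y = frac A C (t1 \<otimes>\<^bsub>A\<^esub> s1) (a1 \<otimes>\<^bsub>A\<^esub> r1')"
        and 1: "rel s r s1 r1" and 2: "rel s' r' s1' r1'" and 3: "t1 \<in> C" "a1 \<in> carrier A"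
          "t1 \<otimes>\<^bsub>A\<^esub> r1 = a1 \<otimes>\<^bsub>A\<^esub> s1'"
        using M unfolding frac_mem by blast
      have C1: "s1 \<in> C" "r1 \<in> carrier A" "s1' \<in> C" "r1' \<in> carrier A"
        using relC[OF 1] relC[OF 2] by auto
      have "rel (t \<otimes>\<^bsub>A\<^esub> s) (a \<otimes>\<^bsub>A\<^esub> r') (t1 \<otimes>\<^bsub>A\<^esub> s1) (a1 \<otimes>\<^bsub>A\<^esub> r1')"
      proof (rule relI')
        fix x y assume x: "x \<in> carrier A" and y: "y \<in> carrier A"
          and xy: "x \<otimes>\<^bsub>A\<^esub> (t \<otimes>\<^bsub>A\<^esub> s) = y \<otimes>\<^bsub>A\<^esub> (t1 \<otimes>\<^bsub>A\<^esub> s1)"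
        have "(x \<otimes>\<^bsub>A\<^esub> t) \<otimes>\<^bsub>A\<^esub> r = (y \<otimes>\<^bsub>A\<^esub> t1) \<otimes>\<^bsub>A\<^esub> r1"
          using relD[OF 1, of "x \<otimes>\<^bsub>A\<^esub> t" "y \<otimes>\<^bsub>A\<^esub> t1"] x y xy c C1 3(1) by (simp add: A.m_assoc)
        then have "x \<otimes>\<^bsub>A\<^esub> (t \<otimes>\<^bsub>A\<^esub> r) = y \<otimes>\<^bsub>A\<^esub> (t1 \<otimes>\<^bsub>A\<^esub> r1)"
          using x y c(2,5) C1(2) 3(1) by (simp add: A.m_assoc)
        then have "(x \<otimes>\<^bsub>A\<^esub> a) \<otimes>\<^bsub>A\<^esub> s' = (y \<otimes>\<^bsub>A\<^esub> a1) \<otimes>\<^bsub>A\<^esub> s1'"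
          unfolding ta 3(3) using x y c(3,6) C1(3) 3(2) by (simp add: A.m_assoc)
        then have "(x \<otimes>\<^bsub>A\<^esub> a) \<otimes>\<^bsub>A\<^esub> r' = (y \<otimes>\<^bsub>A\<^esub> a1) \<otimes>\<^bsub>A\<^esub> r1'"
          using relD[OF 2] x y c(6) 3(2) by simp
        then show "x \<otimes>\<^bsub>A\<^esub> (a \<otimes>\<^bsub>A\<^esub> r') = y \<otimes>\<^bsub>A\<^esub> (a1 \<otimes>\<^bsub>A\<^esub> r1')"
          using x y c(4,6) C1(4) 3(2) by (simp add: A.m_assoc)
      qed (use c C1 3 in auto)
      then show ?thesis unfolding Y using frac_eq by simp
    qed
    moreover have "frac A C (t \<otimes>\<^bsub>A\<^esub> s) (a \<otimes>\<^bsub>A\<^esub> r') \<in> ?M"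
      using c ta refl unfolding frac_mem by blast
    ultimately have "\<Union>?M = frac A C (t \<otimes>\<^bsub>A\<^esub> s) (a \<otimes>\<^bsub>A\<^esub> r')" by blast
    then show ?thesis by (simp add: Q_lcl_def left_localization_def C_def[symmetric])
  qed
  \<comment> \<open>Sums are evaluated over a shared denominator, which is what additivity of the
    embedding asks for.\<close>
  have add: "frac A C s r \<oplus>\<^bsub>Q_lcl A\<^esub> frac A C s r' = frac A C s (r \<oplus>\<^bsub>A\<^esub> r')"
    if c: "s \<in> C" "r \<in> carrier A" "r' \<in> carrier A" for s r r'
  proof -
    let ?M = "{frac A C (x \<otimes>\<^bsub>A\<^esub> s1) ((x \<otimes>\<^bsub>A\<^esub> r1) \<oplus>\<^bsub>A\<^esub> (d \<otimes>\<^bsub>A\<^esub> r1')) | s1 r1 s1' r1' x d.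
                (s1, r1) \<in> frac A C s r \<and> (s1', r1') \<in> frac A C s r' \<and> x \<in> carrier A \<and> d \<in> carrier A \<and>
                x \<otimes>\<^bsub>A\<^esub> s1 \<in> C \<and> x \<otimes>\<^bsub>A\<^esub> s1 = d \<otimes>\<^bsub>A\<^esub> s1'}"
    have "Y = frac A C s (r \<oplus>\<^bsub>A\<^esub> r')" if M: "Y \<in> ?M" for Y
    proof -
      obtain s1 r1 s1' r1' c1 d1 where Y: "Y = frac A C (c1 \<otimes>\<^bsub>A\<^esub> s1) ((c1 \<otimes>\<^bsub>A\<^esub> r1) \<oplus>\<^bsub>A\<^esub> (d1 \<otimes>\<^bsub>A\<^esub> r1'))"
        and 1: "rel s r s1 r1" and 2: "rel s r' s1' r1'" and 3: "c1 \<in> carrier A" "d1 \<in> carrier A"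
          "c1 \<otimes>\<^bsub>A\<^esub> s1 \<in> C" "c1 \<otimes>\<^bsub>A\<^esub> s1 = d1 \<otimes>\<^bsub>A\<^esub> s1'"
        using M unfolding frac_mem by blast
      have C1: "s1 \<in> C" "r1 \<in> carrier A" "s1' \<in> C" "r1' \<in> carrier A"
        using relC[OF 1] relC[OF 2] by auto
      have "rel s (r \<oplus>\<^bsub>A\<^esub> r') (c1 \<otimes>\<^bsub>A\<^esub> s1) (c1 \<otimes>\<^bsub>A\<^esub> r1 \<oplus>\<^bsub>A\<^esub> d1 \<otimes>\<^bsub>A\<^esub> r1')"
      proof (rule relI')
        fix x y assume x: "x \<in> carrier A" and y: "y \<in> carrier A"
          and xy: "x \<otimes>\<^bsub>A\<^esub> s = y \<otimes>\<^bsub>A\<^esub> (c1 \<otimes>\<^bsub>A\<^esub> s1)"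
        have "x \<otimes>\<^bsub>A\<^esub> s = (y \<otimes>\<^bsub>A\<^esub> c1) \<otimes>\<^bsub>A\<^esub> s1" using xy x y 3(1) C1 by (simp add: A.m_assoc)
        then have e1: "x \<otimes>\<^bsub>A\<^esub> r = (y \<otimes>\<^bsub>A\<^esub> c1) \<otimes>\<^bsub>A\<^esub> r1"
          using relD[OF 1] x y 3(1) by simp
        have "x \<otimes>\<^bsub>A\<^esub> s = (y \<otimes>\<^bsub>A\<^esub> d1) \<otimes>\<^bsub>A\<^esub> s1'"
          using xy x y 3(2) C1 unfolding 3(4) by (simp add: A.m_assoc)
        then have e2: "x \<otimes>\<^bsub>A\<^esub> r' = (y \<otimes>\<^bsub>A\<^esub> d1) \<otimes>\<^bsub>A\<^esub> r1'"
          using relD[OF 2] x y 3(2) by simp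
        have "x \<otimes>\<^bsub>A\<^esub> (r \<oplus>\<^bsub>A\<^esub> r') = x \<otimes>\<^bsub>A\<^esub> r \<oplus>\<^bsub>A\<^esub> x \<otimes>\<^bsub>A\<^esub> r'"
          using x c by (simp add: A.r_distr)
        then show "x \<otimes>\<^bsub>A\<^esub> (r \<oplus>\<^bsub>A\<^esub> r') = y \<otimes>\<^bsub>A\<^esub> (c1 \<otimes>\<^bsub>A\<^esub> r1 \<oplus>\<^bsub>A\<^esub> d1 \<otimes>\<^bsub>A\<^esub> r1')"
          unfolding e1 e2 using y 3(1,2) C1(2,4) by (simp add: A.r_distr A.m_assoc)
      qed (use c C1 3 in auto)
      then show ?thesis unfolding Y using frac_eq by simp
    qed
    moreover have "frac A C (\<one>\<^bsub>A\<^esub> \<otimes>\<^bsub>A\<^esub> s) (\<one>\<^bsub>A\<^esub> \<otimes>\<^bsub>A\<^esub> r \<oplus>\<^bsub>A\<^esub> \<one>\<^bsub>A\<^esub> \<otimes>\<^bsub>A\<^esub> r') \<in> ?M"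
      using c refl[of s r] refl[of s r'] A.one_closed C.m_closed[OF C.one_closed c(1)]
      unfolding frac_mem by blast
    moreover have "frac A C (\<one>\<^bsub>A\<^esub> \<otimes>\<^bsub>A\<^esub> s) (\<one>\<^bsub>A\<^esub> \<otimes>\<^bsub>A\<^esub> r \<oplus>\<^bsub>A\<^esub> \<one>\<^bsub>A\<^esub> \<otimes>\<^bsub>A\<^esub> r') = frac A C s (r \<oplus>\<^bsub>A\<^esub> r')"
      using c by simp
    ultimately have "\<Union>?M = frac A C s (r \<oplus>\<^bsub>A\<^esub> r')" by blast
    then show ?thesis by (simp add: Q_lcl_def left_localization_def C_def[symmetric])
  qed
  have carrier: "carrier (Q_lcl A) = {frac A C s r | s r. s \<in> C \<and> r \<in> carrier A}"
    unfolding Q_lcl_def left_localization_def frac_def quotient_def C_def by auto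
  have one: "\<one>\<^bsub>Q_lcl A\<^esub> = frac A C \<one>\<^bsub>A\<^esub> \<one>\<^bsub>A\<^esub>"
    by (simp add: Q_lcl_def left_localization_def C_def)
  have zero: "\<zero>\<^bsub>Q_lcl A\<^esub> = frac A C \<one>\<^bsub>A\<^esub> \<zero>\<^bsub>A\<^esub>"
    by (simp add: Q_lcl_def left_localization_def C_def)
  have inj: "a = b" if "a \<in> carrier A" "b \<in> carrier A" "frac A C \<one>\<^bsub>A\<^esub> a = frac A C \<one>\<^bsub>A\<^esub> b" for a b
    using relD[OF eq_rel[OF that(3)], of "\<one>\<^bsub>A\<^esub>" "\<one>\<^bsub>A\<^esub>"] that by simp
  define \<iota> where "\<iota> = loc_map A C"
  have iota: "\<iota> a = frac A C \<one>\<^bsub>A\<^esub> a" for a by (simp add: \<iota>_def loc_map_def)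
  have "left_order (Q_lcl A) A \<iota>"
  proof (unfold_locales)
    show "\<iota> \<in> ring_hom A (Q_lcl A)"
    proof (rule ring_hom_memI)
      show "\<iota> x \<in> carrier (Q_lcl A)" if "x \<in> carrier A" for x
        unfolding carrier iota using that C.one_closed by blast
      show "\<iota> (x \<otimes>\<^bsub>A\<^esub> y) = \<iota> x \<otimes>\<^bsub>Q_lcl A\<^esub> \<iota> y" if "x \<in> carrier A" "y \<in> carrier A" for x y
        unfolding iota using mult[of "\<one>\<^bsub>A\<^esub>" x "\<one>\<^bsub>A\<^esub>" y "\<one>\<^bsub>A\<^esub>" x] that by simp
      show "\<iota> (x \<oplus>\<^bsub>A\<^esub> y) = \<iota> x \<oplus>\<^bsub>Q_lcl A\<^esub> \<iota> y" if "x \<in> carrier A" "y \<in> carrier A" for x y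
        unfolding iota using add[of "\<one>\<^bsub>A\<^esub>" x y] that by simp
      show "\<iota> \<one>\<^bsub>A\<^esub> = \<one>\<^bsub>Q_lcl A\<^esub>" by (simp add: iota one)
    qed
    show "inj_on \<iota> (carrier A)" using inj by (auto intro!: inj_onI simp: iota)
    show "\<one>\<^bsub>Q_lcl A\<^esub> \<noteq> \<zero>\<^bsub>Q_lcl A\<^esub>" unfolding one zero using inj assms(2) by blast
  next
    fix z assume "z \<in> carrier (Q_lcl A)"
    then obtain s r where z: "z = frac A C s r" "s \<in> C" "r \<in> carrier A" unfolding carrier by blast
    have fone: "frac A C s s = \<one>\<^bsub>Q_lcl A\<^esub>"
      unfolding one using z(2) by (intro frac_eq relI[of s s "\<one>\<^bsub>A\<^esub>" "\<one>\<^bsub>A\<^esub>" "\<one>\<^bsub>A\<^esub>" s]) auto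
    have "frac A C s \<one>\<^bsub>A\<^esub> \<otimes>\<^bsub>Q_lcl A\<^esub> \<iota> s = \<one>\<^bsub>Q_lcl A\<^esub>"
      unfolding iota using mult[of s "\<one>\<^bsub>A\<^esub>" "\<one>\<^bsub>A\<^esub>" s "\<one>\<^bsub>A\<^esub>" "\<one>\<^bsub>A\<^esub>"] z(2) fone by simp
    moreover have "\<iota> s \<otimes>\<^bsub>Q_lcl A\<^esub> frac A C s \<one>\<^bsub>A\<^esub> = \<one>\<^bsub>Q_lcl A\<^esub>"
      unfolding iota using mult[of "\<one>\<^bsub>A\<^esub>" s s "\<one>\<^bsub>A\<^esub>" "\<one>\<^bsub>A\<^esub>" "\<one>\<^bsub>A\<^esub>"] z(2) one by simp
    moreover have "frac A C s \<one>\<^bsub>A\<^esub> \<in> carrier (Q_lcl A)" "\<iota> s \<in> carrier (Q_lcl A)"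
      unfolding carrier iota using z(2) Cc[OF z(2)] C.one_closed A.one_closed by blast+
    ultimately have "\<iota> s \<in> Units (Q_lcl A)" unfolding Units_def by blast
    moreover have "\<iota> s \<otimes>\<^bsub>Q_lcl A\<^esub> z = \<iota> r"
      unfolding z(1) iota using mult[of "\<one>\<^bsub>A\<^esub>" s s r "\<one>\<^bsub>A\<^esub>" "\<one>\<^bsub>A\<^esub>"] z by simp
    ultimately show "\<exists>c\<in>carrier A. \<iota> c \<in> Units (Q_lcl A) \<and> (\<exists>a\<in>carrier A. \<iota> c \<otimes>\<^bsub>Q_lcl A\<^esub> z = \<iota> a)"
      using Cc[OF z(2)] z(3) by blast
  qed
  then show ?thesis by (simp add: \<iota>_def C_def)
qed

lemma (in ring) left_order_self: "\<one> \<noteq> \<zero> \<Longrightarrow> left_order R R id"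
  by unfold_locales (auto simp: ring_hom_def intro!: bexI[of _ \<one>])

section \<open>Products of rings\<close>

lemma ring_product_ring:
  assumes "\<And>i. i \<in> I \<Longrightarrow> ring (F i)"
  shows "ring (product_ring I F)"
proof -
  note [simp] = ring.ring_simprules ring.is_monoid[THEN monoid.r_one]
  have neg: "(\<lambda>i\<in>I. \<ominus>\<^bsub>F i\<^esub> x i) \<in> carrier (product_ring I F) \<and>
      (\<lambda>i\<in>I. \<ominus>\<^bsub>F i\<^esub> x i) \<oplus>\<^bsub>product_ring I F\<^esub> x = \<zero>\<^bsub>product_ring I F\<^esub>"
    if "x \<in> carrier (product_ring I F)" for x
    using that assms by (auto simp: product_ring_def PiE_iff fun_eq_iff)
  have "abelian_group (product_ring I F)"
  proof (rule abelian_groupI)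
    show "\<exists>y\<in>carrier (product_ring I F). y \<oplus>\<^bsub>product_ring I F\<^esub> x = \<zero>\<^bsub>product_ring I F\<^esub>"
      if "x \<in> carrier (product_ring I F)" for x
      using neg[OF that] by blast
  qed (use assms in \<open>auto simp: product_ring_def PiE_iff fun_eq_iff extensional_def\<close>)
  moreover have "monoid (product_ring I F)"
    by (rule monoidI) (use assms in \<open>auto simp: product_ring_def PiE_iff fun_eq_iff extensional_def\<close>)
  ultimately show ?thesis
    by (rule ringI) (use assms in \<open>auto simp: product_ring_def PiE_iff fun_eq_iff extensional_def\<close>)
qed

text \<open>Applied with \<pi> = \<open>order_den\<close>, to pass from factors indexed by
  idempotents to factors indexed by maximal denominator sets.\<close>

lemma product_ring_iso:
  assumes bij: "bij_betw \<pi> I J" and iso: "\<And>i. i \<in> I \<Longrightarrow> F i \<simeq> G (\<pi> i)"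
  shows "product_ring I F \<simeq> product_ring J G"
proof -
  have "\<exists>h. \<forall>i\<in>I. h i \<in> ring_iso (F i) (G (\<pi> i))"
    using iso unfolding is_ring_iso_def by (intro bchoice) blast
  then obtain h where h: "\<And>i. i \<in> I \<Longrightarrow> h i \<in> ring_iso (F i) (G (\<pi> i))" by blast
  define k where "k = inv_into I \<pi>"
  have k: "k j \<in> I" "\<pi> (k j) = j" if "j \<in> J" for j
    using bij that unfolding k_def by (auto simp: bij_betw_def inv_into_into f_inv_into_f)
  have k': "k (\<pi> i) = i" "\<pi> i \<in> J" if "i \<in> I" for i
    using bij that unfolding k_def by (auto simp: bij_betw_def)
  have hk: "h (k j) \<in> ring_iso (F (k j)) (G j)" if "j \<in> J" for j
    using h[OF k(1)[OF that]] k(2)[OF that] by simp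
  note E = ring_iso_memE[OF hk]
  define H where "H x = (\<lambda>j\<in>J. h (k j) (x (k j)))" for x
  have "bij_betw H (carrier (product_ring I F)) (carrier (product_ring J G))"
    unfolding bij_betw_def
  proof
    show "inj_on H (carrier (product_ring I F))"
    proof (rule inj_onI)
      fix x y assume x: "x \<in> carrier (product_ring I F)" and y: "y \<in> carrier (product_ring I F)"
        and eq: "H x = H y"
      show "x = y"
      proof (rule PiE_ext)
        show "x \<in> (\<Pi>\<^sub>E i\<in>I. carrier (F i))" "y \<in> (\<Pi>\<^sub>E i\<in>I. carrier (F i))"
          using x y by (simp_all add: product_ring_def)
        fix i assume i: "i \<in> I"
        have "h i (x i) = h i (y i)" using fun_cong[OF eq, of "\<pi> i"] k'[OF i] by (simp add: H_def)
        moreover have "inj_on (h i) (carrier (F i))"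
          using ring_iso_memE(5)[OF h[OF i]] by (simp add: bij_betw_def)
        ultimately show "x i = y i"
          using x y i by (auto simp: product_ring_def PiE_iff dest: inj_onD)
      qed
    qed
    show "H ` carrier (product_ring I F) = carrier (product_ring J G)"
    proof (intro equalityI subsetI)
      fix z assume "z \<in> H ` carrier (product_ring I F)"
      then show "z \<in> carrier (product_ring J G)"
        using E(1) k(1) by (auto simp: product_ring_def H_def PiE_iff)
    next
      fix z assume z: "z \<in> carrier (product_ring J G)"
      have "\<exists>y\<in>carrier (F i). h i y = z (\<pi> i)" if "i \<in> I" for i
        using ring_iso_memE(5)[OF h[OF that]] z k'[OF that]
        by (auto simp: bij_betw_def product_ring_def PiE_iff image_iff) (metis imageE)
      then obtain y where y: "\<And>i. i \<in> I \<Longrightarrow> y i \<in> carrier (F i) \<and> h i (y i) = z (\<pi> i)"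
        by metis
      have "restrict y I \<in> carrier (product_ring I F)" using y by (simp add: product_ring_def)
      moreover have "H (restrict y I) = z"
        using y k z by (auto simp: H_def product_ring_def fun_eq_iff PiE_iff extensional_def)
      ultimately show "z \<in> H ` carrier (product_ring I F)" by blast
    qed
  qed
  moreover have "H x \<in> carrier (product_ring J G)" if "x \<in> carrier (product_ring I F)" for x
    using that E(1) k(1) by (auto simp: product_ring_def H_def PiE_iff)
  ultimately have "H \<in> ring_iso (product_ring I F) (product_ring J G)"
    using E(2-4) k(1)
    by (intro ring_iso_memI) (auto simp: product_ring_def H_def PiE_iff fun_eq_iff)
  then show ?thesis unfolding is_ring_iso_def by blast
qed

section \<open>Minimal semicentral idempotents and maximal denominator sets\<close>

context left_order
begin

section \<open>The ideal (1 - f)R and its denominator set\<close>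

lemma order_den_mono: "right_ann f \<subseteq> right_ann g \<Longrightarrow> order_den f \<subseteq> order_den g"
  unfolding order_den_def using units_modulo_mono by blast

text \<open>The set \<open>order_den f\<close> determines the trace of \<open>right_ann f\<close> on
  \<open>A\<close> through \<open>ass\<close>, and each x in \<open>R\<close> is carried into
  \<open>A\<close> by a unit, so the trace determines the ideal.\<close>

lemma right_ann_mono_of_order_den:
  assumes f: "right_semicentral f" and g: "right_semicentral g"
    and sub: "order_den f \<subseteq> order_den g"
  shows "right_ann f \<subseteq> right_ann g"
proof
  fix x assume x: "x \<in> right_ann f"
  obtain c a where c: "c \<in> carrier A" "\<phi> c \<in> Units R" "a \<in> carrier A" "\<phi> c \<otimes> x = \<phi> a"
    using fraction x by blast
  have "\<phi> c \<otimes> x \<in> right_ann f"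
    using ideal.I_l_closed[OF right_semicentral_ideal[OF f] x] c(2) by blast
  then have "a \<in> ass A (order_den f)" using ass_order_den[OF f] c by simp
  then have "a \<in> ass A (order_den g)" using sub unfolding ass_def by blast
  then have "\<phi> c \<otimes> x \<in> right_ann g" using ass_order_den[OF g] c by simp
  then have "inv (\<phi> c) \<otimes> (\<phi> c \<otimes> x) \<in> right_ann g"
    using ideal.I_l_closed[OF right_semicentral_ideal[OF g]] c(2) by blast
  moreover have "inv (\<phi> c) \<otimes> (\<phi> c \<otimes> x) = x"
    using c(1,2) x by (simp add: R.m_assoc[symmetric])
  ultimately show "x \<in> right_ann g" by simp
qed

text \<open>The quotient serves as the model of the localization: the kernel of A \<rightarrow> R/(1
  - f)R is \<open>ass\<close> by \<open>ass_order_den\<close>, and denominators that are units of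
  \<open>R\<close> already lie in \<open>order_den f\<close>.\<close>

lemma localization_order_den:
  assumes f: "right_semicentral f" and f0: "f \<noteq> \<zero>"
  obtains G where "G \<in> ring_iso (R Quot right_ann f) (left_localization A (order_den f))"
    "\<forall>a\<in>carrier A. G (right_ann f +> \<phi> a) = loc_map A (order_den f) a"
proof -
  define I where "I = right_ann f"
  note K = right_semicentral_ideal[OF f, folded I_def]
  have mem: "x \<in> I \<longleftrightarrow> f \<otimes> x = \<zero>" if "x \<in> carrier R" for x
    using that by (simp add: I_def)
  have den: "order_den f = {a \<in> carrier A. \<phi> a \<in> units_modulo I}"
    by (simp add: order_den_def I_def)
  interpret K: ideal I R by (rule K)
  interpret Q: ring "R Quot I" by (rule K.quotient_is_ring)
  interpret pi: ring_hom_ring R "R Quot I" "(+>) I" by (rule K.rcos_ring_hom_ring)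
  have eq: "I +> x = I +> y \<longleftrightarrow> x \<ominus> y \<in> I"
    if "x \<in> carrier R" "y \<in> carrier R" for x y
    by (rule quotient_eq_iff_same_a_r_cos[OF K that, symmetric])
  have carrierQ: "\<exists>x\<in>carrier R. z = I +> x" if "z \<in> carrier (R Quot I)" for z
    using that unfolding FactRing_simps by auto
  have unit: "I +> c \<in> Units (R Quot I)" if "c \<in> units_modulo I" for c
  proof -
    obtain t where t: "t \<in> carrier R" "t \<otimes> c \<ominus> \<one> \<in> I" "c \<otimes> t \<ominus> \<one> \<in> I"
      and c: "c \<in> carrier R" using \<open>c \<in> units_modulo I\<close> unfolding units_modulo_def by blast
    have "I +> t \<otimes> c = I +> \<one>" "I +> c \<otimes> t = I +> \<one>"
      using eq[of "t \<otimes> c" \<one>] eq[of "c \<otimes> t" \<one>] t c by auto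
    then show ?thesis unfolding Units_def using t(1) c
      by (auto intro!: bexI[of _ "I +> t"] simp: pi.hom_mult[symmetric] pi.hom_one[symmetric] simp del: pi.hom_mult pi.hom_one)
  qed
  have hom: "(\<lambda>a. I +> \<phi> a) \<in> ring_hom A (R Quot I)"
    by (rule ring_hom_memI) auto
  show ?thesis
  proof (rule left_localization_characterization[OF A.ring_axioms Q.ring_axioms hom, of "order_den f"])
    show "left_Ore_set A (order_den f)" using order_den_Den_l[OF f f0] by (simp add: Den_l_def)
    show "I +> \<phi> s \<in> Units (R Quot I)" if "s \<in> order_den f" for s
      using that unit by (simp add: den)
    show "r \<in> ass A (order_den f)"
      if r: "r \<in> carrier A" and "I +> \<phi> r = \<zero>\<^bsub>R Quot I\<^esub>" for r
    proof -
      have "I +> \<phi> r = I +> \<zero>" using that(2) by simp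
      then have "\<phi> r \<ominus> \<zero> \<in> I" using eq[of "\<phi> r" \<zero>] r by simp
      then have "\<phi> r \<in> I" using r by (simp add: R.minus_eq)
      then show ?thesis using ass_order_den[OF f] r mem by simp
    qed
    show "\<exists>s\<in>order_den f. \<exists>r\<in>carrier A. I +> \<phi> r = (I +> \<phi> s) \<otimes>\<^bsub>R Quot I\<^esub> z"
      if z: "z \<in> carrier (R Quot I)" for z
    proof -
      obtain x where x: "x \<in> carrier R" "z = I +> x" using carrierQ[OF z] by blast
      obtain c a where c: "c \<in> carrier A" "\<phi> c \<in> Units R" "a \<in> carrier A" "\<phi> c \<otimes> x = \<phi> a"
        using fraction x(1) by blast
      have "c \<in> order_den f"
        using c Units_subset_units_modulo[OF ideal_imp_left_ideal[OF K]] by (auto simp: den)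
      moreover have "I +> \<phi> a = (I +> \<phi> c) \<otimes>\<^bsub>R Quot I\<^esub> z"
        unfolding c(4)[symmetric] x(2) using c(1) x(1) by simp
      ultimately show ?thesis using c(3) by blast
    qed
  qed (use that[folded I_def] in blast)
qed

end

text \<open>Abstracts min I'_l(R). By \<open>cover\<close> and orthogonality, the ideals (1 - g)R
  with g in \<open>M\<close> are exactly the maximal ones among all (1 - f)R with f \<noteq> 0 right
  semicentral.\<close>

locale orthogonal_semicentral = left_order +
  fixes M
  assumes art: "left_artinian R" and finite: "finite M"
    and semicentral: "g \<in> M \<Longrightarrow> right_semicentral g" and nonzero: "g \<in> M \<Longrightarrow> g \<noteq> \<zero>"
    and orth: "g \<in> M \<Longrightarrow> h \<in> M \<Longrightarrow> g \<noteq> h \<Longrightarrow> g \<otimes> h = \<zero>"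
    and cover: "right_semicentral f \<Longrightarrow> f \<noteq> \<zero> \<Longrightarrow> \<exists>g\<in>M. right_ann f \<subseteq> right_ann g"
begin

section \<open>The sum of the orthogonal idempotents and the Chinese remainder theorem\<close>

definition total :: 'a where "total = (\<Oplus>g\<in>M. g)"

lemma M_closed: "g \<in> M \<Longrightarrow> g \<in> carrier R" and M_idem: "g \<in> M \<Longrightarrow> g \<otimes> g = g"
  and M_semi: "g \<in> M \<Longrightarrow> x \<in> carrier R \<Longrightarrow> g \<otimes> x \<otimes> g = g \<otimes> x"
  using semicentral by (auto simp: right_semicentral_def)

lemma M_nonempty: "M \<noteq> {}"
proof -
  have "right_semicentral \<one>" by (simp add: right_semicentral_def)
  then show ?thesis using cover nontrivial by blast
qed

text \<open>If g and h were different, orthogonality would put h into \<open>right_ann g\<close>,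
  hence into \<open>right_ann h\<close>, giving h = h h = 0.\<close>

lemma right_ann_inj:
  assumes "g \<in> M" "h \<in> M" "right_ann g \<subseteq> right_ann h"
  shows "g = h"
proof (rule ccontr)
  assume "g \<noteq> h"
  then have "h \<in> right_ann g" using orth M_closed assms by blast
  then have "h \<otimes> h = \<zero>" using assms(3) by blast
  then show False using M_idem nonzero assms(2) by auto
qed

text \<open>The surjectivity half of the Chinese remainder theorem by an explicit formula: left
  multiplication by h keeps only the summand at h.\<close>

lemma glue:
  assumes y: "\<And>g. g \<in> M \<Longrightarrow> y g \<in> carrier R"
  shows "(\<Oplus>g\<in>M. g \<otimes> y g) \<in> carrier R"
    and "h \<in> M \<Longrightarrow> h \<otimes> (\<Oplus>g\<in>M. g \<otimes> y g) = h \<otimes> y h"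
proof -
  have c: "(\<lambda>g. g \<otimes> y g) \<in> M \<rightarrow> carrier R" using y M_closed by auto
  then show "(\<Oplus>g\<in>M. g \<otimes> y g) \<in> carrier R" by simp
  assume h: "h \<in> M"
  have "h \<otimes> (\<Oplus>g\<in>M. g \<otimes> y g) = (\<Oplus>g\<in>M. h \<otimes> (g \<otimes> y g))"
    using finsum_rdistr[OF finite M_closed[OF h] c] .
  also have "\<dots> = (\<Oplus>g\<in>M. if h = g then h \<otimes> y g else \<zero>)"
  proof (rule finsum_cong')
    show "h \<otimes> (g \<otimes> y g) = (if h = g then h \<otimes> y g else \<zero>)" if "g \<in> M" for g
      using orth[OF h that] M_idem[OF h] M_closed h that y[OF that]
      by (auto simp: R.m_assoc[symmetric])
  qed (use M_closed y h in auto)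
  also have "\<dots> = h \<otimes> y h"
    by (rule add.finprod_singleton[OF h finite]) (use M_closed y h in auto)
  finally show "h \<otimes> (\<Oplus>g\<in>M. g \<otimes> y g) = h \<otimes> y h" .
qed

lemma total_closed: "total \<in> carrier R"
  unfolding total_def using M_closed by (intro finsum_closed) auto

lemma mult_total: "g \<in> M \<Longrightarrow> g \<otimes> total = g"
proof -
  assume g: "g \<in> M"
  have "total = (\<Oplus>g\<in>M. g \<otimes> \<one>)"
    unfolding total_def using M_closed by (intro finsum_cong') auto
  then show ?thesis using glue(2)[of "\<lambda>_. \<one>" g] M_closed[OF g] g by simp
qed

text \<open>Since g total = g, multiplying by \<open>total\<close> loses nothing that a single g
  sees. Identities for \<open>total\<close> can therefore be checked one g at a time.\<close>

lemma total_zero_iff: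
  assumes x: "x \<in> carrier R"
  shows "total \<otimes> x = \<zero> \<longleftrightarrow> (\<forall>g\<in>M. g \<otimes> x = \<zero>)"
proof
  assume 0: "total \<otimes> x = \<zero>"
  show "\<forall>g\<in>M. g \<otimes> x = \<zero>"
  proof
    fix g assume g: "g \<in> M"
    have "g \<otimes> x = g \<otimes> (total \<otimes> x)"
      using mult_total[OF g] M_closed[OF g] total_closed x by (simp add: R.m_assoc[symmetric])
    then show "g \<otimes> x = \<zero>" using 0 M_closed[OF g] by simp
  qed
next
  assume 0: "\<forall>g\<in>M. g \<otimes> x = \<zero>"
  have "total \<otimes> x = (\<Oplus>g\<in>M. g \<otimes> x)"
    unfolding total_def using finite x M_closed by (intro finsum_ldistr) auto
  also have "\<dots> = \<zero>" using 0 by (intro add.finprod_one_eqI) auto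
  finally show "total \<otimes> x = \<zero>" .
qed

lemma right_ann_total: "right_ann total = (\<Inter>g\<in>M. right_ann g)"
  using total_zero_iff M_nonempty by auto

lemma total_idem: "total \<otimes> total = total"
proof -
  have "g \<otimes> (total \<ominus> \<one>) = \<zero>" if "g \<in> M" for g
    using mult_total[OF that] M_closed[OF that] total_closed
    by (simp add: R.minus_eq R.r_distr R.r_minus R.r_neg)
  then have "total \<otimes> (total \<ominus> \<one>) = \<zero>" using total_zero_iff total_closed by simp
  moreover have "total \<otimes> (total \<ominus> \<one>) = total \<otimes> total \<ominus> total"
    using total_closed by (simp add: R.minus_eq R.r_distr R.r_minus)
  ultimately show ?thesis using minus_eq_zero_iff total_closed by simp
qed

text \<open>For each g, semicentrality gives g x (1 - total) = g x g (1 - total), and g (1 - total)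
  = 0.\<close>

lemma total_semicentral: "right_semicentral total"
proof -
  have "total \<otimes> (x \<otimes> (\<one> \<ominus> total)) = \<zero>" if x: "x \<in> carrier R" for x
  proof -
    have "g \<otimes> (x \<otimes> (\<one> \<ominus> total)) = \<zero>" if g: "g \<in> M" for g
    proof -
      have "g \<otimes> (x \<otimes> (\<one> \<ominus> total)) = g \<otimes> x \<otimes> g \<otimes> (\<one> \<ominus> total)"
        using M_semi[OF g x] M_closed[OF g] x total_closed by (simp add: R.m_assoc)
      also have "\<dots> = g \<otimes> x \<otimes> (g \<otimes> (\<one> \<ominus> total))"
        using M_closed[OF g] x total_closed by (simp add: R.m_assoc)
      also have "g \<otimes> (\<one> \<ominus> total) = \<zero>"
        using mult_total[OF g] M_closed[OF g] total_closed
        by (simp add: R.minus_eq R.r_distr R.r_minus R.r_neg)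
      finally show ?thesis using M_closed[OF g] x by simp
    qed
    then show ?thesis using total_zero_iff x total_closed by simp
  qed
  then show ?thesis
    using right_semicentral_iff[OF total_closed total_idem] total_closed by (simp add: R.m_assoc)
qed

lemma total_nonzero: "total \<noteq> \<zero>"
proof
  assume "total = \<zero>"
  obtain g where g: "g \<in> M" using M_nonempty by blast
  then show False using mult_total[OF g] nonzero[OF g] M_closed[OF g] \<open>total = \<zero>\<close> by simp
qed

text \<open>Inverses t g, valid modulo the separate ideals, are glued to one inverse T modulo their
  intersection.\<close>

lemma units_modulo_total: "units_modulo (right_ann total) = (\<Inter>g\<in>M. units_modulo (right_ann g))"
proof (intro equalityI subsetI)
  fix c assume "c \<in> units_modulo (right_ann total)"
  moreover have "right_ann total \<subseteq> right_ann g" if "g \<in> M" for g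
    using that unfolding right_ann_total by (rule INT_lower)
  ultimately show "c \<in> (\<Inter>g\<in>M. units_modulo (right_ann g))"
    using units_modulo_mono by blast
next
  fix c assume c: "c \<in> (\<Inter>g\<in>M. units_modulo (right_ann g))"
  then have cc: "c \<in> carrier R" using M_nonempty by (auto simp: units_modulo_def)
  have "\<exists>t. \<forall>g\<in>M. t g \<in> carrier R \<and> g \<otimes> t g \<otimes> c = g \<and> g \<otimes> c \<otimes> t g = g"
    using right_semicentral_units_modulo[OF semicentral] c by (intro bchoice) blast
  then obtain t where t: "\<And>g. g \<in> M \<Longrightarrow> t g \<in> carrier R" "\<And>g. g \<in> M \<Longrightarrow> g \<otimes> t g \<otimes> c = g"
    "\<And>g. g \<in> M \<Longrightarrow> g \<otimes> c \<otimes> t g = g" by blast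
  define T where "T = (\<Oplus>g\<in>M. g \<otimes> t g)"
  have Tc: "T \<in> carrier R" unfolding T_def using glue(1) t(1) by blast
  have gT: "g \<otimes> T = g \<otimes> t g" if "g \<in> M" for g unfolding T_def using glue(2) t(1) that by blast
  have "g \<otimes> (T \<otimes> c \<ominus> \<one>) = \<zero>" if g: "g \<in> M" for g
  proof -
    have "g \<otimes> (T \<otimes> c \<ominus> \<one>) = g \<otimes> T \<otimes> c \<ominus> g"
      using M_closed[OF g] Tc cc by (simp add: ring_simprules)
    then show ?thesis using gT[OF g] t(2)[OF g] M_closed[OF g] minus_eq_zero_iff by simp
  qed
  moreover have "g \<otimes> (c \<otimes> T \<ominus> \<one>) = \<zero>" if g: "g \<in> M" for g
  proof -
    have "g \<otimes> (c \<otimes> T \<ominus> \<one>) = g \<otimes> c \<otimes> T \<ominus> g"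
      using M_closed[OF g] Tc cc by (simp add: ring_simprules)
    \<comment> \<open>\<open>glue\<close> only controls g T, so semicentrality is used to place a g
      in front of T.\<close>
    also have "g \<otimes> c \<otimes> T = g \<otimes> c \<otimes> (g \<otimes> T)"
      using M_semi[OF g cc] M_closed[OF g] Tc cc by (simp add: R.m_assoc[symmetric])
    also have "\<dots> = g \<otimes> c \<otimes> t g"
      unfolding gT[OF g] using M_semi[OF g cc] M_closed[OF g] t(1)[OF g] cc
      by (simp add: R.m_assoc[symmetric])
    finally show ?thesis using t(3)[OF g] M_closed[OF g] minus_eq_zero_iff by simp
  qed
  ultimately have "T \<otimes> c \<ominus> \<one> \<in> right_ann total" "c \<otimes> T \<ominus> \<one> \<in> right_ann total"
    using total_zero_iff Tc cc by auto
  then show "c \<in> units_modulo (right_ann total)"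
    unfolding units_modulo_def using Tc cc by blast
qed

text \<open>Any left denominator set lies in some \<open>order_den h\<close> with h in
  \<open>M\<close>. If it contains \<open>order_den g\<close>, comparison of the ideals and
  \<open>right_ann_inj\<close> force g = h.\<close>

lemma max_Den_l_order: "max_Den_l A = order_den ` M"
proof (intro equalityI subsetI)
  fix S assume "S \<in> max_Den_l A"
  then have S: "S \<in> Den_l A" and max: "\<And>S'. S' \<in> Den_l A \<Longrightarrow> S \<subseteq> S' \<Longrightarrow> S' = S"
    by (auto simp: max_Den_l_def)
  obtain f where f: "right_semicentral f" "f \<noteq> \<zero>" "S \<subseteq> order_den f"
    using Den_l_subset_order_den[OF art S] .
  obtain g where g: "g \<in> M" "right_ann f \<subseteq> right_ann g" using cover f by blast
  have "S \<subseteq> order_den g" using f(3) order_den_mono[OF g(2)] by blast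
  then have "order_den g = S" using max order_den_Den_l semicentral nonzero g(1) by blast
  then show "S \<in> order_den ` M" using g(1) by blast
next
  fix S assume "S \<in> order_den ` M"
  then obtain g where g: "g \<in> M" "S = order_den g" by blast
  have "S' = S" if S': "S' \<in> Den_l A" and sub: "S \<subseteq> S'" for S'
  proof -
    obtain f where f: "right_semicentral f" "f \<noteq> \<zero>" "S' \<subseteq> order_den f"
      using Den_l_subset_order_den[OF art S'] .
    obtain h where h: "h \<in> M" "right_ann f \<subseteq> right_ann h" using cover f by blast
    have "S' \<subseteq> order_den h" using f(3) order_den_mono[OF h(2)] by blast
    moreover from this have "g = h"
      using right_ann_inj right_ann_mono_of_order_den semicentral g h(1) sub by blast
    ultimately show ?thesis using sub g(2) by blast
  qed
  then show "S \<in> max_Den_l A"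
    unfolding max_Den_l_def using order_den_Den_l semicentral nonzero g by blast
qed

lemma order_den_bij: "bij_betw order_den M (max_Den_l A)"
proof -
  have "inj_on order_den M"
  proof (rule inj_onI)
    fix g h assume "g \<in> M" "h \<in> M" "order_den g = order_den h"
    then show "g = h" using right_ann_inj right_ann_mono_of_order_den semicentral by blast
  qed
  then show ?thesis by (simp add: bij_betw_def max_Den_l_order)
qed

lemma L_ls_order: "L_ls A = order_den total"
  unfolding L_ls_def max_Den_l_order order_den_def units_modulo_total using M_nonempty by auto

text \<open>The intersection of the maximal denominator sets is itself a left denominator set, so it
  is the largest member of the union that defines \<open>T_l\<close>.\<close>

lemma T_l_order: "T_l A = order_den total"
proof -
  have "order_den total \<in> Den_l A" using order_den_Den_l total_semicentral total_nonzero .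
  then show ?thesis unfolding T_l_def L_ls_order by blast
qed

lemma ls_rad_order: "ls_rad A = {a \<in> carrier A. total \<otimes> \<phi> a = \<zero>}"
  unfolding ls_rad_def T_l_order by (rule ass_order_den[OF total_semicentral])

lemma l_rad_order: "l_rad A = {a \<in> carrier A. total \<otimes> \<phi> a = \<zero>}"
proof -
  have "l_rad A = (\<Inter>g\<in>M. {a \<in> carrier A. g \<otimes> \<phi> a = \<zero>})"
    unfolding l_rad_def max_Den_l_order using ass_order_den semicentral by auto
  also have "\<dots> = {a \<in> carrier A. total \<otimes> \<phi> a = \<zero>}"
    using total_zero_iff M_nonempty by auto
  finally show ?thesis .
qed

text \<open>Factor the diagonal map into the product of quotients: \<open>total_zero_iff\<close>
  gives its kernel, \<open>glue\<close> its surjectivity.\<close>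

lemma quotient_total_iso:
  "R Quot right_ann total \<simeq> product_ring M (\<lambda>g. R Quot right_ann g)"
proof -
  let ?P = "product_ring M (\<lambda>g. R Quot right_ann g)"
  define H where "H x = (\<lambda>g\<in>M. right_ann g +> x)" for x
  have K: "ideal (right_ann g) R" if "g \<in> M" for g
    using right_semicentral_ideal semicentral that by blast
  have hom: "(+>) (right_ann g) \<in> ring_hom R (R Quot right_ann g)" if "g \<in> M" for g
    using ideal.rcos_ring_hom[OF K[OF that]] .
  have P: "ring ?P" by (rule ring_product_ring) (rule ideal.quotient_is_ring[OF K])
  have "H \<in> ring_hom R ?P"
    by (rule ring_hom_memI)
      (use ring_hom_memE[OF hom] in \<open>auto simp: H_def product_ring_def fun_eq_iff\<close>)
  then interpret H: ring_hom_ring R ?P H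
    using P by (intro ring_hom_ringI2 R.ring_axioms)
  have zero: "H x = \<zero>\<^bsub>?P\<^esub> \<longleftrightarrow> total \<otimes> x = \<zero>" if x: "x \<in> carrier R" for x
  proof -
    have "right_ann g +> x = \<zero>\<^bsub>R Quot right_ann g\<^esub> \<longleftrightarrow> g \<otimes> x = \<zero>" if g: "g \<in> M" for g
    proof -
      have "\<zero>\<^bsub>R Quot right_ann g\<^esub> = right_ann g +> \<zero>"
        using ring_hom_zero[OF hom[OF g] R.ring_axioms ideal.quotient_is_ring[OF K[OF g]]] by simp
      then have "right_ann g +> x = \<zero>\<^bsub>R Quot right_ann g\<^esub> \<longleftrightarrow> x \<ominus> \<zero> \<in> right_ann g"
        using quotient_eq_iff_same_a_r_cos[OF K[OF g] x zero_closed] by simp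
      then show ?thesis using x by (simp add: R.minus_eq)
    qed
    then have "H x = \<zero>\<^bsub>?P\<^esub> \<longleftrightarrow> (\<forall>g\<in>M. g \<otimes> x = \<zero>)"
      by (auto simp: H_def product_ring_def fun_eq_iff)
    then show ?thesis using total_zero_iff[OF x] by simp
  qed
  have ker: "a_kernel R ?P H = right_ann total"
    unfolding a_kernel_def' using zero by auto
  have "H ` carrier R = carrier ?P"
  proof (intro equalityI subsetI)
    fix X assume X: "X \<in> carrier ?P"
    have "\<exists>y\<in>carrier R. X g = right_ann g +> y" if "g \<in> M" for g
      using X that unfolding product_ring_def FactRing_simps by (auto simp: PiE_iff)
    then obtain y where y: "\<And>g. g \<in> M \<Longrightarrow> y g \<in> carrier R" "\<And>g. g \<in> M \<Longrightarrow> X g = right_ann g +> y g"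
      by metis
    define T where "T = (\<Oplus>g\<in>M. g \<otimes> y g)"
    have T: "T \<in> carrier R" unfolding T_def using glue(1) y(1) by blast
    have "right_ann g +> T = right_ann g +> y g" if g: "g \<in> M" for g
    proof -
      have "g \<otimes> (T \<ominus> y g) = g \<otimes> T \<ominus> g \<otimes> y g"
        using M_closed[OF g] T y(1)[OF g] by algebra
      moreover have "g \<otimes> T = g \<otimes> y g" unfolding T_def using glue(2) y(1) g by blast
      ultimately have "T \<ominus> y g \<in> right_ann g"
        using minus_eq_zero_iff M_closed[OF g] T y(1)[OF g] by simp
      then show ?thesis using quotient_eq_iff_same_a_r_cos[OF K[OF g] T y(1)[OF g]] by blast
    qed
    then have "H T = X"
      using X y(2) by (auto simp: H_def product_ring_def fun_eq_iff PiE_iff extensional_def)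
    then show "X \<in> H ` carrier R" using T by blast
  qed (auto simp: H.hom_closed)
  then show ?thesis using H.FactRing_iso ker by simp
qed

lemma quotient_localization_iso:
  "f \<in> M \<or> f = total \<Longrightarrow> R Quot right_ann f \<simeq> left_localization A (order_den f)"
proof -
  assume "f \<in> M \<or> f = total"
  then have "right_semicentral f" "f \<noteq> \<zero>"
    using semicentral nonzero total_semicentral total_nonzero by auto
  then obtain G where "G \<in> ring_iso (R Quot right_ann f) (left_localization A (order_den f))"
    by (rule localization_order_den)
  then show ?thesis by (auto simp: is_ring_iso_def)
qed

lemma product_localization_iso:
  "product_ring M (\<lambda>g. R Quot right_ann g) \<simeq>
    product_ring (max_Den_l A) (\<lambda>S. left_localization A S)"
  by (rule product_ring_iso[OF order_den_bij]) (simp add: quotient_localization_iso)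

end

section \<open>Idempotents lifted from the semisimple quotient\<close>

context ring
begin

text \<open>The radical is defined by maximal left ideals, so right multiplication needs an
  argument: for M maximal, N = {y. y r in M} is either maximal or all of \<open>R\<close>, and x
  lies in N in both cases.\<close>

lemma ideal_jacobson_radical: "ideal (jacobson_radical R) R"
proof (rule ideal_of_left_ideal)
  show "left_ideal (jacobson_radical R) R"
    by (rule left_idealI) (auto simp: jacobson_radical_def maximal_left_ideal_def dest: left_idealD)
next
  fix r x assume r: "r \<in> carrier R" and x: "x \<in> jacobson_radical R"
  then have xc: "x \<in> carrier R" by (simp add: jacobson_radical_def)
  have "x \<otimes> r \<in> M" if max: "maximal_left_ideal M R" for M
  proof -
    have M: "left_ideal M R"
      and M_max: "\<And>I. left_ideal I R \<Longrightarrow> M \<subseteq> I \<Longrightarrow> I \<noteq> M \<Longrightarrow> I = carrier R"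
      using max by (auto simp: maximal_left_ideal_def)
    define N where "N = {y \<in> carrier R. y \<otimes> r \<in> M}"
    have N: "left_ideal N R"
      unfolding N_def using left_idealD[OF M] r
      by (intro left_idealI) (auto simp: l_distr m_assoc)
    have "maximal_left_ideal N R" if "N \<noteq> carrier R"
      unfolding maximal_left_ideal_def
    proof (intro conjI allI impI N that)
      fix I assume I: "left_ideal I R \<and> N \<subseteq> I"
      show "I = N \<or> I = carrier R"
      proof (rule disjCI)
        assume "I \<noteq> carrier R"
        show "I = N"
        proof (rule ccontr)
          assume "I \<noteq> N"
          then obtain y where y: "y \<in> I" "y \<notin> N" using I by blast
          have yc: "y \<in> carrier R" using y(1) I left_idealD(1) by blast
          \<comment> \<open>This is M + R y r, strictly larger than M because y is not in N, hence
            all of \<open>R\<close>. Thus each z r is a y r modulo M, which places z - a y in N and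
            z in I.\<close>
          let ?L = "{z \<in> carrier R. \<exists>a\<in>carrier R. z \<ominus> a \<otimes> (y \<otimes> r) \<in> M}"
          have L: "left_ideal ?L R"
          proof (rule left_idealI)
            show "\<zero> \<in> ?L"
              using yc r left_idealD(2)[OF M] by (auto intro!: bexI[of _ \<zero>] simp: minus_eq)
          next
            fix z w assume "z \<in> ?L" "w \<in> ?L"
            then obtain a b where *: "z \<in> carrier R" "w \<in> carrier R" "a \<in> carrier R" "b \<in> carrier R"
              "z \<ominus> a \<otimes> (y \<otimes> r) \<in> M" "w \<ominus> b \<otimes> (y \<otimes> r) \<in> M" by blast
            have "z \<oplus> w \<ominus> (a \<oplus> b) \<otimes> (y \<otimes> r) = (z \<ominus> a \<otimes> (y \<otimes> r)) \<oplus> (w \<ominus> b \<otimes> (y \<otimes> r))"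
              using *(1-4) yc r by algebra
            also have "\<dots> \<in> M" using left_idealD(3)[OF M *(5,6)] .
            finally show "z \<oplus> w \<in> ?L" using *(1-4) by blast
          next
            fix c z assume c: "c \<in> carrier R" and "z \<in> ?L"
            then obtain a where *: "z \<in> carrier R" "a \<in> carrier R" "z \<ominus> a \<otimes> (y \<otimes> r) \<in> M" by blast
            have "c \<otimes> z \<ominus> (c \<otimes> a) \<otimes> (y \<otimes> r) = c \<otimes> (z \<ominus> a \<otimes> (y \<otimes> r))"
              using *(1,2) c yc r by algebra
            also have "\<dots> \<in> M" using left_idealD(4)[OF M c *(3)] .
            finally show "c \<otimes> z \<in> ?L" using *(1,2) c by blast
          qed blast
          have "z \<in> ?L" if "z \<in> M" for z
          proof -
            have "z \<in> carrier R" using that left_idealD(1)[OF M] by blast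
            then show ?thesis
              using that yc r by (auto intro!: bexI[of _ \<zero>] simp: minus_eq)
          qed
          then have "M \<subseteq> ?L" by blast
          moreover have "y \<otimes> r \<in> ?L"
            using yc r left_idealD(2)[OF M] by (auto intro!: bexI[of _ \<one>] simp: minus_eq r_neg)
          then have "?L \<noteq> M" using y(2) yc by (auto simp: N_def)
          ultimately have full: "?L = carrier R" using M_max[OF L] by blast
          have "z \<in> I" if z: "z \<in> carrier R" for z
          proof -
            have "z \<otimes> r \<in> ?L" unfolding full using z r by simp
            then obtain a where a: "a \<in> carrier R" "z \<otimes> r \<ominus> a \<otimes> (y \<otimes> r) \<in> M" by blast
            have "z \<otimes> r \<ominus> a \<otimes> (y \<otimes> r) = (z \<ominus> a \<otimes> y) \<otimes> r" using z a(1) yc r by algebra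
            then have "z \<ominus> a \<otimes> y \<in> N" using a z yc by (simp add: N_def)
            then have "(z \<ominus> a \<otimes> y) \<oplus> a \<otimes> y \<in> I"
              using I left_idealD(3,4) a(1) y(1) by blast
            moreover have "(z \<ominus> a \<otimes> y) \<oplus> a \<otimes> y = z"
              using z a(1) yc by (simp add: minus_eq a_assoc l_neg)
            ultimately show ?thesis by simp
          qed
          then show False using \<open>I \<noteq> carrier R\<close> I left_idealD(1) by blast
        qed
      qed
    qed
    then have "x \<in> N" using x xc by (auto simp: jacobson_radical_def)
    then show ?thesis by (simp add: N_def)
  qed
  then show "x \<otimes> r \<in> jacobson_radical R" using xc r by (simp add: jacobson_radical_def)
qed

lemma left_ideal_in_maximal:
  assumes "left_ideal L R" "\<one> \<notin> L"
  obtains M where "maximal_left_ideal M R" "L \<subseteq> M"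
proof -
  let ?F = "{I. left_ideal I R \<and> L \<subseteq> I \<and> \<one> \<notin> I}"
  have "\<exists>M\<in>?F. \<forall>X\<in>?F. M \<subseteq> X \<longrightarrow> X = M"
  proof (rule subset_Zorn_nonempty)
    show "?F \<noteq> {}" using assms by blast
    fix C assume C: "C \<noteq> {}" "subset.chain ?F C"
    then have CF: "left_ideal I R" "L \<subseteq> I" "\<one> \<notin> I" if "I \<in> C" for I
      using that by (auto simp: subset.chain_def)
    have "left_ideal (\<Union>C) R"
    proof (rule left_idealI)
      fix x y assume "x \<in> \<Union>C" "y \<in> \<Union>C"
      then obtain I J where IJ: "I \<in> C" "x \<in> I" "J \<in> C" "y \<in> J" by blast
      then have "I \<subseteq> J \<or> J \<subseteq> I" using C(2) unfolding subset.chain_def by blast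
      then show "x \<oplus> y \<in> \<Union>C"
        using IJ left_idealD(3)[OF CF(1)[OF IJ(1)], of x y] left_idealD(3)[OF CF(1)[OF IJ(3)], of x y] by blast
    next
      show "\<zero> \<in> \<Union>C" using C(1) left_idealD(2)[OF CF(1)] by blast
      show "\<Union>C \<subseteq> carrier R" using left_idealD(1)[OF CF(1)] by blast
      show "r \<otimes> x \<in> \<Union>C" if "r \<in> carrier R" "x \<in> \<Union>C" for r x
        using that left_idealD(4)[OF CF(1)] by blast
    qed
    then show "\<Union>C \<in> ?F" using C(1) CF by blast
  qed
  then obtain M where MF: "M \<in> ?F" and maxF: "\<forall>X\<in>?F. M \<subseteq> X \<longrightarrow> X = M" by (rule bexE)
  then have M: "left_ideal M R" "L \<subseteq> M" "\<one> \<notin> M" by auto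
  have max: "X = M" if "left_ideal X R" "L \<subseteq> X" "\<one> \<notin> X" "M \<subseteq> X" for X
    using maxF that by simp
  have full: "X = carrier R" if X: "left_ideal X R" "\<one> \<in> X" for X
  proof
    show "carrier R \<subseteq> X" using left_idealD(4)[OF X(1) _ X(2)] by force
  qed (rule left_idealD(1)[OF X(1)])
  have "maximal_left_ideal M R"
    unfolding maximal_left_ideal_def using M max full by blast
  then show ?thesis using that M(2) by blast
qed

text \<open>If n \<noteq> 0, the left annihilator of n is proper and contains 1 - n. A maximal left
  ideal above it contains both 1 - n and n, hence 1.\<close>

lemma jacobson_radical_idempotent:
  assumes n: "n \<in> jacobson_radical R" "n \<otimes> n = n"
  shows "n = \<zero>"
proof (rule ccontr)
  assume n0: "n \<noteq> \<zero>"
  have nc: "n \<in> carrier R" using n(1) by (simp add: jacobson_radical_def)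
  define L where "L = {x \<in> carrier R. x \<otimes> n = \<zero>}"
  have "left_ideal L R"
    unfolding L_def using nc by (intro left_idealI) (auto simp: l_distr m_assoc)
  moreover have "\<one> \<notin> L" using nc n0 by (simp add: L_def)
  ultimately obtain M where M: "maximal_left_ideal M R" "L \<subseteq> M" by (rule left_ideal_in_maximal)
  have LM: "left_ideal M R" using M(1) by (simp add: maximal_left_ideal_def)
  have "(\<one> \<ominus> n) \<otimes> n = \<zero>" using nc n(2) by (simp add: minus_eq l_distr l_minus r_neg)
  then have "\<one> \<ominus> n \<in> M" using M(2) nc by (auto simp: L_def)
  moreover have "n \<in> M" using n(1) M(1) by (simp add: jacobson_radical_def)
  ultimately have "(\<one> \<ominus> n) \<oplus> n \<in> M" using left_idealD(3)[OF LM] by blast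
  then have "\<one> \<in> M" using nc by (simp add: minus_eq a_assoc l_neg)
  then have "carrier R \<subseteq> M" using left_idealD(4)[OF LM _ \<open>\<one> \<in> M\<close>] by force
  then show False using M(1) left_idealD(1)[OF LM] by (auto simp: maximal_left_ideal_def)
qed

text \<open>The two-sided ideal (1 - g)R is zero or everything.\<close>

lemma simple_right_semicentral:
  assumes "simple_ring R" and g: "right_semicentral g"
  shows "g = \<zero> \<or> g = \<one>"
proof -
  have gc: "g \<in> carrier R" "g \<otimes> g = g" using g by (auto simp: right_semicentral_def)
  have "right_ann g = {\<zero>} \<or> right_ann g = carrier R"
    using assms(1) right_semicentral_ideal[OF g] by (simp add: simple_ring_def)
  then show ?thesis
  proof
    assume K: "right_ann g = {\<zero>}"
    have "\<one> \<ominus> g \<in> right_ann g" using gc by (simp add: minus_eq r_distr r_minus r_neg)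
    then have "\<one> \<ominus> g = \<zero>" unfolding K by simp
    then show ?thesis using minus_eq_zero_iff gc(1) by auto
  next
    assume "right_ann g = carrier R"
    then have "\<one> \<in> right_ann g" by simp
    then show ?thesis using gc(1) by simp
  qed
qed

text \<open>The second f is absorbed by the first: f (g x) f g = f (g x g) = f g x. For sums of the
  u i this handles intersections of index sets.\<close>

lemma right_semicentral_mult:
  assumes "right_semicentral f" "right_semicentral g"
  shows "right_semicentral (f \<otimes> g)"
proof -
  have c: "f \<in> carrier R" "g \<in> carrier R" "f \<otimes> f = f" "g \<otimes> g = g"
    and f: "\<And>x. x \<in> carrier R \<Longrightarrow> f \<otimes> x \<otimes> f = f \<otimes> x"
    and g: "\<And>x. x \<in> carrier R \<Longrightarrow> g \<otimes> x \<otimes> g = g \<otimes> x"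
    using assms by (auto simp: right_semicentral_def)
  have "f \<otimes> g \<otimes> x \<otimes> (f \<otimes> g) = f \<otimes> g \<otimes> x" if x: "x \<in> carrier R" for x
  proof -
    have "f \<otimes> g \<otimes> x \<otimes> (f \<otimes> g) = f \<otimes> (g \<otimes> x) \<otimes> f \<otimes> g" using c x by (simp add: m_assoc)
    also have "\<dots> = f \<otimes> (g \<otimes> x \<otimes> g)" using f[of "g \<otimes> x"] c x by (simp add: m_assoc)
    finally show ?thesis using g[OF x] c x by (simp add: m_assoc)
  qed
  moreover from this[of \<one>] have "f \<otimes> g \<otimes> (f \<otimes> g) = f \<otimes> g" using c by simp
  ultimately show ?thesis using c by (simp add: right_semicentral_def)
qed

end

text \<open>The quotient R/rad(R) enters through its coordinate maps \<open>\<chi> i\<close> onto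
  the simple factors. An element with all coordinates zero lies in the radical, so
  \<open>separate\<close> says that the radical has no nonzero idempotent.\<close>

locale lifted_idempotents = R?: ring R for R (structure) +
  fixes s :: nat and Rb :: "nat \<Rightarrow> 'c ring" and \<chi> :: "nat \<Rightarrow> 'a \<Rightarrow> 'c" and u :: "nat \<Rightarrow> 'a"
  assumes simple: "i \<in> {1..s} \<Longrightarrow> simple_ring (Rb i)"
    and chi: "i \<in> {1..s} \<Longrightarrow> \<chi> i \<in> ring_hom R (Rb i)"
    and chi_surj: "i \<in> {1..s} \<Longrightarrow> \<chi> i ` carrier R = carrier (Rb i)"
    and separate: "x \<in> carrier R \<Longrightarrow> x \<otimes> x = x \<Longrightarrow> (\<And>i. i \<in> {1..s} \<Longrightarrow> \<chi> i x = \<zero>\<^bsub>Rb i\<^esub>) \<Longrightarrow> x = \<zero>"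
    and orth_u: "orthogonal_idempotents R s u"
    and chi_u: "i \<in> {1..s} \<Longrightarrow> j \<in> {1..s} \<Longrightarrow> \<chi> i (u j) = (if i = j then \<one>\<^bsub>Rb i\<^esub> else \<zero>\<^bsub>Rb i\<^esub>)"
begin

section \<open>Sums of lifted idempotents over index sets\<close>

abbreviation E :: "nat set \<Rightarrow> 'a" where "E \<equiv> idem_sum R u"

lemma Rb_ring: "i \<in> {1..s} \<Longrightarrow> ring (Rb i)" and Rb_nontrivial: "i \<in> {1..s} \<Longrightarrow> \<one>\<^bsub>Rb i\<^esub> \<noteq> \<zero>\<^bsub>Rb i\<^esub>"
  using simple by (auto simp: simple_ring_def)

lemma chi_hom: "i \<in> {1..s} \<Longrightarrow> ring_hom_ring R (Rb i) (\<chi> i)"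
  using chi Rb_ring by (intro ring_hom_ringI2 R.ring_axioms)

lemma u_closed: "i \<in> {1..s} \<Longrightarrow> u i \<in> carrier R"
  and u_mult: "i \<in> {1..s} \<Longrightarrow> j \<in> {1..s} \<Longrightarrow> u i \<otimes> u j = (if i = j then u i else \<zero>)"
  using orth_u by (auto simp: orthogonal_idempotents_def)

lemma E_insert: "finite I \<Longrightarrow> i \<notin> I \<Longrightarrow> insert i I \<subseteq> {1..s} \<Longrightarrow> E (insert i I) = u i \<oplus> E I"
  unfolding idem_sum_def using u_closed by (intro finsum_insert) auto

lemma E_empty [simp]: "E {} = \<zero>" by (simp add: idem_sum_def)

lemma E_closed: "I \<subseteq> {1..s} \<Longrightarrow> E I \<in> carrier R"
  unfolding idem_sum_def using u_closed by (intro finsum_closed) auto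

lemma u_E: "j \<in> {1..s} \<Longrightarrow> I \<subseteq> {1..s} \<Longrightarrow> u j \<otimes> E I = (if j \<in> I then u j else \<zero>)"
proof -
  assume j: "j \<in> {1..s}" and I: "I \<subseteq> {1..s}"
  have "finite I" using I finite_subset by blast
  then show ?thesis using I
  proof (induction I)
    case empty then show ?case using u_closed[OF j] by simp
  next
    case (insert i I)
    then have i: "i \<in> {1..s}" "I \<subseteq> {1..s}" by auto
    show ?case
      unfolding E_insert[OF insert(1,2,4)]
      using insert.IH[OF i(2)] u_mult[OF j i(1)] u_closed[OF j] u_closed[OF i(1)] E_closed[OF i(2)] insert(2)
      by (auto simp: R.r_distr)
  qed
qed

lemma E_mult: "I \<subseteq> {1..s} \<Longrightarrow> J \<subseteq> {1..s} \<Longrightarrow> E I \<otimes> E J = E (I \<inter> J)"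
proof -
  assume I: "I \<subseteq> {1..s}" and J: "J \<subseteq> {1..s}"
  have "finite I" using I finite_subset by blast
  then show ?thesis using I
  proof (induction I)
    case empty then show ?case using E_closed[OF J] by simp
  next
    case (insert i I)
    then have i: "i \<in> {1..s}" "I \<subseteq> {1..s}" by auto
    have IJ: "I \<inter> J \<subseteq> {1..s}" using i by blast
    have "E (insert i I) \<otimes> E J = u i \<otimes> E J \<oplus> E (I \<inter> J)"
      unfolding E_insert[OF insert(1,2,4)] using insert.IH[OF i(2)] u_closed[OF i(1)] E_closed[OF i(2)] E_closed[OF J]
      by (simp add: R.l_distr)
    also have "\<dots> = E (insert i I \<inter> J)"
    proof (cases "i \<in> J")
      case True
      then have "insert i I \<inter> J = insert i (I \<inter> J)" by blast
      then show ?thesis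
        using E_insert[of "I \<inter> J" i] insert(1,2) i IJ u_E[OF i(1) J] True by simp
    next
      case False
      then have "insert i I \<inter> J = I \<inter> J" by blast
      then show ?thesis using u_E[OF i(1) J] False E_closed[OF IJ] by simp
    qed
    finally show ?case .
  qed
qed

lemma E_idem: "I \<subseteq> {1..s} \<Longrightarrow> E I \<otimes> E I = E I"
  using E_mult[of I I] by simp

lemma chi_E: "i \<in> {1..s} \<Longrightarrow> I \<subseteq> {1..s} \<Longrightarrow> \<chi> i (E I) = (if i \<in> I then \<one>\<^bsub>Rb i\<^esub> else \<zero>\<^bsub>Rb i\<^esub>)"
proof -
  assume i: "i \<in> {1..s}" and I: "I \<subseteq> {1..s}"
  interpret chi: ring_hom_ring R "Rb i" "\<chi> i" using chi_hom[OF i] .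
  have "finite I" using I finite_subset by blast
  then show ?thesis using I
  proof (induction I)
    case empty then show ?case by simp
  next
    case (insert j I)
    then have j: "j \<in> {1..s}" "I \<subseteq> {1..s}" by auto
    have add: "(if p then \<one>\<^bsub>Rb i\<^esub> else \<zero>\<^bsub>Rb i\<^esub>) \<oplus>\<^bsub>Rb i\<^esub> (if q then \<one>\<^bsub>Rb i\<^esub> else \<zero>\<^bsub>Rb i\<^esub>) =
        (if p \<or> q then \<one>\<^bsub>Rb i\<^esub> else \<zero>\<^bsub>Rb i\<^esub>)" if "\<not> (p \<and> q)" for p q
      using that by auto
    have "\<chi> i (E (insert j I)) = \<chi> i (u j) \<oplus>\<^bsub>Rb i\<^esub> \<chi> i (E I)"
      unfolding E_insert[OF insert(1,2,4)] using u_closed[OF j(1)] E_closed[OF j(2)] by simp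
    also have "\<dots> = (if i = j \<or> i \<in> I then \<one>\<^bsub>Rb i\<^esub> else \<zero>\<^bsub>Rb i\<^esub>)"
      unfolding chi_u[OF i j(1)] insert.IH[OF j(2)] using insert(2) by (intro add) blast
    finally show ?case by simp
  qed
qed

text \<open>The coordinates of \<open>E I\<close> are 1 on I and 0 elsewhere, and 1 \<noteq> 0 in
  each simple factor.\<close>

lemma E_inj: "I \<subseteq> {1..s} \<Longrightarrow> J \<subseteq> {1..s} \<Longrightarrow> E I = E J \<Longrightarrow> I = J"
proof -
  assume I: "I \<subseteq> {1..s}" and J: "J \<subseteq> {1..s}" and eq: "E I = E J"
  have "i \<in> I \<longleftrightarrow> i \<in> J" if "i \<in> {1..s}" for i
    using chi_E[OF that I] chi_E[OF that J] eq Rb_nontrivial[OF that] by (auto split: if_splits)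
  then show "I = J" using I J by blast
qed

lemma I'_l_iff: "g \<in> I'_l R s u \<longleftrightarrow> (\<exists>I. I \<noteq> {} \<and> I \<subseteq> {1..s} \<and> g = E I \<and> right_semicentral (E I))"
  unfolding I'_l_def using right_semicentral_iff[OF E_closed E_idem] by blast

text \<open>\<open>idem_le\<close> asks for some index sets representing the two idempotents; by
  \<open>E_inj\<close> these can only be the given ones.\<close>

lemma idem_le_iff:
  assumes "I \<noteq> {}" "I \<subseteq> {1..s}" "J \<subseteq> {1..s}"
  shows "idem_le R s u (E I) (E J) \<longleftrightarrow> I \<subseteq> J"
proof
  assume "idem_le R s u (E I) (E J)"
  then obtain I' J' where *: "I' \<subseteq> J'" "J' \<subseteq> {1..s}" "E I = E I'" "E J = E J'"
    unfolding idem_le_def by blast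
  then have "I = I'" "J = J'" using E_inj assms by blast+
  then show "I \<subseteq> J" using *(1) by simp
next
  assume "I \<subseteq> J"
  then show "idem_le R s u (E I) (E J)" unfolding idem_le_def using assms by blast
qed

lemma min_I'_l_iff:
  "g \<in> min_I'_l R s u \<longleftrightarrow> (\<exists>I. I \<noteq> {} \<and> I \<subseteq> {1..s} \<and> g = E I \<and> right_semicentral (E I) \<and>
    (\<forall>J. J \<noteq> {} \<longrightarrow> J \<subseteq> I \<longrightarrow> right_semicentral (E J) \<longrightarrow> J = I))"
proof
  assume g: "g \<in> min_I'_l R s u"
  then obtain I where I: "I \<noteq> {}" "I \<subseteq> {1..s}" "g = E I" "right_semicentral (E I)"
    using I'_l_iff by (auto simp: min_I'_l_def)
  have "J = I" if J: "J \<noteq> {}" "J \<subseteq> I" "right_semicentral (E J)" for J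
  proof -
    have Js: "J \<subseteq> {1..s}" using J(2) I(2) by blast
    have "E J = E I"
      using g I'_l_iff[of "E J"] J Js idem_le_iff[OF J(1) Js I(2)] I(3) by (auto simp: min_I'_l_def)
    then show ?thesis using E_inj Js I(2) by blast
  qed
  then show "\<exists>I. I \<noteq> {} \<and> I \<subseteq> {1..s} \<and> g = E I \<and> right_semicentral (E I) \<and>
    (\<forall>J. J \<noteq> {} \<longrightarrow> J \<subseteq> I \<longrightarrow> right_semicentral (E J) \<longrightarrow> J = I)" using I by blast
next
  assume "\<exists>I. I \<noteq> {} \<and> I \<subseteq> {1..s} \<and> g = E I \<and> right_semicentral (E I) \<and>
    (\<forall>J. J \<noteq> {} \<longrightarrow> J \<subseteq> I \<longrightarrow> right_semicentral (E J) \<longrightarrow> J = I)"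
  then obtain I where I: "I \<noteq> {}" "I \<subseteq> {1..s}" "g = E I" "right_semicentral (E I)"
    and min: "\<And>J. J \<noteq> {} \<Longrightarrow> J \<subseteq> I \<Longrightarrow> right_semicentral (E J) \<Longrightarrow> J = I" by blast
  have "f = g" if f: "f \<in> I'_l R s u" and le: "idem_le R s u f g" for f
  proof -
    obtain J where J: "J \<noteq> {}" "J \<subseteq> {1..s}" "f = E J" "right_semicentral (E J)"
      using f I'_l_iff by blast
    then have "J \<subseteq> I" using le idem_le_iff[OF J(1,2) I(2)] I(3) by blast
    then show ?thesis using min J I(3) by blast
  qed
  then show "g \<in> min_I'_l R s u"
    unfolding min_I'_l_def using I'_l_iff I by blast
qed

lemma finite_min_I'_l: "finite (min_I'_l R s u)"
proof (rule finite_subset)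
  show "min_I'_l R s u \<subseteq> E ` Pow {1..s}" unfolding min_I'_l_iff subset_iff by blast
qed simp

text \<open>Each coordinate of f is right semicentral in a simple ring, hence 0 or 1; I collects the
  ones. Then E I (1 - f) and f (1 - E I) are idempotents with zero coordinates, so they vanish. This
  yields E I f = E I and f E I = f, which suffices for equal right annihilators.\<close>

lemma right_semicentral_E_cases:
  assumes f: "right_semicentral f" and f0: "f \<noteq> \<zero>"
  obtains I where "I \<noteq> {}" "I \<subseteq> {1..s}" "right_semicentral (E I)" "right_ann f = right_ann (E I)"
proof -
  have fc: "f \<in> carrier R" "f \<otimes> f = f" and fs: "\<And>x. x \<in> carrier R \<Longrightarrow> f \<otimes> x \<otimes> f = f \<otimes> x"
    using f by (auto simp: right_semicentral_def)
  have chi_f: "\<chi> i f = \<zero>\<^bsub>Rb i\<^esub> \<or> \<chi> i f = \<one>\<^bsub>Rb i\<^esub>" if i: "i \<in> {1..s}" for i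
  proof -
    interpret chi: ring_hom_ring R "Rb i" "\<chi> i" using chi_hom[OF i] .
    have "chi.S.right_semicentral (\<chi> i f)"
      unfolding chi.S.right_semicentral_def
    proof (intro conjI ballI)
      show "\<chi> i f \<otimes>\<^bsub>Rb i\<^esub> \<chi> i f = \<chi> i f" using fc chi.hom_mult[of f f] by simp
      fix y assume "y \<in> carrier (Rb i)"
      then obtain x where x: "x \<in> carrier R" "y = \<chi> i x" using chi_surj[OF i] by blast
      show "\<chi> i f \<otimes>\<^bsub>Rb i\<^esub> y \<otimes>\<^bsub>Rb i\<^esub> \<chi> i f = \<chi> i f \<otimes>\<^bsub>Rb i\<^esub> y"
        unfolding x(2) using fs[OF x(1)] fc(1) x(1) by (metis R.m_closed chi.hom_mult)
    qed (use fc in simp)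
    then show ?thesis using chi.S.simple_right_semicentral simple[OF i] by blast
  qed
  define I where "I = {i \<in> {1..s}. \<chi> i f = \<one>\<^bsub>Rb i\<^esub>}"
  have I: "I \<subseteq> {1..s}" by (auto simp: I_def)
  note Ec = E_closed[OF I] and Ei = E_idem[OF I]
  have K: "ideal (right_ann f) R" using right_semicentral_ideal[OF f] .
  have f1: "\<one> \<ominus> f \<in> right_ann f" using fc by (simp add: minus_eq r_distr r_minus r_neg)
  have chi_fE: "\<chi> i f = \<chi> i (E I)" if i: "i \<in> {1..s}" for i
    using chi_f[OF i] chi_E[OF i I] i by (auto simp: I_def)
  have chi_idem: "\<chi> i f \<otimes>\<^bsub>Rb i\<^esub> (\<one>\<^bsub>Rb i\<^esub> \<ominus>\<^bsub>Rb i\<^esub> \<chi> i f) = \<zero>\<^bsub>Rb i\<^esub>" if i: "i \<in> {1..s}" for i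
  proof -
    interpret Rbi: ring "Rb i" using Rb_ring[OF i] .
    show ?thesis using chi_f[OF i] by (auto simp: Rbi.minus_eq Rbi.r_neg)
  qed
  have "E I \<otimes> (\<one> \<ominus> f) = \<zero>"
  proof (rule separate)
    have n: "E I \<otimes> (\<one> \<ominus> f) \<in> right_ann f" using ideal.I_l_closed[OF K f1 Ec] .
    \<comment> \<open>The element n = E I (1 - f) lies in the two-sided ideal
      \<open>right_ann f\<close>, so f n = 0 and n n = E I n = n.\<close>
    have "E I \<otimes> (\<one> \<ominus> f) \<otimes> (E I \<otimes> (\<one> \<ominus> f)) = E I \<otimes> (E I \<otimes> (\<one> \<ominus> f)) \<ominus> E I \<otimes> (f \<otimes> (E I \<otimes> (\<one> \<ominus> f)))"
      using Ec fc(1) by (simp add: ring_simprules)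
    also have "\<dots> = E I \<otimes> E I \<otimes> (\<one> \<ominus> f)" using n Ec fc(1) by (simp add: m_assoc minus_eq)
    finally show "E I \<otimes> (\<one> \<ominus> f) \<otimes> (E I \<otimes> (\<one> \<ominus> f)) = E I \<otimes> (\<one> \<ominus> f)" using Ei by simp
    fix i assume i: "i \<in> {1..s}"
    interpret chi: ring_hom_ring R "Rb i" "\<chi> i" using chi_hom[OF i] .
    show "\<chi> i (E I \<otimes> (\<one> \<ominus> f)) = \<zero>\<^bsub>Rb i\<^esub>"
      using chi_idem[OF i] chi_fE[OF i] Ec fc(1) by (simp add: minus_eq chi.S.minus_eq)
  qed (use Ec fc in simp)
  then have Ef: "E I \<otimes> f = E I"
    using minus_eq_zero_iff[of "E I" "E I \<otimes> f"] Ec fc(1) by (simp add: minus_eq r_distr r_minus)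
  have "f \<otimes> (\<one> \<ominus> E I) = \<zero>"
  proof (rule separate)
    have "f \<otimes> (\<one> \<ominus> E I) \<otimes> (f \<otimes> (\<one> \<ominus> E I)) = f \<otimes> (\<one> \<ominus> E I) \<otimes> f \<otimes> (\<one> \<ominus> E I)"
      using Ec fc(1) by (simp add: m_assoc)
    also have "\<dots> = f \<otimes> ((\<one> \<ominus> E I) \<otimes> (\<one> \<ominus> E I))"
      using fs[of "\<one> \<ominus> E I"] Ec fc(1) by (simp add: m_assoc)
    also have "(\<one> \<ominus> E I) \<otimes> (\<one> \<ominus> E I) = \<one> \<ominus> E I"
      using Ei Ec by (simp add: minus_eq l_distr r_distr l_minus r_minus r_neg)
    finally show "f \<otimes> (\<one> \<ominus> E I) \<otimes> (f \<otimes> (\<one> \<ominus> E I)) = f \<otimes> (\<one> \<ominus> E I)" .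
    fix i assume i: "i \<in> {1..s}"
    interpret chi: ring_hom_ring R "Rb i" "\<chi> i" using chi_hom[OF i] .
    show "\<chi> i (f \<otimes> (\<one> \<ominus> E I)) = \<zero>\<^bsub>Rb i\<^esub>"
      using chi_idem[OF i] chi_fE[OF i] Ec fc(1) by (simp add: minus_eq chi.S.minus_eq)
  qed (use Ec fc in simp)
  then have fE: "f \<otimes> E I = f"
    using minus_eq_zero_iff[of f "f \<otimes> E I"] Ec fc(1) by (simp add: minus_eq r_distr r_minus)
  have ann: "right_ann f = right_ann (E I)"
  proof (intro equalityI subsetI)
    fix x assume "x \<in> right_ann f"
    then have "E I \<otimes> f \<otimes> x = \<zero>" using Ec fc(1) by (simp add: m_assoc)
    then show "x \<in> right_ann (E I)" using \<open>x \<in> right_ann f\<close> Ef by simp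
  next
    fix x assume "x \<in> right_ann (E I)"
    then have "f \<otimes> E I \<otimes> x = \<zero>" using Ec fc(1) by (simp add: m_assoc)
    then show "x \<in> right_ann f" using \<open>x \<in> right_ann (E I)\<close> fE by simp
  qed
  \<comment> \<open>The right annihilator of \<open>E I\<close> is the two-sided ideal
    \<open>right_ann f\<close>, so it contains x (1 - E I) along with 1 - E I.\<close>
  have "E I \<otimes> x \<otimes> (\<one> \<ominus> E I) = \<zero>" if x: "x \<in> carrier R" for x
  proof -
    have "\<one> \<ominus> E I \<in> right_ann (E I)" using Ec Ei by (simp add: minus_eq r_distr r_minus r_neg)
    then have "x \<otimes> (\<one> \<ominus> E I) \<in> right_ann (E I)"
      using ideal.I_l_closed[OF K] x unfolding ann by blast
    then show ?thesis using Ec x by (simp add: m_assoc)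
  qed
  then have "right_semicentral (E I)" using right_semicentral_iff[OF Ec Ei] by blast
  moreover have "I \<noteq> {}" using fE f0 fc(1) by auto
  ultimately show ?thesis using that I ann by blast
qed

text \<open>Shrinking the index set enlarges the right annihilator, since E J E I = E J for J inside
  I; a minimal J inside I does the job.\<close>

lemma min_I'_l_cover:
  assumes "right_semicentral f" "f \<noteq> \<zero>"
  shows "\<exists>g\<in>min_I'_l R s u. right_ann f \<subseteq> right_ann g"
proof -
  obtain I where I: "I \<noteq> {}" "I \<subseteq> {1..s}" "right_semicentral (E I)" "right_ann f = right_ann (E I)"
    using right_semicentral_E_cases[OF assms] .
  let ?F = "{J. J \<noteq> {} \<and> J \<subseteq> I \<and> right_semicentral (E J)}"
  have "finite ?F" using finite_subset[OF I(2)] by simp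
  moreover have "I \<in> ?F" using I by blast
  ultimately have "\<exists>J\<in>?F. J \<subseteq> I \<and> (\<forall>J'\<in>?F. J' \<subseteq> J \<longrightarrow> J = J')"
    by (rule finite_has_minimal2)
  then obtain J where J: "J \<in> ?F" and min: "\<forall>J'\<in>?F. J' \<subseteq> J \<longrightarrow> J = J'" by (elim bexE conjE)
  have Js: "J \<subseteq> {1..s}" using J I(2) by blast
  have "E J \<in> min_I'_l R s u"
    unfolding min_I'_l_iff
  proof (intro exI[of _ J] conjI allI impI)
    show "K = J" if "K \<noteq> {}" "K \<subseteq> J" "right_semicentral (E K)" for K
      using bspec[OF min, of K] that J by auto
  qed (use J Js in auto)
  moreover have "right_ann (E I) \<subseteq> right_ann (E J)"
  proof
    fix x assume x: "x \<in> right_ann (E I)"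
    have "E J \<otimes> E I = E J" using E_mult[OF Js I(2)] J by (simp add: Int_absorb2)
    moreover have "E J \<otimes> (E I \<otimes> x) = E J \<otimes> E I \<otimes> x"
      using E_closed[OF Js] E_closed[OF I(2)] x by (simp add: m_assoc)
    ultimately have "E J \<otimes> x = E J \<otimes> (E I \<otimes> x)" by simp
    then show "x \<in> right_ann (E J)" using x E_closed[OF Js] by simp
  qed
  ultimately show ?thesis using I(4) by blast
qed

text \<open>The product of E I and E J is E (I \<inter> J), again right semicentral. A nonempty
  intersection would equal both I and J by minimality.\<close>

lemma min_I'_l_orthogonal:
  assumes "g \<in> min_I'_l R s u" "h \<in> min_I'_l R s u" "g \<noteq> h"
  shows "g \<otimes> h = \<zero>"
proof -
  obtain I where I: "I \<subseteq> {1..s}" "g = E I" "right_semicentral (E I)"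
    and min1: "\<And>J. J \<noteq> {} \<Longrightarrow> J \<subseteq> I \<Longrightarrow> right_semicentral (E J) \<Longrightarrow> J = I"
    using assms(1) min_I'_l_iff by blast
  obtain J where J: "J \<subseteq> {1..s}" "h = E J" "right_semicentral (E J)"
    and min2: "\<And>K. K \<noteq> {} \<Longrightarrow> K \<subseteq> J \<Longrightarrow> right_semicentral (E K) \<Longrightarrow> K = J"
    using assms(2) min_I'_l_iff by blast
  have "right_semicentral (E (I \<inter> J))"
    using right_semicentral_mult[OF I(3) J(3)] E_mult[OF I(1) J(1)] by simp
  then have "I \<inter> J = {}"
    using min1[of "I \<inter> J"] min2[of "I \<inter> J"] assms(3) I(2) J(2) by (metis Int_lower1 Int_lower2)
  then show ?thesis using E_mult[OF I(1) J(1)] I(2) J(2) by simp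
qed

lemma min_I'_l_semicentral: "g \<in> min_I'_l R s u \<Longrightarrow> right_semicentral g"
  unfolding min_I'_l_iff by blast

lemma min_I'_l_nonzero: "g \<in> min_I'_l R s u \<Longrightarrow> g \<noteq> \<zero>"
  unfolding min_I'_l_iff using E_inj[of _ "{}"] by auto

end

text \<open>The coordinate maps are the components of R \<rightarrow> R/rad(R) followed by
  \<open>h\<close>; \<open>separate\<close> comes from injectivity of \<open>h\<close> and
  \<open>jacobson_radical_idempotent\<close>.\<close>

lemma lifted_idempotentsI:
  assumes "ring R" and wed: "wedderburn_decomposition R s Rb h"
    and "orthogonal_idempotents R s u" and lift: "lifts_identities R s Rb h u"
  shows "lifted_idempotents R s Rb (\<lambda>i r. h (jacobson_radical R +>\<^bsub>R\<^esub> r) i) u"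
proof -
  interpret ring R by fact
  let ?J = "jacobson_radical R"
  let ?P = "product_ring {1..s} Rb"
  let ?chi = "\<lambda>i r. h (?J +>\<^bsub>R\<^esub> r) i"
  interpret J: ideal ?J R by (rule ideal_jacobson_radical)
  have simple: "simple_ring (Rb i)" if "i \<in> {1..s}" for i
    using wed that by (simp add: wedderburn_decomposition_def)
  have h: "h \<in> ring_iso (R Quot ?J) ?P"
    using wed by (simp add: wedderburn_decomposition_def)
  have "h \<in> ring_hom (R Quot ?J) ?P" using h by (simp add: ring_iso_def)
  then have H: "h \<circ> (+>\<^bsub>R\<^esub>) ?J \<in> ring_hom R ?P"
    using ring_hom_trans[OF J.rcos_ring_hom] by blast
  have P: "ring ?P" using simple by (intro ring_product_ring) (simp add: simple_ring_def)
  interpret H: ring_hom_ring R ?P "h \<circ> (+>\<^bsub>R\<^esub>) ?J"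
    using H P by (intro ring_hom_ringI2 ring_axioms)
  have inj: "inj_on h (carrier (R Quot ?J))" and surj: "h ` carrier (R Quot ?J) = carrier ?P"
    using ring_iso_memE(5)[OF h] by (auto simp: bij_betw_def)
  have carr: "carrier (R Quot ?J) = (\<lambda>r. ?J +>\<^bsub>R\<^esub> r) ` carrier R"
    unfolding FactRing_simps by auto
  show ?thesis
  proof (unfold_locales)
    show "?chi i \<in> ring_hom R (Rb i)" if i: "i \<in> {1..s}" for i
    proof (rule ring_hom_memI)
      show "?chi i x \<in> carrier (Rb i)" if "x \<in> carrier R" for x
        using H.hom_closed[OF that] i by (auto simp: product_ring_def)
      show "?chi i (x \<otimes>\<^bsub>R\<^esub> y) = ?chi i x \<otimes>\<^bsub>Rb i\<^esub> ?chi i y" if "x \<in> carrier R" "y \<in> carrier R" for x y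
        using H.hom_mult[OF that] i by (simp add: product_ring_def)
      show "?chi i (x \<oplus>\<^bsub>R\<^esub> y) = ?chi i x \<oplus>\<^bsub>Rb i\<^esub> ?chi i y" if "x \<in> carrier R" "y \<in> carrier R" for x y
        using H.hom_add[OF that] i by (simp add: product_ring_def)
      show "?chi i \<one>\<^bsub>R\<^esub> = \<one>\<^bsub>Rb i\<^esub>"
        using H.hom_one i by (simp add: product_ring_def)
    qed
    then show "?chi i ` carrier R = carrier (Rb i)" if i: "i \<in> {1..s}" for i
    proof (intro equalityI subsetI)
      fix b assume b: "b \<in> carrier (Rb i)"
      let ?X = "\<lambda>j\<in>{1..s}. if j = i then b else \<zero>\<^bsub>Rb j\<^esub>"
      have "\<zero>\<^bsub>Rb j\<^esub> \<in> carrier (Rb j)" if "j \<in> {1..s}" for j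
        using simple[OF that] ring.ring_simprules(2) by (auto simp: simple_ring_def)
      then have "?X \<in> carrier ?P" using b by (auto simp: product_ring_def)
      then have "?X \<in> h ` (\<lambda>r. ?J +>\<^bsub>R\<^esub> r) ` carrier R" unfolding carr[symmetric] surj .
      then obtain r where r: "r \<in> carrier R" "?X = h (?J +>\<^bsub>R\<^esub> r)" by (elim imageE) simp
      have "?chi i r = b" unfolding r(2)[symmetric] using i by simp
      then show "b \<in> ?chi i ` carrier R" using r(1) by blast
    qed (use i in \<open>auto dest: ring_hom_closed\<close>)
    show "x = \<zero>\<^bsub>R\<^esub>" if x: "x \<in> carrier R" "x \<otimes>\<^bsub>R\<^esub> x = x"
      and 0: "\<And>i. i \<in> {1..s} \<Longrightarrow> ?chi i x = \<zero>\<^bsub>Rb i\<^esub>" for x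
    proof -
      have "h (?J +>\<^bsub>R\<^esub> x) = \<zero>\<^bsub>?P\<^esub>"
        using 0 H.hom_closed[OF x(1)] by (auto simp: product_ring_def fun_eq_iff PiE_iff extensional_def)
      then have "h (?J +>\<^bsub>R\<^esub> x) = h (?J +>\<^bsub>R\<^esub> \<zero>\<^bsub>R\<^esub>)" using H.hom_zero by simp
      then have "?J +>\<^bsub>R\<^esub> x = ?J +>\<^bsub>R\<^esub> \<zero>\<^bsub>R\<^esub>"
        using inj x(1) unfolding carr by (auto dest: inj_onD)
      then have "x \<ominus>\<^bsub>R\<^esub> \<zero>\<^bsub>R\<^esub> \<in> ?J"
        using quotient_eq_iff_same_a_r_cos[OF ideal_jacobson_radical x(1) zero_closed] by simp
      then show ?thesis using jacobson_radical_idempotent x by (simp add: minus_eq)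
    qed
    show "?chi i (u j) = (if i = j then \<one>\<^bsub>Rb i\<^esub> else \<zero>\<^bsub>Rb i\<^esub>)" if "i \<in> {1..s}" "j \<in> {1..s}" for i j
      using lift that by (simp add: lifts_identities_def)
  qed (use simple assms(3) in auto)
qed

theorem theorem5p7:
  fixes A :: "('a, 'm) ring_scheme"
    and R :: "('a \<times> 'a) set ring"
    and s :: nat
    and Rb :: "nat \<Rightarrow> 'b ring"
    and h :: "('a \<times> 'a) set set \<Rightarrow> nat \<Rightarrow> 'b"
    and u :: "nat \<Rightarrow> ('a \<times> 'a) set"
    and e :: "('a \<times> 'a) set"
    and \<iota> :: "'a \<Rightarrow> ('a \<times> 'a) set"
  assumes "ring A" and "\<one>\<^bsub>A\<^esub> \<noteq> \<zero>\<^bsub>A\<^esub>"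
    and "left_Ore_set A (regular_elements A)"
    and R_def: "R = Q_lcl A"
    and "left_artinian R"
    and \<iota>_def: "\<iota> = loc_map A (regular_elements A)"
    and "wedderburn_decomposition R s Rb h"
    and "orthogonal_idempotents R s u"
    and "(\<Oplus>\<^bsub>R\<^esub>i\<in>{1..s}. u i) = \<one>\<^bsub>R\<^esub>"
    and "lifts_identities R s Rb h u"
    and e_def: "e = (\<Oplus>\<^bsub>R\<^esub>e'\<in>min_I'_l R s u. e')"
  shows
    "T_l A = (\<Inter>S'\<in>max_Den_l A. S') \<and>

     (\<iota> ` ls_rad A = \<iota> ` carrier A \<inter> ls_rad R \<and>
      \<iota> ` carrier A \<inter> ls_rad R = \<iota> ` carrier A \<inter> l_rad R \<and>
      \<iota> ` carrier A \<inter> l_rad R = \<iota> ` carrier A \<inter> idem_compl_ideal R e) \<and>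

     (Q_ls A \<simeq> Q_ls R \<and>
      (\<lambda>X. the_elem (loc_map R (T_l R) ` X)) \<in> ring_iso (R Quot ls_rad R) (Q_ls R) \<and>
      R Quot ls_rad R \<simeq> R Quot idem_compl_ideal R e \<and>
      R Quot idem_compl_ideal R e \<simeq>
        product_ring (min_I'_l R s u) (\<lambda>e'. R Quot idem_compl_ideal R e') \<and>
      product_ring (min_I'_l R s u) (\<lambda>e'. R Quot idem_compl_ideal R e') \<simeq>
        product_ring (max_Den_l R) (\<lambda>S. left_localization R S) \<and>
      product_ring (max_Den_l R) (\<lambda>S. left_localization R S) \<simeq>
        product_ring (max_Den_l A) (\<lambda>S'. left_localization A S'))"
proof -
  interpret A: ring A by fact
  interpret R: ring R using \<open>left_artinian R\<close> by (simp add: left_artinian_def)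
  interpret LI: lifted_idempotents R s Rb "\<lambda>i r. h (jacobson_radical R +>\<^bsub>R\<^esub> r) i" u
    using lifted_idempotentsI R.ring_axioms assms(7,8,10) by blast
  define M where "M = min_I'_l R s u"
  interpret AR: left_order R A \<iota>
    using left_order_Q_lcl[OF assms(1,2,3)] R.ring_axioms unfolding R_def \<iota>_def by blast
  interpret RR: left_order R R id
    using R.left_order_self AR.nontrivial by blast
  \<comment> \<open>The same set \<open>M\<close> serves for \<open>A\<close> in \<open>R\<close>
    and for \<open>R\<close> in itself. Both totals are therefore the one element \<open>e\<close>,
    which links the two rings.\<close>
  interpret OA: orthogonal_semicentral R A \<iota> M
    by unfold_locales (use \<open>left_artinian R\<close> LI.finite_min_I'_l LI.min_I'_l_semicentral LI.min_I'_l_nonzero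
        LI.min_I'_l_orthogonal LI.min_I'_l_cover in \<open>auto simp: M_def\<close>)
  interpret OR: orthogonal_semicentral R R id M
    by unfold_locales (use \<open>left_artinian R\<close> LI.finite_min_I'_l LI.min_I'_l_semicentral LI.min_I'_l_nonzero
        LI.min_I'_l_orthogonal LI.min_I'_l_cover in \<open>auto simp: M_def\<close>)
  have e: "OA.total = e" "OR.total = e"
    unfolding OA.total_def OR.total_def unfolding e_def M_def by (rule refl)+
  have compl: "idem_compl_ideal R g = R.right_ann g" if "R.right_semicentral g" for g
    using that R.idem_compl_ideal_eq by (simp add: R.right_semicentral_def)
  have e_semi: "R.right_semicentral e" and e0: "e \<noteq> \<zero>\<^bsub>R\<^esub>"
    using OA.total_semicentral OA.total_nonzero e by auto
  have Ke: "idem_compl_ideal R e = R.right_ann e" using compl e_semi .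
  have lsR: "ls_rad R = R.right_ann e" using OR.ls_rad_order e by simp
  have lR: "l_rad R = R.right_ann e" using OR.l_rad_order e by simp
  have lsA: "ls_rad A = {a \<in> carrier A. e \<otimes>\<^bsub>R\<^esub> \<iota> a = \<zero>\<^bsub>R\<^esub>}" using OA.ls_rad_order e by simp
  have TA: "T_l A = AR.order_den e" and TR: "T_l R = RR.order_den e"
    using OA.T_l_order OR.T_l_order e by auto
  have ringQ: "ring (R Quot R.right_ann e)"
    using ideal.quotient_is_ring[OF R.right_semicentral_ideal[OF e_semi]] .

  have 1: "T_l A = (\<Inter>S'\<in>max_Den_l A. S')"
    using OA.T_l_order OA.L_ls_order by (simp add: L_ls_def)
  have 2: "\<iota> ` ls_rad A = \<iota> ` carrier A \<inter> R.right_ann e"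
    unfolding lsA by auto
  have QA: "R Quot R.right_ann e \<simeq> Q_ls A"
    using OA.quotient_localization_iso[of e] e TA by (simp add: Q_ls_def)
  have QR: "R Quot R.right_ann e \<simeq> Q_ls R"
    using OR.quotient_localization_iso[of e] e TR by (simp add: Q_ls_def)
  \<comment> \<open>Reversing an isomorphism requires its source to be a ring, so the comparison
    goes through the quotient of \<open>R\<close>.\<close>
  have 3: "Q_ls A \<simeq> Q_ls R"
    using ring_iso_trans[OF ring_iso_sym[OF ringQ QA] QR] .
  have 4: "(\<lambda>X. the_elem (loc_map R (T_l R) ` X)) \<in> ring_iso (R Quot ls_rad R) (Q_ls R)"
  proof -
    define N where "N = R.right_ann e"
    interpret N: ideal N R unfolding N_def by (rule R.right_semicentral_ideal[OF e_semi])
    obtain G where G: "G \<in> ring_iso (R Quot N) (left_localization R (RR.order_den e))"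
      and Gl: "\<forall>a\<in>carrier R. G (N +>\<^bsub>R\<^esub> id a) = loc_map R (RR.order_den e) a"
      by (rule RR.localization_order_den[OF e_semi e0, folded N_def])
    have Q: "left_localization R (RR.order_den e) = Q_ls R" by (simp add: Q_ls_def TR)
    \<comment> \<open>The localization map is constant on each coset of (1 - e)R, with value
      \<open>G X\<close>; so the induced canonical map agrees with the isomorphism \<open>G\<close>
      on the quotient.\<close>
    have "the_elem (loc_map R (T_l R) ` X) = G X" if X: "X \<in> carrier (R Quot N)" for X
    proof -
      obtain x where x: "x \<in> carrier R" "X = N +>\<^bsub>R\<^esub> x" using X unfolding FactRing_simps by auto
      have "loc_map R (T_l R) y = G X" if y: "y \<in> X" for y
      proof -
        have yc: "y \<in> carrier R" using y x N.a_Hcarr by (auto simp: a_r_coset_def r_coset_def)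
        have "N +>\<^bsub>R\<^esub> y = X" using y x N.a_repr_independence' by metis
        then show ?thesis using bspec[OF Gl yc] TR by simp
      qed
      moreover have "x \<in> X" using N.a_rcos_self x by blast
      ultimately have "loc_map R (T_l R) ` X = {G X}" by auto
      then show ?thesis by simp
    qed
    then show ?thesis
      using ring.ring_iso_restrict[OF N.quotient_is_ring G[unfolded Q]] unfolding lsR N_def[symmetric] by metis
  qed
  have 5: "R Quot ls_rad R \<simeq> R Quot idem_compl_ideal R e"
    unfolding lsR Ke by (rule ring_iso_refl)
  let ?PM = "product_ring M (\<lambda>g. R Quot R.right_ann g)"
  have PM: "product_ring M (\<lambda>e'. R Quot idem_compl_ideal R e') = ?PM"
    unfolding product_ring_def using compl OA.semicentral
    by (auto simp: fun_eq_iff intro!: PiE_cong restrict_ext)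
  have ringPM: "ring ?PM"
    by (rule ring_product_ring)
      (rule ideal.quotient_is_ring[OF R.right_semicentral_ideal[OF OA.semicentral]])
  have 6: "R Quot idem_compl_ideal R e \<simeq> ?PM"
    using OA.quotient_total_iso e Ke by simp
  have 7: "?PM \<simeq> product_ring (max_Den_l R) (\<lambda>S. left_localization R S)"
    using OR.product_localization_iso .
  have 8: "product_ring (max_Den_l R) (\<lambda>S. left_localization R S) \<simeq>
      product_ring (max_Den_l A) (\<lambda>S'. left_localization A S')"
    using ring_iso_trans[OF ring_iso_sym[OF ringPM 7] OA.product_localization_iso] .
  show ?thesis
    using 1 2 3 4 5 6 7 8 lsR lR Ke PM unfolding M_def by simp
qed

end
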